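(* Let $E$ be a sequential effect space with sequential product $\circ$ and associated order unit space $V$, and suppose that $V$ is also a real Hilbert space with respect to an inner product $\langle\cdot,\cdot\rangle$. If the sequential product is symmetric with respect to the inner product, i.e. $\langle a\circ b,c\rangle=\langle b,a\circ c\rangle$ for all $a,b,c\in E$, then $E$ is the unit interval of a Euclidean Jordan algebra (that is, $V$, with its given order and unit, is a Euclidean Jordan algebra), and the sequential product is identical to its standard sequential product: $a\circ b=Q_{\sqrt a}(b)$ for all $a,b\in E$.
   Context: Effect algebra: a set $E$ with elements $0,1$ and a partially defined operation $+$ that is commutative and associative (where defined: if $x+y$ is defined so is $y+x$ and they are equal; if $y+z$ and $x+(y+z)$ are defined then so are $x+y$ and $(x+y)+z$, and $x+(y+z)=(x+y)+z$), with $x+0=x$ always defined, such that $x+1$ defined implies $x=0$, and such that each $x$ has a unique $x^\perp$ with $x+x^\perp=1$. It is partially ordered by $x\leq y\iff\exists z: x+z=y$. Sequential effect algebra (SEA): an effect algebra with a total binary operation $\circ$ (the sequential product) such that, writing $a\mid b$ for $a\circ b=b\circ a$: (1) $a\circ(b+c)=a\circ b+a\circ c$ whenever $b+c$ is defined; (2) $1\circ a=a$; (3) $a\circ b=0\Rightarrow b\circ a=0$; (4) if $a\mid b$ then $a\mid b^\perp$ and $a\circ(b\circ c)=(a\circ b)\circ c$ for all $c$; (5) if $c\mid a$ and $c\mid b$ then $c\mid(a\circ b)$ and, if $a+b$ is defined, $c\mid(a+b)$. $\sigma$-SEA: a SEA in which every descending sequence $a_1\geq a_2\geq\cdots$ has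 an infimum $\bigwedge a_i$, with $b\circ\bigwedge a_i=\bigwedge(b\circ a_i)$, and $b\mid a_i$ for all $i$ implies $b\mid\bigwedge a_i$. Convex effect algebra: an effect algebra with an action $[0,1]\times E\to E$ such that for $r,s\in[0,1]$: if $r+s\leq 1$ then $ra+sa$ is defined and equals $(r+s)a$; $(rs)a=r(sa)$; $0a=0$, $1a=a$; if $a+b$ is defined then $ra+rb$ is defined and equals $r(a+b)$. A sequential effect space (SES) is a convex $\sigma$-SEA. An order unit space $(V,C,1)$ is a real vector space with a proper cone $C$ ($C\cap(-C)=\{0\}$, $\mathrm{span}(C)=V$), ordered by $v\leq w\iff w-v\in C$, with an element $1$ such that every $v$ satisfies $-n1\leq v\leq n1$ for some $n\in\mathbb N$, and $v\leq\frac1n1$ for all $n\geq 1$ implies $v\leq 0$. Every SES $E$ is isomorphic, as a convex effect algebra, to the unit interval $[0,1]_V=\{v: 0\leq v\leq 1\}$ of an order unit space $V$ (with $+$ defined when the sum is $\leq 1$); this $V$ is its associated order unit space, and $E$ is identified with $[0,1]_V$. Here "$V$ is a Hilbert space with respect to $\langle\cdot,\cdot\rangle$" means the inner product is positive definite and $V$ is complete in the norm it induces. A Jordan algebra is a real vector space with a bilinear commutative operation $*$ with unit $1$ satisfying $a^2*(b*a)=(a^2*b)*a$, where $a^2=a*a$; $a\geq 0$ iff $a=b*b$ for some $b$. It is a Euclidean Jordan algebra if it is a real Hilbert space with $\langle a*b,c\rangle=\langle b,a*c\rangle$ and such that $a\geq 0$ iff $\langle a,b\rangle\geq 0$ for all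 $b\geq 0$ (finite-dimensionality is not assumed). Its quadratic representation is $Q_a(b)=2a*(a*b)-a^2*b$, and $\sqrt a$ is the unique positive square root of a positive $a$. *)

theory Defs
  imports "HOL-Analysis.Analysis"
begin

text \<open>The partial addition takes values in an option type: \<open>padd x y = None\<close> means that
  \<open>x + y\<close> is undefined. All axioms are relativised to the carrier \<open>E\<close>.\<close>

locale effect_algebra =
  fixes E :: "'e set" and zero one :: 'e and padd :: "'e \<Rightarrow> 'e \<Rightarrow> 'e option"
  assumes zero_closed: "zero \<in> E"
    and one_closed: "one \<in> E"
    and padd_closed: "\<lbrakk>x \<in> E; y \<in> E; padd x y = Some z\<rbrakk> \<Longrightarrow> z \<in> E"
    and padd_commute: "\<lbrakk>x \<in> E; y \<in> E\<rbrakk> \<Longrightarrow> padd x y = padd y x"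
    and padd_assoc: "\<lbrakk>x \<in> E; y \<in> E; z \<in> E; padd y z = Some s; padd x s = Some t\<rbrakk>
          \<Longrightarrow> \<exists>w. padd x y = Some w \<and> padd w z = Some t"
    and padd_zero: "x \<in> E \<Longrightarrow> padd x zero = Some x"
    and padd_one: "\<lbrakk>x \<in> E; padd x one \<noteq> None\<rbrakk> \<Longrightarrow> x = zero"
    and orthosupplement: "x \<in> E \<Longrightarrow> \<exists>!y. y \<in> E \<and> padd x y = Some one"
begin

definition orth :: "'e \<Rightarrow> 'e" where
  "orth x = (THE y. y \<in> E \<and> padd x y = Some one)"

definition le :: "'e \<Rightarrow> 'e \<Rightarrow> bool" where
  "le x y \<longleftrightarrow> (\<exists>z\<in>E. padd x z = Some y)"

definition is_seq_inf :: "(nat \<Rightarrow> 'e) \<Rightarrow> 'e \<Rightarrow> bool" where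
  "is_seq_inf a m \<longleftrightarrow>
     m \<in> E \<and> (\<forall>i. le m (a i)) \<and> (\<forall>l\<in>E. (\<forall>i. le l (a i)) \<longrightarrow> le l m)"

definition descending :: "(nat \<Rightarrow> 'e) \<Rightarrow> bool" where
  "descending a \<longleftrightarrow> (\<forall>i. a i \<in> E) \<and> (\<forall>i. le (a (Suc i)) (a i))"

end

locale sequential_effect_algebra = effect_algebra E zero one padd
  for E :: "'e set" and zero one :: 'e and padd :: "'e \<Rightarrow> 'e \<Rightarrow> 'e option" +
  fixes sp :: "'e \<Rightarrow> 'e \<Rightarrow> 'e"
  assumes sp_closed: "\<lbrakk>a \<in> E; b \<in> E\<rbrakk> \<Longrightarrow> sp a b \<in> E"
    and sp_padd: "\<lbrakk>a \<in> E; b \<in> E; c \<in> E; padd b c = Some d\<rbrakk>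
          \<Longrightarrow> padd (sp a b) (sp a c) = Some (sp a d)"
    and sp_one: "a \<in> E \<Longrightarrow> sp one a = a"
    and sp_zero_sym: "\<lbrakk>a \<in> E; b \<in> E; sp a b = zero\<rbrakk> \<Longrightarrow> sp b a = zero"
    and commuting_orth: "\<lbrakk>a \<in> E; b \<in> E; sp a b = sp b a\<rbrakk> \<Longrightarrow> sp a (orth b) = sp (orth b) a"
    and commuting_assoc: "\<lbrakk>a \<in> E; b \<in> E; sp a b = sp b a; c \<in> E\<rbrakk>
          \<Longrightarrow> sp a (sp b c) = sp (sp a b) c"
    and commuting_sp: "\<lbrakk>a \<in> E; b \<in> E; c \<in> E; sp c a = sp a c; sp c b = sp b c\<rbrakk>
          \<Longrightarrow> sp c (sp a b) = sp (sp a b) c"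
    and commuting_padd: "\<lbrakk>a \<in> E; b \<in> E; c \<in> E; sp c a = sp a c; sp c b = sp b c;
            padd a b = Some d\<rbrakk> \<Longrightarrow> sp c d = sp d c"

locale sigma_sequential_effect_algebra = sequential_effect_algebra E zero one padd sp
  for E :: "'e set" and zero one :: 'e and padd :: "'e \<Rightarrow> 'e \<Rightarrow> 'e option"
    and sp :: "'e \<Rightarrow> 'e \<Rightarrow> 'e" +
  assumes seq_inf_exists: "descending a \<Longrightarrow> \<exists>m. is_seq_inf a m"
    and sp_seq_inf: "\<lbrakk>descending a; is_seq_inf a m; b \<in> E\<rbrakk>
          \<Longrightarrow> is_seq_inf (\<lambda>i. sp b (a i)) (sp b m)"
    and commuting_seq_inf: "\<lbrakk>descending a; is_seq_inf a m; b \<in> E; \<And>i. sp b (a i) = sp (a i) b\<rbrakk>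
          \<Longrightarrow> sp b m = sp m b"

locale convex_effect_algebra = effect_algebra E zero one padd
  for E :: "'e set" and zero one :: 'e and padd :: "'e \<Rightarrow> 'e \<Rightarrow> 'e option" +
  fixes scal :: "real \<Rightarrow> 'e \<Rightarrow> 'e"
  assumes scal_closed: "\<lbrakk>r \<in> {0..1}; a \<in> E\<rbrakk> \<Longrightarrow> scal r a \<in> E"
    and scal_add: "\<lbrakk>r \<in> {0..1}; s \<in> {0..1}; r + s \<le> 1; a \<in> E\<rbrakk>
          \<Longrightarrow> padd (scal r a) (scal s a) = Some (scal (r + s) a)"
    and scal_mult: "\<lbrakk>r \<in> {0..1}; s \<in> {0..1}; a \<in> E\<rbrakk> \<Longrightarrow> scal (r * s) a = scal r (scal s a)"
    and scal_0: "a \<in> E \<Longrightarrow> scal 0 a = zero"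
    and scal_1: "a \<in> E \<Longrightarrow> scal 1 a = a"
    and scal_padd: "\<lbrakk>r \<in> {0..1}; a \<in> E; b \<in> E; padd a b = Some c\<rbrakk>
          \<Longrightarrow> padd (scal r a) (scal r b) = Some (scal r c)"

locale sequential_effect_space =
  sigma_sequential_effect_algebra E zero one padd sp + convex_effect_algebra E zero one padd scal
  for E :: "'e set" and zero one :: 'e and padd :: "'e \<Rightarrow> 'e \<Rightarrow> 'e option"
    and sp :: "'e \<Rightarrow> 'e \<Rightarrow> 'e" and scal :: "real \<Rightarrow> 'e \<Rightarrow> 'e"

definition convex_effect_algebra_iso ::
  "'e set \<Rightarrow> 'e \<Rightarrow> 'e \<Rightarrow> ('e \<Rightarrow> 'e \<Rightarrow> 'e option) \<Rightarrow> (real \<Rightarrow> 'e \<Rightarrow> 'e) \<Rightarrow>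
   'f set \<Rightarrow> 'f \<Rightarrow> 'f \<Rightarrow> ('f \<Rightarrow> 'f \<Rightarrow> 'f option) \<Rightarrow> (real \<Rightarrow> 'f \<Rightarrow> 'f) \<Rightarrow> ('e \<Rightarrow> 'f) \<Rightarrow> bool"
  where
  "convex_effect_algebra_iso E zero one padd scal E' zero' one' padd' scal' \<phi> \<longleftrightarrow>
     bij_betw \<phi> E E' \<and> \<phi> zero = zero' \<and> \<phi> one = one' \<and>
     (\<forall>a\<in>E. \<forall>b\<in>E. padd' (\<phi> a) (\<phi> b) = map_option \<phi> (padd a b)) \<and>
     (\<forall>r\<in>{0..1}. \<forall>a\<in>E. \<phi> (scal r a) = scal' r (\<phi> a))"

text \<open>The order is encoded by its positive cone: \<open>v \<le> w\<close> is \<open>w - v \<in> C\<close>.\<close>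

locale order_unit_space =
  fixes C :: "'v::real_vector set" and u :: 'v
  assumes cone: "convex_cone C"
    and cone_proper: "C \<inter> uminus ` C = {0}"
    and cone_span: "span C = UNIV"
    and order_unit: "\<exists>n::nat. v - (- (real n *\<^sub>R u)) \<in> C \<and> real n *\<^sub>R u - v \<in> C"
    and archimedean: "(\<And>n::nat. n \<ge> 1 \<Longrightarrow> (1 / real n) *\<^sub>R u - v \<in> C) \<Longrightarrow> 0 - v \<in> C"

definition unit_interval :: "'v::real_vector set \<Rightarrow> 'v \<Rightarrow> 'v set" where
  "unit_interval C u = {v. v \<in> C \<and> u - v \<in> C}"

definition unit_interval_padd :: "'v::real_vector set \<Rightarrow> 'v \<Rightarrow> 'v \<Rightarrow> 'v \<Rightarrow> 'v option" where
  "unit_interval_padd C u v w = (if u - (v + w) \<in> C then Some (v + w) else None)"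

text \<open>\<open>V\<close>, the whole type \<open>'v\<close> with cone \<open>C\<close> and unit \<open>u\<close>, is the order unit space associated
  with the convex effect algebra \<open>E\<close>, and \<open>\<phi>\<close> is the map identifying \<open>E\<close> with \<open>[0,1]\<^sub>V\<close>.\<close>

definition associated_order_unit_space ::
  "'e set \<Rightarrow> 'e \<Rightarrow> 'e \<Rightarrow> ('e \<Rightarrow> 'e \<Rightarrow> 'e option) \<Rightarrow> (real \<Rightarrow> 'e \<Rightarrow> 'e) \<Rightarrow>
   'v::real_vector set \<Rightarrow> 'v \<Rightarrow> ('e \<Rightarrow> 'v) \<Rightarrow> bool"
  where
  "associated_order_unit_space E zero one padd scal C u \<phi> \<longleftrightarrow>
     order_unit_space C u \<and>
     convex_effect_algebra_iso E zero one padd scal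
       (unit_interval C u) 0 u (unit_interval_padd C u) (*\<^sub>R) \<phi>"

locale jordan_algebra =
  fixes J :: "'v::real_vector \<Rightarrow> 'v \<Rightarrow> 'v" and u :: 'v
  assumes bilinear: "bilinear J"
    and commute: "J a b = J b a"
    and unit: "J u a = a"
    and jordan_identity: "J (J a a) (J b a) = J (J (J a a) b) a"

definition jordan_nonneg :: "('v \<Rightarrow> 'v \<Rightarrow> 'v) \<Rightarrow> 'v \<Rightarrow> bool" where
  "jordan_nonneg J a \<longleftrightarrow> (\<exists>b. a = J b b)"

definition jordan_quad :: "('v::real_vector \<Rightarrow> 'v \<Rightarrow> 'v) \<Rightarrow> 'v \<Rightarrow> 'v \<Rightarrow> 'v" where
  "jordan_quad J a b = 2 *\<^sub>R J a (J a b) - J (J a a) b"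

text \<open>In a Euclidean Jordan algebra every positive element has exactly one positive square root,
  so there the description below denotes it; elsewhere the value may be arbitrary.\<close>

definition jordan_sqrt :: "('v \<Rightarrow> 'v \<Rightarrow> 'v) \<Rightarrow> 'v \<Rightarrow> 'v" where
  "jordan_sqrt J a = (THE s. jordan_nonneg J s \<and> J s s = a)"

text \<open>The Hilbert space structure is that of the type class: an inner product whose induced norm
  is complete. No relation between this norm and an order unit norm, and no
  finite-dimensionality, is assumed.\<close>

locale euclidean_jordan_algebra = jordan_algebra J u
  for J :: "'v::{real_inner,complete_space} \<Rightarrow> 'v \<Rightarrow> 'v" and u :: 'v +
  assumes inner_symmetric: "inner (J a b) c = inner b (J a c)"
    and self_dual: "jordan_nonneg J a \<longleftrightarrow> (\<forall>b. jordan_nonneg J b \<longrightarrow> inner a b \<ge> 0)"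

end

theory Submission
  imports Defs
begin

text \<open>Write \<open>1\<close> for the order unit \<open>u\<close>. Left multiplication by an effect \<open>a\<close> extends to a symmetric linear operator \<open>L a\<close>, bounded by
  Hellinger-Toeplitz. Norm completeness of the order unit space makes \<open>1 - s (L a)\<^sup>2\<close> surjective for
  \<open>0 < s < 1\<close>, so \<open>L a\<close> is a contraction; hence the order unit norm and the Hilbert norm are
  equivalent and the cone is closed. The powers of an effect of order unit norm \<open>1\<close> then converge to
  a nonzero sharp element, and since the Hilbert norms of nonzero sharp elements are bounded below,
  every element is a finite combination of pairwise orthogonal atoms.

  For a sharp \<open>e\<close> and an atom \<open>q\<close> the vectors \<open>L (e + r (1 - e)) q\<close> with \<open>0 < r \<le> 1\<close> are multiples of
  atoms \<open>q\<^sub>r\<close>. Since \<open>\<langle>q\<^sub>r, 1 - q\<^sub>s\<rangle> \<ge> 0\<close>, the trace \<open>\<langle>1, q\<^sub>r\<rangle>\<close> changes at most quadratically in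
  \<open>r\<close> and is therefore constant. Letting \<open>r\<close> tend to \<open>0\<close>, nonorthogonal atoms have equal traces and
  \<open>1 - p\<close> compresses atoms to multiples of atoms. These two facts give \<open>T p q = T q p\<close> for atoms,
  where \<open>T p = (1 + L p - L (1 - p)) / 2\<close>; thus \<open>T\<close> extends to a commutative bilinear product, in
  which \<open>T p\<close> and \<open>T q\<close> commute for orthogonal \<open>p\<close>, \<open>q\<close>. The constancy of the trace also forces
  \<open>L (1 - p + r p)\<close> to act as \<open>\<surd>r\<close> on the Peirce half space of \<open>p\<close>, which identifies \<open>L a\<close> with the
  quadratic representation of \<open>\<surd>a\<close>.\<close>

section \<open>Symmetric operators on Hilbert spaces\<close>

text \<open>Operators with different left factors are compared through commuting pairs, where
  associativity gives \<open>L (L a b) x = L a (L b x)\<close>, and commutation in turn is mostly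
  produced from zero products, since \<open>a \<odot> b = 0\<close> forces
  \<open>b \<odot> a = 0\<close>. This singles out pairs \<open>e\<close>, \<open>u - e\<close> with
  \<open>e\<close> sharp, and the paths built from them: their members multiply like the parameters
  \<open>r\<close>.

  The second obstacle is that infima live in the order while the inner product lives in the Hilbert
  norm; until the two norms are compared, no positivity argument survives a Hilbert limit.

  The functional \<open>inner u\<close> acts as a trace because
  \<open>inner u p = (norm p)\<^sup>2\<close> for sharp \<open>p\<close>. Conversely this equation
  characterises sharpness among effects, in a form that passes to limits.

  \<open>T p\<close> is what Jordan multiplication by an idempotent must be: \<open>1\<close>,
  \<open>1/2\<close> and \<open>0\<close> on the three Peirce spaces of \<open>p\<close>.\<close>

lemma closed_cover_contains_ball:
  fixes S :: "nat \<Rightarrow> 'a::{real_normed_vector,complete_space} set"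
  assumes closed: "\<And>n. closed (S n)" and cover: "(\<Union>n. S n) = UNIV"
  shows "\<exists>n x e. e > 0 \<and> ball x e \<subseteq> S n"
proof (rule ccontr)
  assume contra: "\<not> ?thesis"
  have complete: "Met_TC.mcomplete TYPE('a)"
    unfolding Met_TC.mcomplete_def
    by (metis Cauchy_convergent_iff MCauchy_iff_Cauchy UNIV_I convergent_def limitin_iff_tendsto)
  have "interior (S n) = {}" for n
    using contra by (meson equals0I mem_interior)
  then have "interior (\<Union>(range S)) = {}"
    using Met_TC.metric_Baire_category_alt[OF complete, of "range S"] closed by auto
  then show False
    using cover by simp
qed

text \<open>Baire's theorem applies to the sets where \<open>norm (f x)\<close> is at most
  \<open>n\<close>. Symmetry makes them closed: \<open>norm (f x)\<close> is the supremum over unit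
  vectors \<open>y\<close> of \<open>inner x (f y)\<close>, and each of these is continuous in
  \<open>x\<close> although \<open>f\<close> is not known to be.\<close>

lemma hellinger_toeplitz:
  fixes f :: "'a::{real_inner,complete_space} \<Rightarrow> 'a"
  assumes lin: "linear f" and sym: "\<And>x y. inner (f x) y = inner x (f y)"
  shows "\<exists>K. \<forall>x. norm (f x) \<le> K * norm x"
proof -
  define S where "S n = {x. norm (f x) \<le> real n}" for n :: nat
  have S_eq: "S n = (\<Inter>y\<in>cball 0 1. {x. inner x (f y) \<le> real n})" for n
  proof (intro set_eqI iffI)
    fix x assume "x \<in> S n"
    then have "norm (f x) \<le> real n" by (simp add: S_def)
    moreover have "inner (f x) y \<le> norm (f x)" if "norm y \<le> 1" for y
      using norm_cauchy_schwarz[of "f x" y] mult_left_mono[OF that norm_ge_zero[of "f x"]] by simp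
    ultimately show "x \<in> (\<Inter>y\<in>cball 0 1. {x. inner x (f y) \<le> real n})"
      using sym by (fastforce intro: order_trans)
  next
    fix x assume x: "x \<in> (\<Inter>y\<in>cball 0 1. {x. inner x (f y) \<le> real n})"
    show "x \<in> S n"
    proof (cases "f x = 0")
      case False
      define y where "y = f x /\<^sub>R norm (f x)"
      have "y \<in> cball 0 1" using False by (simp add: y_def)
      then have "inner (f x) y \<le> real n" using x sym by auto
      moreover have "inner (f x) y = norm (f x)"
        using False by (simp add: y_def dot_square_norm power2_eq_square field_simps)
      ultimately show ?thesis by (simp add: S_def)
    qed (simp add: S_def)
  qed
  have "closed (S n)" for n
    unfolding S_eq
    by (intro closed_INT ballI closed_Collect_le continuous_intros)
  moreover have "(\<Union>n. S n) = UNIV"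
    using real_arch_simple by (fastforce simp: S_def)
  ultimately obtain n x0 e where e: "e > 0" "ball x0 e \<subseteq> S n"
    using closed_cover_contains_ball by blast
  have bound: "norm (f x) \<le> (4 * real n / e) * norm x" for x
  proof (cases "x = 0")
    case False
    define y where "y = (e / (2 * norm x)) *\<^sub>R x"
    have "norm y = e / 2" using False e by (simp add: y_def)
    then have "x0 + y \<in> S n" "x0 \<in> S n" using e by (auto simp: dist_norm subset_iff)
    then have "norm (f (x0 + y) - f x0) \<le> 2 * real n"
      unfolding S_def using norm_triangle_ineq4[of "f (x0 + y)" "f x0"] by simp
    then have "norm (f y) \<le> 2 * real n" by (simp add: linear_add[OF lin])
    moreover have "norm (f y) = (e / (2 * norm x)) * norm (f x)"
      unfolding y_def using e by (simp add: linear_scale[OF lin])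
    ultimately show ?thesis using e False by (simp add: field_simps)
  qed (simp add: linear_0[OF lin])
  then show ?thesis by blast
qed

text \<open>If the operator norm squared were \<open>M > 1\<close>, then \<open>1 - f\<^sup>2/M\<close> would be injective with
  bounded inverse; its positivity as a form then bounds \<open>f\<^sup>2\<close> strictly below \<open>M\<close>.\<close>

lemma symmetric_contraction_of_surj:
  fixes f :: "'a::{real_inner,complete_space} \<Rightarrow> 'a"
  assumes lin: "linear f" and sym: "\<And>x y. inner (f x) y = inner x (f y)"
    and surj: "\<And>s. 0 < s \<Longrightarrow> s < 1 \<Longrightarrow> surj (\<lambda>x. x - s *\<^sub>R f (f x))"
  shows "norm (f x) \<le> norm x"
proof -
  obtain K0 where K0: "\<And>x. norm (f x) \<le> K0 * norm x"
    using hellinger_toeplitz[OF lin sym] by blast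
  have bl: "bounded_linear f"
    using lin K0 by (intro bounded_linear_intro[where K = K0])
      (auto simp: linear_add linear_scale mult.commute)
  define N where "N = onorm f"
  have N: "norm (f x) \<le> N * norm x" for x
    unfolding N_def by (rule onorm[OF bl])
  have N0: "0 \<le> N" unfolding N_def by (rule onorm_pos_le[OF bl])
  show ?thesis
  proof (cases "N \<le> 1")
    case True
    then show ?thesis using N[of x] mult_right_mono[OF True norm_ge_zero[of x]] by simp
  next
    case False
    define s where "s = 1 / N\<^sup>2"
    define T where "T x = x - s *\<^sub>R f (f x)" for x
    have s: "0 < s" "s < 1" using False by (auto simp: s_def field_simps)
    have linT: "linear T"
      unfolding T_def by (intro linearI)
        (auto simp: linear_add[OF lin] linear_scale[OF lin] algebra_simps)
    have symT: "inner (T x) y = inner x (T y)" for x y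
      by (simp add: T_def inner_diff sym)
    have surjT: "surj T" using surj[OF s] by (simp add: T_def)
    have injT: "inj T"
      unfolding linear_injective_0[OF linT]
    proof (intro allI impI)
      fix x assume "T x = 0"
      then have "inner x (T y) = 0" for y using symT[of x y] by simp
      then show "x = 0" using surjT by (metis inner_eq_zero_iff surjD)
    qed
    define R where "R = inv T"
    have TR: "T (R x) = x" for x unfolding R_def by (rule surj_f_inv_f[OF surjT])
    have RT: "R (T x) = x" for x unfolding R_def by (rule inv_f_f[OF injT])
    have linR: "linear R"
      by (rule linearI; rule injD[OF injT])
        (simp_all add: TR linear_add[OF linT] linear_scale[OF linT])
    have symR: "inner (R x) y = inner x (R y)" for x y
      using symT[of "R x" "R y"] by (simp add: TR)
    obtain K where K: "\<And>x. norm (R x) \<le> K * norm x"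
      using hellinger_toeplitz[OF linR symR] by blast
    \<comment> \<open>A bound of at least \<open>1\<close> keeps \<open>1 - 1 / L\<^sup>2\<close>
      nonnegative, so that its square root can serve as an operator bound.\<close>
    define L where "L = max K 1"
    have L: "L \<ge> 1" "norm (R x) \<le> L * norm x" for x
      using order_trans[OF K[of x] mult_right_mono[of K L "norm x"]] by (auto simp: L_def)
    \<comment> \<open>Since \<open>s * N\<^sup>2 = 1\<close>, the quartic term in
      \<open>(norm (T x))\<^sup>2\<close> is at most \<open>s * (norm (f x))\<^sup>2\<close> and
      cancels half of the middle term. Bounded invertibility of \<open>T\<close> then gives a bound
      on \<open>f\<close> strictly below \<open>N\<close>.\<close>
    have "(norm (f x))\<^sup>2 \<le> N\<^sup>2 * (1 - 1 / L\<^sup>2) * (norm x)\<^sup>2" for x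
    proof -
      have "norm x \<le> L * norm (T x)" using L(2)[of "T x"] by (simp add: RT)
      then have "(norm x)\<^sup>2 \<le> L\<^sup>2 * (norm (T x))\<^sup>2"
        using power_mono[of "norm x" "L * norm (T x)" 2] by (simp add: power_mult_distrib)
      moreover have "(norm (T x))\<^sup>2 = (norm x)\<^sup>2 - 2 * s * (norm (f x))\<^sup>2 + s\<^sup>2 * (norm (f (f x)))\<^sup>2"
      proof -
        have "inner x (f (f x)) = inner (f x) (f x)" "inner (f (f x)) x = inner (f x) (f x)"
          by (metis sym)+
        then show ?thesis
          unfolding T_def power2_norm_eq_inner inner_diff inner_scaleR_left inner_scaleR_right
          by (simp only:) (simp add: power2_eq_square right_diff_distrib)
      qed
      moreover have "s\<^sup>2 * (norm (f (f x)))\<^sup>2 \<le> s * (norm (f x))\<^sup>2"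
      proof -
        have "(norm (f (f x)))\<^sup>2 \<le> N\<^sup>2 * (norm (f x))\<^sup>2"
          using power_mono[OF N[of "f x"], of 2] by (simp add: power_mult_distrib)
        then have "s\<^sup>2 * (norm (f (f x)))\<^sup>2 \<le> s\<^sup>2 * (N\<^sup>2 * (norm (f x))\<^sup>2)"
          by (simp add: mult_left_mono)
        also have "\<dots> = s * (norm (f x))\<^sup>2"
          using False by (simp add: s_def power2_eq_square)
        finally show ?thesis .
      qed
      ultimately have "(norm x)\<^sup>2 \<le> L\<^sup>2 * (norm (T x))\<^sup>2"
        "(norm (T x))\<^sup>2 \<le> (norm x)\<^sup>2 - s * (norm (f x))\<^sup>2" by linarith+
      then have "(norm x)\<^sup>2 \<le> L\<^sup>2 * ((norm x)\<^sup>2 - s * (norm (f x))\<^sup>2)"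
        using mult_left_mono[OF _ zero_le_power2[of L]] order_trans by blast
      then show ?thesis using L(1) False by (simp add: s_def field_simps)
    qed
    then have bound: "norm (f x) \<le> sqrt (N\<^sup>2 * (1 - 1 / L\<^sup>2)) * norm x" for x
      using real_le_rsqrt[of "norm (f x)" "N\<^sup>2 * (1 - 1 / L\<^sup>2) * (norm x)\<^sup>2"]
      by (simp only: real_sqrt_mult[of _ "(norm x)\<^sup>2"] real_sqrt_abs abs_norm_cancel)
    have "0 \<le> sqrt (N\<^sup>2 * (1 - 1 / L\<^sup>2))"
      using L(1) by (simp add: zero_le_mult_iff)
    then have "onorm f \<le> sqrt (N\<^sup>2 * (1 - 1 / L\<^sup>2))"
      using bound by (rule onorm_bound)
    then have le: "N \<le> sqrt (N\<^sup>2 * (1 - 1 / L\<^sup>2))"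
      by (simp only: N_def)
    then have "0 < sqrt (N\<^sup>2 * (1 - 1 / L\<^sup>2))" using False by linarith
    then have "0 < N\<^sup>2 * (1 - 1 / L\<^sup>2)" by (simp only: real_sqrt_gt_0_iff)
    then have "N\<^sup>2 \<le> N\<^sup>2 * (1 - 1 / L\<^sup>2)"
      using power_mono[OF le N0, of 2] by (simp only: real_sqrt_pow2)
    moreover have "N\<^sup>2 * (1 - 1 / L\<^sup>2) < N\<^sup>2 * 1"
      using L(1) False by (intro mult_strict_left_mono) auto
    ultimately show ?thesis by simp
  qed
qed

text \<open>Polarisation with \<open>y\<close> a multiple of \<open>f x\<close> of the same length
  as \<open>x\<close>; the parallelogram law evaluates the sum of the two form bounds.\<close>

lemma symmetric_norm_le_of_form_le:
  fixes f :: "'a::real_inner \<Rightarrow> 'a"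
  assumes lin: "linear f" and sym: "\<And>x y. inner (f x) y = inner x (f y)"
    and form: "\<And>x. \<bar>inner (f x) x\<bar> \<le> c * (norm x)\<^sup>2"
  shows "norm (f x) \<le> c * norm x"
proof (cases "f x = 0 \<or> x = 0")
  case True
  have "0 \<le> c * norm x"
  proof (cases "x = 0")
    case False
    then have "0 \<le> c" using order_trans[OF abs_ge_zero form[of x]]
      by (simp add: zero_le_mult_iff)
    then show ?thesis by simp
  qed simp
  then show ?thesis using True linear_0[OF lin] by auto
next
  case False
  define r where "r = norm x / norm (f x)"
  define y where "y = r *\<^sub>R f x"
  have r: "r > 0" using False by (simp add: r_def)
  have ny: "norm y = norm x" using False by (simp add: y_def r_def)
  have "4 * inner (f x) y = inner (f (x + y)) (x + y) - inner (f (x - y)) (x - y)"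
    by (simp add: linear_add[OF lin] linear_diff[OF lin] inner_add inner_diff sym[of y x]
        inner_commute[of y "f x"])
  also have "\<dots> \<le> c * (norm (x + y))\<^sup>2 + c * (norm (x - y))\<^sup>2"
    using form[of "x + y"] form[of "x - y"] by linarith
  also have "\<dots> = c * (2 * (norm x)\<^sup>2 + 2 * (norm y)\<^sup>2)"
    by (simp add: power2_norm_eq_inner inner_add inner_diff algebra_simps)
  finally have "inner (f x) y \<le> c * (norm x)\<^sup>2" by (simp add: ny)
  moreover have "inner (f x) y = norm x * norm (f x)"
    using False by (simp add: y_def r_def dot_square_norm power2_eq_square)
  ultimately show ?thesis using False
    by (simp add: power2_eq_square mult.left_commute[of c])
qed

text \<open>Cutting the interval into \<open>n\<close> equal pieces bounds the total change by
  \<open>K * t\<^sup>2 / n\<close>.\<close>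

lemma quadratic_variation_imp_constant:
  fixes f :: "real \<Rightarrow> real"
  assumes "\<And>s t. 0 \<le> s \<Longrightarrow> s \<le> t \<Longrightarrow> \<bar>f t - f s\<bar> \<le> K * (t - s)\<^sup>2" and "0 \<le> t"
  shows "f t = f 0"
proof -
  have step: "\<bar>f (real k * h) - f 0\<bar> \<le> real k * (K * h\<^sup>2)" if "0 \<le> h" for k :: nat and h
  proof (induction k)
    case (Suc k)
    have "\<bar>f (real (Suc k) * h) - f (real k * h)\<bar> \<le> K * (real (Suc k) * h - real k * h)\<^sup>2"
      using that by (intro assms(1)) (auto simp: algebra_simps)
    then have "\<bar>f (real (Suc k) * h) - f (real k * h)\<bar> \<le> K * h\<^sup>2"
      by (simp add: algebra_simps)
    then show ?case using Suc by (simp add: algebra_simps)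
  qed simp
  have bound: "\<bar>f t - f 0\<bar> \<le> K * t\<^sup>2 * inverse (real (Suc n))" for n
    using step[of "t / real (Suc n)" "Suc n"] \<open>0 \<le> t\<close>
    by (simp add: power2_eq_square field_simps del: of_nat_Suc)
  have "(\<lambda>n. K * t\<^sup>2 * inverse (real (Suc n))) \<longlonglongrightarrow> K * t\<^sup>2 * 0"
    by (intro tendsto_mult tendsto_const LIMSEQ_inverse_real_of_nat)
  then have "\<bar>f t - f 0\<bar> \<le> 0"
    using bound by (intro LIMSEQ_le_const) auto
  then show ?thesis by simp
qed

text \<open>The norms \<open>inner (f\<^sup>n x) (f\<^sup>n x)\<close> decrease and \<open>inner (f\<^sup>m x) (f\<^sup>n x)\<close> depends only on
  \<open>m + n\<close>, which makes the even powers a Cauchy sequence.\<close>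

lemma even_powers_of_symmetric_contraction_convergent:
  fixes f :: "'a::{real_inner,complete_space} \<Rightarrow> 'a"
  assumes sym: "\<And>x y. inner (f x) y = inner x (f y)" and contr: "\<And>x. norm (f x) \<le> norm x"
  shows "convergent (\<lambda>n. (f ^^ (2 * n)) x)"
proof -
  have symn: "inner ((f ^^ n) x) y = inner x ((f ^^ n) y)" for n x y
    by (induction n arbitrary: x) (simp_all add: sym funpow_swap1)
  define c where "c n = inner x ((f ^^ n) x)" for n
  have c: "inner ((f ^^ m) x) ((f ^^ n) x) = c (m + n)" for m n
    by (simp add: c_def symn funpow_add)
  define d where "d n = c (2 * n)" for n
  have d_norm: "d n = (norm ((f ^^ n) x))\<^sup>2" for n
    using c[of n n] by (simp add: d_def power2_norm_eq_inner mult_2)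
  have "decseq d"
    unfolding decseq_Suc_iff by (auto simp: d_norm intro!: power_mono contr)
  then have "convergent d"
    using decseq_convergent[of d 0] by (metis convergent_def d_norm zero_le_power2)
  then obtain l where l: "d \<longlonglongrightarrow> l" by (auto simp: convergent_def)
  have "Cauchy (\<lambda>n. (f ^^ (2 * n)) x)"
  proof (rule metric_CauchyI)
    fix e :: real assume e: "0 < e"
    then obtain N where N: "\<And>n. n \<ge> N \<Longrightarrow> \<bar>d n - l\<bar> < e\<^sup>2 / 4"
      using l unfolding LIMSEQ_iff by (metis divide_pos_pos real_norm_def zero_less_numeral zero_less_power)
    have "dist ((f ^^ (2 * m)) x) ((f ^^ (2 * n)) x) < e" if "m \<ge> N" "n \<ge> N" for m n
    proof -
      have "(dist ((f ^^ (2 * m)) x) ((f ^^ (2 * n)) x))\<^sup>2 = d (2 * m) + d (2 * n) - 2 * d (m + n)"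
        unfolding dist_norm power2_norm_eq_inner inner_diff
        by (simp add: c d_def algebra_simps)
      also have "\<dots> < e\<^sup>2"
        using N[of "2 * m", unfolded abs_less_iff] N[of "2 * n", unfolded abs_less_iff]
          N[of "m + n", unfolded abs_less_iff] that by linarith
      finally show ?thesis using e power_less_imp_less_base by fastforce
    qed
    then show "\<exists>M. \<forall>m\<ge>M. \<forall>n\<ge>M. dist ((f ^^ (2 * m)) x) ((f ^^ (2 * n)) x) < e" by blast
  qed
  then show ?thesis by (rule Cauchy_convergent)
qed

section \<open>Order unit spaces\<close>

context order_unit_space
begin

lemma C_add: "x \<in> C \<Longrightarrow> y \<in> C \<Longrightarrow> x + y \<in> C"
  by (rule convex_cone_add[OF cone])

lemma C_scaleR: "0 \<le> r \<Longrightarrow> x \<in> C \<Longrightarrow> r *\<^sub>R x \<in> C"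
  by (rule convex_cone_scaleR[OF cone])

lemma C_0: "0 \<in> C"
  by (rule convex_cone_contains_0[OF cone])

lemma C_sum: "(\<And>i. i \<in> A \<Longrightarrow> f i \<in> C) \<Longrightarrow> sum f A \<in> C"
  by (induction A rule: infinite_finite_induct) (auto simp: C_0 C_add)

lemma C_antisym: "x \<in> C \<Longrightarrow> - x \<in> C \<Longrightarrow> x = 0"
  using cone_proper by (metis IntI equation_minus_iff imageI singletonD)

lemma C_trans: "y - x \<in> C \<Longrightarrow> z - y \<in> C \<Longrightarrow> z - x \<in> C"
  using C_add[of "y - x" "z - y"] by simp

lemma C_scaleR_cancel: "0 < r \<Longrightarrow> r *\<^sub>R x \<in> C \<longleftrightarrow> x \<in> C"
  using C_scaleR[of "1 / r" "r *\<^sub>R x"] C_scaleR[of r x] by auto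

lemma u_in_C: "u \<in> C"
proof -
  obtain n :: nat where "u - (- (real n *\<^sub>R u)) \<in> C"
    using order_unit by blast
  then have "(1 + real n) *\<^sub>R u \<in> C" by (simp add: scaleR_add_left)
  then show ?thesis by (subst (asm) C_scaleR_cancel) auto
qed

section \<open>The order unit norm, expressed through its closed balls\<close>

definition order_ball :: "real \<Rightarrow> 'v set" where
  "order_ball r = {x. r *\<^sub>R u - x \<in> C \<and> r *\<^sub>R u + x \<in> C}"

lemma order_ball_mono: "x \<in> order_ball r \<Longrightarrow> r \<le> s \<Longrightarrow> x \<in> order_ball s"
  using C_add[of "r *\<^sub>R u - x" "(s - r) *\<^sub>R u"] C_add[of "r *\<^sub>R u + x" "(s - r) *\<^sub>R u"]
    C_scaleR[OF _ u_in_C, of "s - r"]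
  by (auto simp: order_ball_def algebra_simps)

lemma order_ball_exists: "\<exists>r>0. x \<in> order_ball r"
proof -
  obtain n :: nat where "x \<in> order_ball (real n)"
    using order_unit[of x] by (auto simp: order_ball_def algebra_simps)
  then have "x \<in> order_ball (real n + 1)" by (rule order_ball_mono) simp
  then show ?thesis by (intro exI[of _ "real n + 1"]) auto
qed

lemma order_ball_add: "x \<in> order_ball r \<Longrightarrow> y \<in> order_ball s \<Longrightarrow> x + y \<in> order_ball (r + s)"
  using C_add[of "r *\<^sub>R u - x" "s *\<^sub>R u - y"] C_add[of "r *\<^sub>R u + x" "s *\<^sub>R u + y"]
  by (auto simp: order_ball_def algebra_simps)

lemma order_ball_minus: "x \<in> order_ball r \<Longrightarrow> - x \<in> order_ball r"
  by (auto simp: order_ball_def)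

lemma order_ball_scaleR:
  assumes "x \<in> order_ball r" "0 \<le> c"
  shows "c *\<^sub>R x \<in> order_ball (c * r)"
  using C_scaleR[of c "r *\<^sub>R u - x"] C_scaleR[of c "r *\<^sub>R u + x"] assms
  by (auto simp: order_ball_def algebra_simps)

lemma archimedean_real:
  assumes "\<And>e. e > 0 \<Longrightarrow> e *\<^sub>R u + v \<in> C"
  shows "v \<in> C"
proof -
  have "0 - (- v) \<in> C"
    by (rule archimedean) (use assms in simp)
  then show ?thesis by simp
qed

lemma order_ball_0: 
  assumes "\<And>e. e > 0 \<Longrightarrow> v \<in> order_ball e"
  shows "v = 0"
proof (rule C_antisym)
  show "v \<in> C"
    by (rule archimedean_real) (use assms in \<open>auto simp: order_ball_def\<close>)
  show "- v \<in> C"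
    by (rule archimedean_real) (use assms in \<open>auto simp: order_ball_def\<close>)
qed

lemma mem_unit_interval: "x \<in> unit_interval C u \<longleftrightarrow> x \<in> C \<and> u - x \<in> C"
  by (simp add: unit_interval_def)

lemma unit_interval_le: "x \<in> C \<Longrightarrow> y - x \<in> C \<Longrightarrow> y \<in> unit_interval C u \<Longrightarrow> x \<in> unit_interval C u"
  by (auto simp: mem_unit_interval intro: C_trans)

lemma unit_interval_diff:
  "x \<in> C \<Longrightarrow> y - x \<in> C \<Longrightarrow> y \<in> unit_interval C u \<Longrightarrow> y - x \<in> unit_interval C u"
  by (rule unit_interval_le[of _ y]) auto

lemma unit_interval_scaleR:
  assumes "0 \<le> r" "r \<le> 1" "x \<in> unit_interval C u"
  shows "r *\<^sub>R x \<in> unit_interval C u"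
proof (rule unit_interval_le[of _ x])
  have "x - r *\<^sub>R x = (1 - r) *\<^sub>R x" by (simp add: algebra_simps)
  then show "x - r *\<^sub>R x \<in> C" using assms by (auto simp: mem_unit_interval intro: C_scaleR)
qed (use assms in \<open>auto simp: mem_unit_interval intro: C_scaleR\<close>)

lemma unit_interval_orth: "x \<in> unit_interval C u \<Longrightarrow> u - x \<in> unit_interval C u"
  by (auto simp: mem_unit_interval)

lemma u_in_unit_interval: "u \<in> unit_interval C u"
  by (simp add: mem_unit_interval u_in_C C_0)

lemma zero_in_unit_interval: "0 \<in> unit_interval C u"
  by (simp add: mem_unit_interval u_in_C C_0)

lemma unit_interval_order_ball: "x \<in> unit_interval C u \<Longrightarrow> x \<in> order_ball 1"
  by (auto simp: mem_unit_interval order_ball_def C_add u_in_C)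

text \<open>The affine rescaling of the ball of radius \<open>r\<close> to the unit interval. It
  lets statements about effects reach all vectors, in the form
  \<open>x = 2 r b - r u\<close>.\<close>

lemma order_ball_to_unit_interval:
  assumes "x \<in> order_ball r" "0 < r"
  shows "(1 / (2 * r)) *\<^sub>R (x + r *\<^sub>R u) \<in> unit_interval C u"
proof -
  have "(2 * r) *\<^sub>R u - (x + r *\<^sub>R u) = r *\<^sub>R u - x"
    unfolding mult_2 scaleR_add_left by simp
  then have "(2 * r) *\<^sub>R (u - (1 / (2 * r)) *\<^sub>R (x + r *\<^sub>R u)) = (2 * r) *\<^sub>R ((1 / (2 * r)) *\<^sub>R (r *\<^sub>R u - x))"
    using assms(2) by (simp add: scaleR_diff_right)
  then have "u - (1 / (2 * r)) *\<^sub>R (x + r *\<^sub>R u) = (1 / (2 * r)) *\<^sub>R (r *\<^sub>R u - x)"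
    using assms(2) by (simp only: scaleR_cancel_left) simp
  then show ?thesis
    using assms by (simp add: mem_unit_interval C_scaleR_cancel order_ball_def add.commute)
qed

lemma order_ball_linear_image:
  assumes lin: "linear f" and pos: "\<And>x. x \<in> C \<Longrightarrow> f x \<in> C" and fu: "u - f u \<in> C"
    and x: "x \<in> order_ball r" and r: "0 \<le> r"
  shows "f x \<in> order_ball r"
proof -
  have "r *\<^sub>R (u - f u) \<in> C" using fu r by (rule C_scaleR[rotated])
  moreover have "f (r *\<^sub>R u - x) \<in> C" "f (r *\<^sub>R u + x) \<in> C"
    using x pos by (auto simp: order_ball_def)
  ultimately have "r *\<^sub>R (u - f u) + f (r *\<^sub>R u - x) \<in> C" "r *\<^sub>R (u - f u) + f (r *\<^sub>R u + x) \<in> C"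
    by (auto intro: C_add)
  then show ?thesis
    by (simp add: order_ball_def linear_add[OF lin] linear_diff[OF lin] linear_scale[OF lin]
        scaleR_diff_right)
qed

text \<open>Homogeneity is squeezed out of additivity and monotonicity: for \<open>k \<le> r n \<le> k + 1\<close> the value
  at \<open>r x\<close> lies between those at \<open>(k/n) x\<close> and \<open>((k+1)/n) x\<close>.\<close>

lemma additive_on_unit_interval_homogeneous:
  assumes closed: "\<And>x. x \<in> unit_interval C u \<Longrightarrow> g x \<in> unit_interval C u"
    and add: "\<And>x y. x \<in> unit_interval C u \<Longrightarrow> y \<in> unit_interval C u \<Longrightarrow> x + y \<in> unit_interval C u
      \<Longrightarrow> g (x + y) = g x + g y"
    and r: "0 \<le> r" "r \<le> 1" and x: "x \<in> unit_interval C u"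
  shows "g (r *\<^sub>R x) = r *\<^sub>R g x"
proof (cases "r = 1")
  case False
  have g0: "g 0 = 0" using add[of 0 0] zero_in_unit_interval by simp
  have mono: "g z - g y \<in> C" if "y \<in> unit_interval C u" "z \<in> unit_interval C u" "z - y \<in> C" for y z
  proof -
    have "z - y \<in> unit_interval C u"
      using that unit_interval_diff mem_unit_interval by blast
    then have "g z - g y = g (z - y)" "g (z - y) \<in> C"
      using add[of y "z - y"] that closed by (auto simp: mem_unit_interval)
    then show ?thesis by simp
  qed
  have mult: "g (real k *\<^sub>R y) = real k *\<^sub>R g y"
    if "y \<in> unit_interval C u" "real k *\<^sub>R y \<in> unit_interval C u" for k :: nat and y
    using that(2)
  proof (induction k)
    case (Suc k)
    have "real k *\<^sub>R y \<in> unit_interval C u"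
      using that(1) Suc.prems by - (rule unit_interval_le[of _ "real (Suc k) *\<^sub>R y"],
        auto simp: mem_unit_interval C_scaleR algebra_simps)
    then show ?case
      using Suc that(1) add[of "real k *\<^sub>R y" y] by (simp add: algebra_simps)
  qed (simp add: g0)
  define d where "d = g (r *\<^sub>R x) - r *\<^sub>R g x"
  have approx: "(1 / real n) *\<^sub>R u - d \<in> C \<and> (1 / real n) *\<^sub>R u + d \<in> C" if n: "n \<ge> 1" for n
  proof -
    define k where "k = nat \<lfloor>r * real n\<rfloor>"
    define y where "y = (1 / real n) *\<^sub>R x"
    have "r * real n < real n" using r False n by simp
    moreover have "0 \<le> r * real n" using r by simp
    then have k: "real k \<le> r * real n" "r * real n \<le> real k + 1"
      unfolding k_def by linarith+
    ultimately have kn: "k + 1 \<le> n" by linarith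
    have y: "y \<in> unit_interval C u" unfolding y_def using n x by (intro unit_interval_scaleR) auto
    have gx: "g x = real n *\<^sub>R g y" using mult[of y n] y x n by (simp add: y_def)
    have sc: "real j *\<^sub>R y \<in> unit_interval C u" if "j \<le> n" for j
      unfolding y_def using n x that by (simp add: unit_interval_scaleR)
    have rx: "r *\<^sub>R x \<in> unit_interval C u" using r x by (intro unit_interval_scaleR)
    have gy: "g y \<in> C" using closed[OF y] by (simp add: mem_unit_interval)
    have xC: "x \<in> C" using x by (simp add: mem_unit_interval)
    have "0 \<le> r - real k / real n" "0 \<le> (real k + 1) / real n - r"
      using k n by (auto simp: field_simps)
    then have "(r - real k / real n) *\<^sub>R x \<in> C" "((real k + 1) / real n - r) *\<^sub>R x \<in> C"
      using xC by (auto intro: C_scaleR)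
    moreover have "r *\<^sub>R x - real k *\<^sub>R y = (r - real k / real n) *\<^sub>R x"
      "real (k + 1) *\<^sub>R y - r *\<^sub>R x = ((real k + 1) / real n - r) *\<^sub>R x"
      by (simp_all add: y_def algebra_simps)
    ultimately have "r *\<^sub>R x - real k *\<^sub>R y \<in> C" "real (k + 1) *\<^sub>R y - r *\<^sub>R x \<in> C"
      by simp_all
    then have "g (r *\<^sub>R x) - g (real k *\<^sub>R y) \<in> C" "g (real (k + 1) *\<^sub>R y) - g (r *\<^sub>R x) \<in> C"
      using mono[of "real k *\<^sub>R y" "r *\<^sub>R x"] mono[of "r *\<^sub>R x" "real (k + 1) *\<^sub>R y"]
        rx sc[of k] sc[of "k + 1"] kn by simp_all
    then have "g (r *\<^sub>R x) - real k *\<^sub>R g y + (real k + 1 - r * real n) *\<^sub>R g y \<in> C"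
      "real (k + 1) *\<^sub>R g y - g (r *\<^sub>R x) + (r * real n - real k) *\<^sub>R g y \<in> C"
      using mult[OF y sc[of k]] mult[OF y sc[of "k + 1"]] k kn gy by (auto intro!: C_add C_scaleR)
    \<comment> \<open>The gap between the two bounds is \<open>g y\<close>, the \<open>n\<close>-th
      part of the effect \<open>g x\<close>, hence at most \<open>u / n\<close>; the archimedean
      property then removes it.\<close>
    moreover have "(1 / real n) *\<^sub>R u - g y = (1 / real n) *\<^sub>R (u - g x)"
      using n by (simp add: gx scaleR_diff_right)
    then have "(1 / real n) *\<^sub>R u - g y \<in> C"
      using closed[OF x] by (auto simp: mem_unit_interval intro: C_scaleR)
    ultimately have "g (r *\<^sub>R x) - real k *\<^sub>R g y + (real k + 1 - r * real n) *\<^sub>R g y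
        + ((1 / real n) *\<^sub>R u - g y) \<in> C"
      "real (k + 1) *\<^sub>R g y - g (r *\<^sub>R x) + (r * real n - real k) *\<^sub>R g y
        + ((1 / real n) *\<^sub>R u - g y) \<in> C"
      by (auto intro: C_add)
    then show ?thesis by (simp add: d_def gx algebra_simps)
  qed
  have "0 - d \<in> C" using approx by (intro archimedean) auto
  moreover have "0 - (- d) \<in> C" using approx by (intro archimedean) auto
  ultimately have "d = 0" by (intro C_antisym) auto
  then show ?thesis by (simp add: d_def)
qed simp

text \<open>Writing \<open>x = 2 r b - r u\<close> with an effect \<open>b\<close> forces the value
  at \<open>x\<close>. What has to be shown is independence of \<open>r\<close>; a common large
  \<open>r\<close> then gives additivity.\<close>

lemma additive_extends_to_linear:
  assumes closed: "\<And>x. x \<in> unit_interval C u \<Longrightarrow> g x \<in> unit_interval C u"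
    and add: "\<And>x y. x \<in> unit_interval C u \<Longrightarrow> y \<in> unit_interval C u \<Longrightarrow> x + y \<in> unit_interval C u
      \<Longrightarrow> g (x + y) = g x + g y"
  shows "\<exists>f. linear f \<and> (\<forall>x\<in>unit_interval C u. f x = g x)"
proof -
  let ?I = "unit_interval C u"
  note hom = additive_on_unit_interval_homogeneous[of g, OF closed add]
  have comb: "g (s *\<^sub>R x + t *\<^sub>R y) = s *\<^sub>R g x + t *\<^sub>R g y"
    if "x \<in> ?I" "y \<in> ?I" "0 \<le> s" "0 \<le> t" "s + t \<le> 1" for s t x y
  proof -
    have *: "s *\<^sub>R x \<in> ?I" "t *\<^sub>R y \<in> ?I" using that by (auto intro!: unit_interval_scaleR)
    have "s *\<^sub>R (u - x) + t *\<^sub>R (u - y) + (1 - s - t) *\<^sub>R u \<in> C"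
      using that by (intro C_add C_scaleR) (auto simp: mem_unit_interval u_in_C)
    also have "s *\<^sub>R (u - x) + t *\<^sub>R (u - y) + (1 - s - t) *\<^sub>R u = u - (s *\<^sub>R x + t *\<^sub>R y)"
      by (simp add: algebra_simps)
    finally have "s *\<^sub>R x + t *\<^sub>R y \<in> ?I"
      using * by (auto simp: mem_unit_interval intro: C_add)
    then show ?thesis using add[of "s *\<^sub>R x" "t *\<^sub>R y"] * hom that by simp
  qed
  define F where "F r x = (2 * r) *\<^sub>R g ((1 / (2 * r)) *\<^sub>R (x + r *\<^sub>R u)) - r *\<^sub>R g u" for r x
  have F_le: "F t x = F r x" if "0 < r" "r \<le> t" "x \<in> order_ball r" for r t x
  proof -
    have "(2 * t) *\<^sub>R ((1 / (2 * t)) *\<^sub>R (x + t *\<^sub>R u))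
        = (2 * t) *\<^sub>R ((r / t) *\<^sub>R ((1 / (2 * r)) *\<^sub>R (x + r *\<^sub>R u)) + ((t - r) / (2 * t)) *\<^sub>R u)"
      using that by (simp add: scaleR_add_right scaleR_diff_left)
    then have "(1 / (2 * t)) *\<^sub>R (x + t *\<^sub>R u)
        = (r / t) *\<^sub>R ((1 / (2 * r)) *\<^sub>R (x + r *\<^sub>R u)) + ((t - r) / (2 * t)) *\<^sub>R u"
      using that by (simp only: scaleR_cancel_left) simp
    also have "g \<dots> = (r / t) *\<^sub>R g ((1 / (2 * r)) *\<^sub>R (x + r *\<^sub>R u)) + ((t - r) / (2 * t)) *\<^sub>R g u"
      using that order_ball_to_unit_interval u_in_unit_interval
      by (intro comb) (auto simp: field_simps)
    finally show ?thesis
      using that by (simp add: F_def scaleR_add_right scaleR_diff_left)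
  qed
  have F_eq: "F t x = F r x" if "0 < r" "0 < t" "x \<in> order_ball r" "x \<in> order_ball t" for r t x
    using F_le[of r "max r t" x] F_le[of t "max r t" x] that by simp
  define f where "f x = F (SOME r. 0 < r \<and> x \<in> order_ball r) x" for x
  have f: "f x = F r x" if "0 < r" "x \<in> order_ball r" for r x
    unfolding f_def using someI_ex[of "\<lambda>r. 0 < r \<and> x \<in> order_ball r"] that F_eq by blast
  have f_add: "f (x + y) = f x + f y" for x y
  proof -
    obtain r1 r2 where "0 < r1" "x \<in> order_ball r1" "0 < r2" "y \<in> order_ball r2"
      using order_ball_exists by metis
    then obtain r where r: "0 < r" "x \<in> order_ball r" "y \<in> order_ball r"
      using order_ball_mono[of _ _ "max r1 r2"] by (meson less_max_iff_disj max.cobounded1 max.cobounded2)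
    have xy: "x + y \<in> order_ball (2 * r)" using order_ball_add[OF r(2,3)] by simp
    have double: "(2 * r) *\<^sub>R z = r *\<^sub>R z + r *\<^sub>R z" for z :: 'v
      by (simp only: mult_2 scaleR_add_left)
    have "(1 / (2 * (2 * r))) *\<^sub>R (x + y + (2 * r) *\<^sub>R u)
        = (1 / 2) *\<^sub>R ((1 / (2 * r)) *\<^sub>R (x + r *\<^sub>R u)) + (1 / 2) *\<^sub>R ((1 / (2 * r)) *\<^sub>R (y + r *\<^sub>R u))"
      unfolding double by (simp add: scaleR_add_right add_ac)
    also have "g \<dots> = (1 / 2) *\<^sub>R g ((1 / (2 * r)) *\<^sub>R (x + r *\<^sub>R u))
        + (1 / 2) *\<^sub>R g ((1 / (2 * r)) *\<^sub>R (y + r *\<^sub>R u))"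
      using r order_ball_to_unit_interval by (intro comb) auto
    finally show ?thesis
      using f[OF r(1,2)] f[OF r(1,3)] f[OF _ xy] r(1) double[of "g u"]
      by (simp add: F_def scaleR_add_right)
  qed
  have f0: "f 0 = 0" using f_add[of 0 0] by simp
  have f_minus: "f (- x) = - f x" for x using f_add[of x "- x"] f0 by (simp add: eq_neg_iff_add_eq_0 add.commute)
  have f_pos: "f (c *\<^sub>R x) = c *\<^sub>R f x" if c: "0 < c" for c x
  proof -
    obtain r where r: "0 < r" "x \<in> order_ball r" using order_ball_exists by blast
    have cx: "c *\<^sub>R x \<in> order_ball (c * r)" using order_ball_scaleR[OF r(2), of c] c by simp
    have eq: "(1 / (2 * (c * r))) *\<^sub>R (c *\<^sub>R x + (c * r) *\<^sub>R u) = (1 / (2 * r)) *\<^sub>R (x + r *\<^sub>R u)"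
      using c r by (simp add: scaleR_add_right)
    then show ?thesis
      using f[OF r] f[OF _ cx] c r unfolding F_def eq by (simp add: scaleR_diff_right mult.commute)
  qed
  have "f (c *\<^sub>R x) = c *\<^sub>R f x" for c x
  proof (cases "c = 0")
    case False
    then consider "c > 0" | "- c > 0" by linarith
    then show ?thesis
    proof cases
      case 2
      then show ?thesis using f_pos[of "- c" "- x"] f_minus by simp
    qed (rule f_pos)
  qed (simp add: f0)
  moreover have "f x = g x" if "x \<in> ?I" for x
  proof -
    have "g ((1 / 2) *\<^sub>R x + (1 / 2) *\<^sub>R u) = (1 / 2) *\<^sub>R g x + (1 / 2) *\<^sub>R g u"
      using that u_in_unit_interval by (intro comb) auto
    then show ?thesis
      using f[OF _ unit_interval_order_ball[OF that]] by (simp add: F_def scaleR_add_right)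
  qed
  ultimately show ?thesis
    using f_add by (intro exI[of _ f]) (auto intro: linearI)
qed

end

section \<open>Left multiplication operators and the order unit norm\<close>

text \<open>The effect space carried over to the unit interval of \<open>V\<close>: effects are
  vectors, and definedness of a sum becomes membership of the vector sum in the interval. Infima are
  phrased with differences in the cone.\<close>

locale symmetric_sequential_product = order_unit_space C u
  for C :: "'v::{real_inner,complete_space} set" and u :: 'v +
  fixes sq :: "'v \<Rightarrow> 'v \<Rightarrow> 'v" (infixl "\<odot>" 70)
  assumes sq_closed: "\<lbrakk>a \<in> unit_interval C u; b \<in> unit_interval C u\<rbrakk>
      \<Longrightarrow> a \<odot> b \<in> unit_interval C u"
    and sq_add: "\<lbrakk>a \<in> unit_interval C u; b \<in> unit_interval C u; c \<in> unit_interval C u; b + c \<in> unit_interval C u\<rbrakk>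
      \<Longrightarrow> a \<odot> (b + c) = a \<odot> b + a \<odot> c"
    and u_sq: "a \<in> unit_interval C u \<Longrightarrow> u \<odot> a = a"
    and sq_zero_sym: "\<lbrakk>a \<in> unit_interval C u; b \<in> unit_interval C u; a \<odot> b = 0\<rbrakk>
      \<Longrightarrow> b \<odot> a = 0"
    and commute_orth: "\<lbrakk>a \<in> unit_interval C u; b \<in> unit_interval C u; a \<odot> b = b \<odot> a\<rbrakk>
      \<Longrightarrow> a \<odot> (u - b) = (u - b) \<odot> a"
    and commute_assoc: "\<lbrakk>a \<in> unit_interval C u; b \<in> unit_interval C u; a \<odot> b = b \<odot> a; c \<in> unit_interval C u\<rbrakk>
      \<Longrightarrow> a \<odot> (b \<odot> c) = (a \<odot> b) \<odot> c"
    and commute_sq: "\<lbrakk>a \<in> unit_interval C u; b \<in> unit_interval C u; c \<in> unit_interval C u; c \<odot> a = a \<odot> c; c \<odot> b = b \<odot> c\<rbrakk>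
      \<Longrightarrow> c \<odot> (a \<odot> b) = (a \<odot> b) \<odot> c"
    and commute_add: "\<lbrakk>a \<in> unit_interval C u; b \<in> unit_interval C u; c \<in> unit_interval C u; c \<odot> a = a \<odot> c; c \<odot> b = b \<odot> c; a + b \<in> unit_interval C u\<rbrakk>
      \<Longrightarrow> c \<odot> (a + b) = (a + b) \<odot> c"
    and inf_exists: "\<lbrakk>\<And>i :: nat. f i \<in> unit_interval C u; \<And>i. f i - f (Suc i) \<in> C\<rbrakk>
      \<Longrightarrow> \<exists>m\<in>unit_interval C u. (\<forall>i. f i - m \<in> C) \<and> (\<forall>l\<in>unit_interval C u. (\<forall>i. f i - l \<in> C) \<longrightarrow> m - l \<in> C)"
    and commute_inf: "\<lbrakk>\<And>i :: nat. f i \<in> unit_interval C u; \<And>i. f i - f (Suc i) \<in> C; m \<in> unit_interval C u; \<And>i. f i - m \<in> C;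
        \<And>l. l \<in> unit_interval C u \<Longrightarrow> (\<And>i. f i - l \<in> C) \<Longrightarrow> m - l \<in> C; b \<in> unit_interval C u; \<And>i. b \<odot> f i = f i \<odot> b\<rbrakk>
      \<Longrightarrow> b \<odot> m = m \<odot> b"
    and sq_symmetric: "\<lbrakk>a \<in> unit_interval C u; b \<in> unit_interval C u; c \<in> unit_interval C u\<rbrakk>
      \<Longrightarrow> inner (a \<odot> b) c = inner b (a \<odot> c)"
begin

abbreviation I :: "'v set" where
  "I \<equiv> unit_interval C u"

lemmas mem_I = mem_unit_interval
  and I_le = unit_interval_le
  and I_diff = unit_interval_diff
  and I_scaleR = unit_interval_scaleR
  and I_orth = unit_interval_orth
  and u_in_I = u_in_unit_interval
  and zero_in_I = zero_in_unit_interval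
  and order_ball_to_I = order_ball_to_unit_interval

lemma I_imp_C: "x \<in> I \<Longrightarrow> x \<in> C"
  by (simp add: mem_I)

lemma C_imp_I:
  assumes "x \<in> C" shows "\<exists>r>0. (1 / r) *\<^sub>R x \<in> I"
proof -
  obtain r where r: "0 < r" "x \<in> order_ball r" using order_ball_exists by blast
  have "u - (1 / r) *\<^sub>R x = (1 / r) *\<^sub>R (r *\<^sub>R u - x)"
    using r by (simp add: scaleR_diff_right)
  then have "(1 / r) *\<^sub>R x \<in> I"
    using r assms by (auto simp: mem_I order_ball_def C_scaleR_cancel)
  then show ?thesis using r by blast
qed

lemma I_decomposition: "\<exists>b\<in>I. \<exists>r. x = (2 * r) *\<^sub>R b - r *\<^sub>R u"
proof -
  obtain r where r: "0 < r" "x \<in> order_ball r" using order_ball_exists by blast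
  have "x = (2 * r) *\<^sub>R ((1 / (2 * r)) *\<^sub>R (x + r *\<^sub>R u)) - r *\<^sub>R u"
    using r by simp
  then show ?thesis using order_ball_to_I[OF r(2,1)] by blast
qed

lemma linear_eq_on_I:
  assumes "linear f" "linear g" "\<And>x. x \<in> I \<Longrightarrow> f x = g x"
  shows "f x = g x"
proof -
  obtain b r where "b \<in> I" "x = (2 * r) *\<^sub>R b - r *\<^sub>R u" using I_decomposition by blast
  then show ?thesis
    using assms u_in_I by (simp add: linear_diff linear_scale)
qed

text \<open>For an effect \<open>a\<close> the choice is unique, because a linear map is determined
  by its values on effects.\<close>

definition L :: "'v \<Rightarrow> 'v \<Rightarrow> 'v" where
  "L a = (SOME f. linear f \<and> (\<forall>x\<in>I. f x = a \<odot> x))"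

lemma
  assumes "a \<in> I"
  shows linear_L: "linear (L a)" and L_eq: "x \<in> I \<Longrightarrow> L a x = a \<odot> x"
proof -
  have "\<exists>f. linear f \<and> (\<forall>x\<in>I. f x = a \<odot> x)"
    using sq_closed[OF assms] sq_add[OF assms] by (intro additive_extends_to_linear)
  from someI_ex[OF this] show "linear (L a)" "x \<in> I \<Longrightarrow> L a x = a \<odot> x"
    by (auto simp: L_def)
qed

lemmas L_add = linear_add[OF linear_L]
  and L_diff = linear_diff[OF linear_L]
  and L_scaleR = linear_scale[OF linear_L]
  and L_sum = linear_sum[OF linear_L]
  and L_0 = linear_0[OF linear_L]

lemma L_symmetric: "a \<in> I \<Longrightarrow> inner (L a x) y = inner x (L a y)"
proof -
  assume a: "a \<in> I"
  obtain b r where "b \<in> I" "x = (2 * r) *\<^sub>R b - r *\<^sub>R u" using I_decomposition by blast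
  moreover obtain c s where "c \<in> I" "y = (2 * s) *\<^sub>R c - s *\<^sub>R u" using I_decomposition by blast
  ultimately show ?thesis
    using u_in_I a sq_symmetric[OF a]
    by (simp add: L_diff L_scaleR L_eq inner_diff)
qed

lemma L_closed: "a \<in> I \<Longrightarrow> x \<in> I \<Longrightarrow> L a x \<in> I"
  by (simp add: L_eq sq_closed)

lemma L_positive: "a \<in> I \<Longrightarrow> x \<in> C \<Longrightarrow> L a x \<in> C"
proof -
  assume a: "a \<in> I" and "x \<in> C"
  then obtain r where r: "r > 0" "(1 / r) *\<^sub>R x \<in> I" using C_imp_I by blast
  then have "(1 / r) *\<^sub>R L a x \<in> C"
    using L_closed[OF a r(2)] a by (simp add: L_scaleR mem_I)
  then show "L a x \<in> C" using r by (subst (asm) C_scaleR_cancel) auto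
qed

lemma L_mono: "a \<in> I \<Longrightarrow> y - x \<in> C \<Longrightarrow> L a y - L a x \<in> C"
  using L_positive[of a "y - x"] by (simp add: L_diff)

definition com :: "'v \<Rightarrow> 'v \<Rightarrow> bool" where
  "com a b \<longleftrightarrow> L a b = L b a"

lemma com_sym: "com a b \<Longrightarrow> com b a"
  by (simp add: com_def)

lemma com_refl: "com a a"
  by (simp add: com_def)

lemma com_iff: "a \<in> I \<Longrightarrow> b \<in> I \<Longrightarrow> com a b \<longleftrightarrow> a \<odot> b = b \<odot> a"
  by (simp add: com_def L_eq)

lemma L_zero_sym: "a \<in> I \<Longrightarrow> b \<in> I \<Longrightarrow> L a b = 0 \<Longrightarrow> L b a = 0"
  using sq_zero_sym by (simp add: L_eq)

lemma com_orth: "a \<in> I \<Longrightarrow> b \<in> I \<Longrightarrow> com a b \<Longrightarrow> com a (u - b)"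
  using commute_orth by (simp add: com_iff I_orth)

lemma com_orth_iff: "a \<in> I \<Longrightarrow> b \<in> I \<Longrightarrow> com a (u - b) \<longleftrightarrow> com a b"
  using com_orth[of a b] com_orth[of a "u - b"] by (auto simp: I_orth)

lemma com_L: "a \<in> I \<Longrightarrow> b \<in> I \<Longrightarrow> c \<in> I \<Longrightarrow> com c a \<Longrightarrow> com c b \<Longrightarrow> com c (L a b)"
  using commute_sq by (simp add: com_iff L_eq sq_closed)

lemma com_add: "a \<in> I \<Longrightarrow> b \<in> I \<Longrightarrow> c \<in> I \<Longrightarrow> com c a \<Longrightarrow> com c b \<Longrightarrow> a + b \<in> I \<Longrightarrow> com c (a + b)"
  using commute_add by (simp add: com_iff)

text \<open>The associativity axiom as an identity of operators, extended from effects by linearity.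
  It is the main source of relations between different left factors.\<close>

lemma L_L: "a \<in> I \<Longrightarrow> b \<in> I \<Longrightarrow> com a b \<Longrightarrow> L (L a b) x = L a (L b x)"
proof (rule linear_eq_on_I[where f = "L (L a b)" and g = "\<lambda>x. L a (L b x)"])
  assume *: "a \<in> I" "b \<in> I" "com a b"
  show "linear (L (L a b))" using * by (intro linear_L L_closed)
  show "linear (\<lambda>x. L a (L b x))"
    using linear_compose[OF linear_L[OF *(2)] linear_L[OF *(1)]] by (simp add: o_def)
  show "L (L a b) c = L a (L b c)" if "c \<in> I" for c
    using * that commute_assoc by (simp add: L_eq sq_closed com_iff)
qed

lemma L_commute: "a \<in> I \<Longrightarrow> b \<in> I \<Longrightarrow> com a b \<Longrightarrow> L a (L b x) = L b (L a x)"
  using L_L[of a b x] L_L[of b a x] com_sym[of a b] by (simp add: com_def)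

lemma L_u_left: "L u x = x"
  using linear_eq_on_I[OF linear_L[OF u_in_I] linear_id, of x] u_sq u_in_I by (simp add: L_eq)

lemma com_0: "a \<in> I \<Longrightarrow> com a 0"
  using L_zero_sym[of a 0] L_0[of a] zero_in_I by (simp add: com_def)

lemma com_u: "a \<in> I \<Longrightarrow> com a u"
  using com_orth[of a 0] com_0[of a] zero_in_I by simp

text \<open>Zero symmetry makes \<open>0\<close> commute with \<open>a\<close>, hence also its
  complement \<open>u\<close>, and \<open>u\<close> is a left unit.\<close>

lemma L_u: "a \<in> I \<Longrightarrow> L a u = a"
  using com_u[of a] by (simp add: com_def L_u_left)

lemma L_le: "a \<in> I \<Longrightarrow> x \<in> I \<Longrightarrow> a - L a x \<in> C"
  using L_mono[of a u x] by (simp add: L_u mem_I)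

lemma L_order_ball: "a \<in> I \<Longrightarrow> x \<in> order_ball r \<Longrightarrow> 0 \<le> r \<Longrightarrow> L a x \<in> order_ball r"
  by (rule order_ball_linear_image[OF linear_L])
    (auto simp: L_u L_positive mem_I)

text \<open>The unit interval is only \<open>\<sigma>\<close>-complete, so \<open>m\<close> is the infimum among the elements above \<open>l0\<close>.\<close>

lemma descending_inf:
  assumes dec: "\<And>i :: nat. f i - f (Suc i) \<in> C" and lower: "\<And>i. f i - l0 \<in> C"
  shows "\<exists>m. (\<forall>i. f i - m \<in> C) \<and> (\<forall>l. l - l0 \<in> C \<longrightarrow> (\<forall>i. f i - l \<in> C) \<longrightarrow> m - l \<in> C)"
proof -
  obtain r where r: "0 < r" "f 0 - l0 \<in> order_ball r" using order_ball_exists by blast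
  define g where "g x = (1 / r) *\<^sub>R (x - l0)" for x
  have g_diff: "g x - g y = (1 / r) *\<^sub>R (x - y)" for x y
    by (simp add: g_def flip: scaleR_diff_right)
  have g_le: "g x - g y \<in> C \<longleftrightarrow> x - y \<in> C" for x y
    unfolding g_diff using r by (simp add: C_scaleR_cancel)
  have "u - g (f 0) = (1 / r) *\<^sub>R (r *\<^sub>R u - (f 0 - l0))"
    using r by (simp add: g_def scaleR_diff_right)
  then have g0: "u - g (f 0) \<in> C"
    using r by (auto simp: order_ball_def C_scaleR_cancel)
  have le0: "f 0 - f i \<in> C" for i
  proof (induction i)
    case (Suc i)
    then show ?case using C_trans[OF dec[of i] Suc] by simp
  qed (simp add: C_0)
  have gI: "g x \<in> I" if "x - l0 \<in> C" "f 0 - x \<in> C" for x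
    using that r C_trans[of "g (f 0)" "g x" u] g0
    by (auto simp: mem_I g_le) (simp add: g_def C_scaleR_cancel)
  obtain m where m: "m \<in> I" "\<And>i. g (f i) - m \<in> C"
    "\<And>l. l \<in> I \<Longrightarrow> (\<And>i. g (f i) - l \<in> C) \<Longrightarrow> m - l \<in> C"
    using inf_exists[of "\<lambda>i. g (f i)"] gI[OF lower le0] dec by (auto simp: g_le)
  define m' where "m' = r *\<^sub>R m + l0"
  have m': "g m' = m" using r by (simp add: g_def m'_def)
  have "f i - m' \<in> C" for i using m(2)[of i] g_le[of "f i" m'] m' by simp
  moreover have "m' - l \<in> C" if "l - l0 \<in> C" "\<And>i. f i - l \<in> C" for l
    using m(3)[OF gI[OF that]] that(2) g_le m' by metis
  ultimately show ?thesis by blast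
qed

text \<open>Here \<open>R n\<close> bounds the tail from index \<open>n\<close> on. Partial sums
  plus \<open>R n\<close> descend, partial sums minus \<open>R n\<close> ascend, and the infimum of
  the former lies between both families. This is how \<open>\<sigma>\<close>-completeness yields
  norm completeness.\<close>

lemma order_series_converges:
  assumes x: "\<And>k :: nat. x k \<in> order_ball (R k - R (Suc k))" and R: "\<And>k. 0 \<le> R k"
  shows "\<exists>y. \<forall>n. y - (\<Sum>k<n. x k) \<in> order_ball (R n)"
proof -
  define t where "t n = (\<Sum>k<n. x k) + R n *\<^sub>R u" for n
  define w where "w n = (\<Sum>k<n. x k) - R n *\<^sub>R u" for n
  have t: "t n - t (Suc n) \<in> C" and w: "w (Suc n) - w n \<in> C" for n
    using x[of n] by (auto simp: t_def w_def order_ball_def algebra_simps)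
  have tw: "t n - w n \<in> C" for n
    using C_add[of "R n *\<^sub>R u" "R n *\<^sub>R u"] C_scaleR[OF R u_in_C] by (auto simp: t_def w_def)
  have w_mono: "w (m + k) - w m \<in> C" and t_mono: "t m - t (m + k) \<in> C" for m k
  proof (induction k)
    case (Suc k)
    case 1 show ?case using C_trans[OF Suc(1) w[of "m + k"]] by simp
    case 2 show ?case using C_trans[OF t[of "m + k"] Suc(2)] by simp
  qed (simp_all add: C_0)
  have wt: "t n - w m \<in> C" for m n
  proof (cases "m \<le> n")
    case True
    then show ?thesis using C_trans[OF w_mono[of m "n - m"] tw[of "m + (n - m)"]] by simp
  next
    case False
    then show ?thesis using C_trans[OF tw[of "n + (m - n)"] t_mono[of n "m - n"]] by simp
  qed
  obtain y where "\<And>i. t i - y \<in> C" "\<And>l. l - w 0 \<in> C \<Longrightarrow> (\<And>i. t i - l \<in> C) \<Longrightarrow> y - l \<in> C"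
    using descending_inf[of t "w 0"] t wt by blast
  then have "t n - y \<in> C \<and> y - w n \<in> C" for n
    using wt w_mono[of 0 n] by simp
  then show ?thesis
    by (intro exI[of _ y]) (auto simp: t_def w_def order_ball_def algebra_simps)
qed

text \<open>A Neumann series in the order unit norm, where \<open>L a\<close> is a contraction
  because it is positive with \<open>L a u = a\<close>. The radii
  \<open>R n = c * s ^ n / (1 - s)\<close> are geometric tails.\<close>

lemma surj_id_minus_L_L:
  assumes a: "a \<in> I" and s: "0 < s" "s < 1"
  shows "surj (\<lambda>x. x - s *\<^sub>R L a (L a x))"
  unfolding surj_def
proof
  fix x
  define f where "f x = s *\<^sub>R L a (L a x)" for x
  have linf: "linear f"
    using linear_compose_scale_right[OF linear_compose[OF linear_L[OF a] linear_L[OF a]], of s]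
    by (simp add: f_def[abs_def] o_def)
  have f_ball: "f x \<in> order_ball (s * r)" if "x \<in> order_ball r" "0 \<le> r" for x r
    unfolding f_def using L_order_ball[OF a] that s by (intro order_ball_scaleR) auto
  obtain c where c: "0 < c" "x \<in> order_ball c" using order_ball_exists by blast
  define R where "R n = c * s ^ n / (1 - s)" for n
  define S where "S n = (\<Sum>k<n. (f ^^ k) x)" for n
  have R: "0 < R n" "R (Suc n) = s * R n" for n
    using c s by (auto simp: R_def)
  have "(f ^^ k) x \<in> order_ball (c * s ^ k)" for k
  proof (induction k)
    case (Suc k)
    then show ?case using f_ball[OF Suc] c s by (simp add: mult.left_commute)
  qed (simp add: c)
  moreover have "R k - R (Suc k) = c * s ^ k" for k
  proof -
    have "R k - R (Suc k) = (1 - s) * R k" by (simp add: R(2) algebra_simps)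
    then show ?thesis using s by (simp add: R_def)
  qed
  ultimately obtain y where y: "\<And>n. y - S n \<in> order_ball (R n)"
    using order_series_converges[of "\<lambda>k. (f ^^ k) x" R] R(1) unfolding S_def by (metis less_imp_le)
  have S: "S (Suc n) = x + f (S n)" for n
    by (simp add: S_def sum.lessThan_Suc_shift linear_sum[OF linf] del: sum.lessThan_Suc)
  have "y - f y - x = 0"
  proof (rule order_ball_0)
    fix e :: real assume e: "0 < e"
    obtain n where "s ^ n < e * (1 - s) / (2 * c)"
      using real_arch_pow_inv[of "e * (1 - s) / (2 * c)" s] e s c by auto
    then have n: "2 * R n \<le> e" using s c by (simp add: R_def field_simps)
    have "(y - S (Suc n)) + (- f (y - S n)) \<in> order_ball (R (Suc n) + s * R n)"
      using y[of "Suc n"] f_ball[OF y[of n]] R(1)[of n]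
      by (intro order_ball_add order_ball_minus) (auto simp: less_imp_le)
    moreover have "(y - S (Suc n)) + (- f (y - S n)) = y - f y - x"
      by (simp add: S linear_diff[OF linf])
    moreover have "R (Suc n) + s * R n \<le> e"
      using n R(1)[of n] s mult_right_mono[of s 1 "R n"] unfolding R(2) by linarith
    ultimately show "y - f y - x \<in> order_ball e" using order_ball_mono by metis
  qed
  then show "\<exists>y. x = y - s *\<^sub>R L a (L a y)"
    by (intro exI[of _ y]) (simp add: f_def)
qed

section \<open>Comparison of the Hilbert norm with the order unit norm\<close>

lemma norm_L: "a \<in> I \<Longrightarrow> norm (L a x) \<le> norm x"
  by (rule symmetric_contraction_of_surj[OF linear_L L_symmetric surj_id_minus_L_L])

lemma norm_I: "a \<in> I \<Longrightarrow> norm a \<le> norm u"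
  using norm_L[of a u] by (simp add: L_u)

lemma bounded_linear_L: "a \<in> I \<Longrightarrow> bounded_linear (L a)"
  by (rule bounded_linear_intro[where K = 1]) (auto simp: L_add L_scaleR norm_L)

text \<open>The factor \<open>3\<close> comes from \<open>x = 2 r b - r u\<close>, where both
  \<open>b\<close> and \<open>u\<close> have norm at most \<open>norm u\<close>.\<close>

lemma order_ball_norm: 
  assumes "x \<in> order_ball r" "0 < r"
  shows "norm x \<le> 3 * r * norm u"
proof -
  obtain b where b: "b \<in> I" "x = (2 * r) *\<^sub>R b - r *\<^sub>R u"
    using order_ball_to_I[OF assms] assms(2) by (metis (no_types, lifting) add_diff_cancel_right' divide_self_if
        less_irrefl mult_eq_0_iff scaleR_one scaleR_scaleR times_divide_eq_right mult.right_neutral zero_neq_numeral)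
  have "norm x \<le> norm ((2 * r) *\<^sub>R b) + norm (r *\<^sub>R u)"
    unfolding b(2) by (rule norm_triangle_ineq4)
  also have "\<dots> \<le> 2 * r * norm u + r * norm u"
    using norm_I[OF b(1)] assms(2) by simp
  finally show ?thesis by simp
qed

text \<open>By Baire, Hilbert balls are approximated by order balls; as in the open mapping theorem, the
  errors are summed up in the complete order unit norm.\<close>

lemma norm_dominates_order_norm: "\<exists>K>0. \<forall>x. x \<in> order_ball (K * norm x)"
proof -
  have "(\<Union>n. closure (order_ball (real n))) = UNIV"
  proof (intro set_eqI iffI UNIV_I)
    fix x
    obtain r n where "x \<in> order_ball r" "r \<le> real (n :: nat)"
      using order_ball_exists real_arch_simple by metis
    then show "x \<in> (\<Union>n. closure (order_ball (real n)))"
      using order_ball_mono closure_subset by blast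
  qed
  then obtain n x0 e where e: "0 < e" "ball x0 e \<subseteq> closure (order_ball (real n))"
    using closed_cover_contains_ball[of "\<lambda>n. closure (order_ball (real n))"] by auto
  have approx0: "\<exists>b\<in>order_ball (2 * real n). norm (x - b) < d" if x: "norm x < e" and d: "0 < d" for x d
  proof -
    have "x0 + x \<in> closure (order_ball (real n))" "x0 \<in> closure (order_ball (real n))"
      using e x by (auto simp: subset_iff dist_norm)
    then obtain b1 b2 where b: "b1 \<in> order_ball (real n)" "dist (x0 + x) b1 < d / 2"
        "b2 \<in> order_ball (real n)" "dist x0 b2 < d / 2"
      using d by (meson closure_approachableD half_gt_zero)
    have "x - (b1 - b2) = (b2 - x0) - (b1 - (x0 + x))" by simp
    then have "norm (x - (b1 - b2)) \<le> norm (b2 - x0) + norm (b1 - (x0 + x))"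
      by (metis norm_triangle_ineq4)
    then have "norm (x - (b1 - b2)) < d" using b by (simp add: dist_norm norm_minus_commute)
    moreover have "b1 - b2 \<in> order_ball (2 * real n)"
      using order_ball_add[OF b(1) order_ball_minus[OF b(3)]] by simp
    ultimately show ?thesis by blast
  qed
  \<comment> \<open>The scaling by \<open>2 * norm x / e\<close> applied to the radius
    \<open>2 * n\<close> gives \<open>4 * n / e\<close>; the added \<open>1\<close> keeps
    \<open>M\<close> positive when \<open>n = 0\<close>.\<close>
  define M where "M = 4 * real n / e + 1"
  have M: "0 < M" unfolding M_def using e by (simp add: add_nonneg_pos)
  have approx: "\<exists>b\<in>order_ball (M * norm x). norm (x - b) < d" if d: "0 < d" for x d
  proof (cases "x = 0")
    case True
    then show ?thesis using d by (intro bexI[of _ 0]) (auto simp: order_ball_def C_0)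
  next
    case False
    define c where "c = 2 * norm x / e"
    have c: "0 < c" using False e by (simp add: c_def)
    have "norm ((1 / c) *\<^sub>R x) < e" using False e by (simp add: c_def)
    then obtain b where b: "b \<in> order_ball (2 * real n)" "norm ((1 / c) *\<^sub>R x - b) < d / c"
      using approx0[of "(1 / c) *\<^sub>R x" "d / c"] d c by auto
    have "c * (2 * real n) \<le> M * norm x"
      using e by (simp add: c_def M_def field_simps)
    then have "c *\<^sub>R b \<in> order_ball (M * norm x)"
      using order_ball_scaleR[OF b(1), of c] order_ball_mono c by auto
    moreover have "x - c *\<^sub>R b = c *\<^sub>R ((1 / c) *\<^sub>R x - b)"
      using c by (simp add: scaleR_diff_right)
    then have "norm (x - c *\<^sub>R b) = c * norm ((1 / c) *\<^sub>R x - b)"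
      using c by (metis abs_of_pos norm_scaleR)
    then have "norm (x - c *\<^sub>R b) < d"
      using b(2) c by (simp add: pos_less_divide_eq mult.commute)
    ultimately show ?thesis by blast
  qed
  define p where "p x d = (SOME b. b \<in> order_ball (M * norm x) \<and> norm (x - b) < d)" for x d
  have p: "p x d \<in> order_ball (M * norm x) \<and> norm (x - p x d) < d" if "0 < d" for x d
    unfolding p_def using someI_ex[of "\<lambda>b. b \<in> order_ball (M * norm x) \<and> norm (x - b) < d"]
      approx[OF that] by blast
  have unit: "x \<in> order_ball (2 * M)" if x: "norm x \<le> 1" for x
  proof -
    \<comment> \<open>The remainders: step \<open>k\<close> is approximated within
      \<open>(1 / 2) ^ Suc k\<close>, so remainders halve and the corrections lie in order balls of
      total radius \<open>2 * M\<close>.\<close>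
    define r where "r = rec_nat x (\<lambda>k z. z - p z ((1 / 2) ^ Suc k))"
    define b where "b k = p (r k) ((1 / 2) ^ Suc k)" for k
    have r: "r 0 = x" "r (Suc k) = r k - b k" for k by (simp_all add: r_def b_def)
    have r_norm: "norm (r k) \<le> (1 / 2) ^ k" for k
      using p[of "(1 / 2) ^ Suc (k - 1)" "r (k - 1)"] x
      by (cases k) (auto simp: r b_def less_imp_le)
    have b: "b k \<in> order_ball (2 * M * (1 / 2) ^ k - 2 * M * (1 / 2) ^ Suc k)" for k
    proof -
      have "b k \<in> order_ball (M * norm (r k))" unfolding b_def using p by simp
      moreover have "M * norm (r k) \<le> 2 * M * (1 / 2) ^ k - 2 * M * (1 / 2) ^ Suc k"
        using mult_left_mono[OF r_norm[of k], of M] M by simp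
      ultimately show ?thesis by (rule order_ball_mono)
    qed
    obtain y where y: "\<And>n. y - (\<Sum>k<n. b k) \<in> order_ball (2 * M * (1 / 2) ^ n)"
      using order_series_converges[of b "\<lambda>n. 2 * M * (1 / 2) ^ n", OF b] M by auto
    have sum_b: "(\<Sum>k<n. b k) = x - r n" for n
      by (induction n) (auto simp: r)
    \<comment> \<open>So far \<open>y\<close> is only an order limit of the corrections. Since order
      balls are Hilbert bounded, the partial sums also tend to \<open>y\<close> in the Hilbert norm,
      where their limit is \<open>x\<close>.\<close>
    have bound: "norm (y - x) \<le> (6 * M * norm u + 1) * (1 / 2) ^ n" for n
    proof -
      have "norm (y - x) \<le> norm (y - (x - r n)) + norm (r n)"
        using norm_triangle_ineq4[of "y - (x - r n)" "r n"] by simp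
      also have "\<dots> \<le> 3 * (2 * M * (1 / 2) ^ n) * norm u + (1 / 2) ^ n"
        using order_ball_norm[OF y[of n, unfolded sum_b]] r_norm[of n] M by auto
      finally show ?thesis by (simp add: algebra_simps)
    qed
    have "(\<lambda>n. (6 * M * norm u + 1) * (1 / 2) ^ n) \<longlonglongrightarrow> (6 * M * norm u + 1) * 0"
      by (intro tendsto_mult tendsto_const LIMSEQ_realpow_zero) auto
    then have "norm (y - x) \<le> 0"
      using bound by (intro LIMSEQ_le_const) auto
    then show ?thesis using y[of 0] by simp
  qed
  have "x \<in> order_ball (2 * M * norm x)" for x
  proof (cases "x = 0")
    case False
    then have "norm x *\<^sub>R ((1 / norm x) *\<^sub>R x) \<in> order_ball (norm x * (2 * M))"
      by (intro order_ball_scaleR unit) auto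
    then show ?thesis using False by (simp add: mult.commute)
  qed (auto simp: order_ball_def C_0)
  then show ?thesis using M by (intro exI[of _ "2 * M"]) auto
qed

lemma closed_C: "closed C"
proof -
  obtain K where K: "0 < K" "\<And>x. x \<in> order_ball (K * norm x)"
    using norm_dominates_order_norm by blast
  have "x \<in> C" if x: "x \<in> closure C" for x
  proof (rule archimedean_real)
    fix e :: real assume "0 < e"
    then obtain y where y: "y \<in> C" "dist x y < e / K"
      using x K(1) by (meson closure_approachableD divide_pos_pos)
    have "K * norm (x - y) \<le> e"
      using y(2) K(1) by (simp add: dist_norm field_simps)
    then have "x - y \<in> order_ball e" using K(2) order_ball_mono by blast
    then have "e *\<^sub>R u + (x - y) \<in> C" by (simp add: order_ball_def)
    from C_add[OF y(1) this] show "e *\<^sub>R u + x \<in> C" by simp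
  qed
  then show ?thesis by (metis closure_subset closure_eq subsetI subset_antisym)
qed


section \<open>Sharp elements\<close>

lemma C_eq_0: "x - y \<in> C \<Longrightarrow> y - x \<in> C \<Longrightarrow> x = y"
  using C_antisym[of "x - y"] by simp

text \<open>Sharpness is encoded as idempotence for the sequential product.\<close>

definition sharp :: "'v \<Rightarrow> bool" where
  "sharp p \<longleftrightarrow> p \<in> I \<and> L p p = p"

lemma sharp_I: "sharp p \<Longrightarrow> p \<in> I" and sharp_C: "sharp p \<Longrightarrow> p \<in> C"
  and sharp_L_self: "sharp p \<Longrightarrow> L p p = p"
  by (auto simp: sharp_def mem_I)

lemma L_sharp_orth: "sharp p \<Longrightarrow> L p (u - p) = 0"
  by (simp add: sharp_I L_diff L_u sharp_L_self)

lemma L_orth_sharp: "sharp p \<Longrightarrow> L (u - p) p = 0"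
  using L_zero_sym[OF _ _ L_sharp_orth] by (simp add: sharp_I I_orth)

lemma sharp_orth: "sharp p \<Longrightarrow> sharp (u - p)"
  unfolding sharp_def[of "u - p"] by (auto simp: sharp_I I_orth L_diff L_u L_orth_sharp)

lemma sharp_u: "sharp u"
  by (simp add: sharp_def u_in_I L_u)

lemma L_idem: "sharp p \<Longrightarrow> L p (L p x) = L p x"
  using L_L[of p p x] by (simp add: sharp_I com_refl sharp_L_self)

text \<open>The complement \<open>u - p\<close> annihilates \<open>p\<close>, hence by positivity
  every effect below \<open>p\<close>. Zero symmetry turns this vanishing product into
  commutation.\<close>

lemma sharp_above:
  assumes p: "sharp p" and a: "a \<in> I" "p - a \<in> C"
  shows "L p a = a" and "com p a"
proof -
  have "L (u - p) p - L (u - p) a \<in> C" using L_mono[OF I_orth a(2)] p by (simp add: sharp_I)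
  moreover have "L (u - p) a \<in> C" using L_positive[OF I_orth I_imp_C[OF a(1)]] p by (simp add: sharp_I)
  ultimately have 0: "L (u - p) a = 0" using C_antisym p by (simp add: L_orth_sharp)
  then have 1: "L a (u - p) = 0" using L_zero_sym a p by (simp add: sharp_I I_orth)
  have "com a (u - p)" using 0 1 by (simp add: com_def)
  then show "com p a" using com_orth_iff a p com_sym by (metis sharp_I)
  then show "L p a = a" using 1 a by (simp add: com_def L_diff L_u)
qed

text \<open>The dual of \<open>sharp_above\<close>, obtained by passing to complements.\<close>

lemma sharp_below:
  assumes p: "sharp p" and a: "a \<in> I" "a - p \<in> C"
  shows "L p a = p" and "com p a"
proof -
  have *: "u - a \<in> I" "(u - p) - (u - a) \<in> C" using a by (auto simp: I_orth)
  have "L (u - p) (u - a) = u - a" "com (u - p) (u - a)"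
    using sharp_above[OF sharp_orth[OF p] *] by auto
  then show "com p a" using com_orth_iff com_sym a p by (metis I_orth sharp_I)
  have "L p (u - a) = L p (L (u - p) (u - a))" using \<open>L (u - p) (u - a) = u - a\<close> by simp
  also have "\<dots> = L (L p (u - p)) (u - a)"
    using p com_orth[OF _ _ com_refl] by (subst L_L) (auto simp: sharp_I I_orth)
  also have "\<dots> = 0"
    using com_0[of "u - a"] L_0[of "u - a"] a p by (simp add: L_sharp_orth com_def I_orth)
  finally show "L p a = p" using p by (simp add: sharp_I L_diff L_u)
qed

text \<open>Both products of \<open>p\<close> and \<open>a\<close> vanish, so they commute; then
  \<open>u - p\<close> fixes \<open>a\<close>, and a product never exceeds its left factor.\<close>

lemma L_eq_0_imp:
  assumes p: "sharp p" and a: "a \<in> I" "L p a = 0"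
  shows "com p a" and "(u - p) - a \<in> C"
proof -
  have "L a p = 0" using L_zero_sym a p by (simp add: sharp_I)
  then show c: "com p a" using a by (simp add: com_def)
  then have "com a (u - p)" using com_sym com_orth a p by (metis sharp_I)
  then have "L (u - p) a = a" using \<open>L a p = 0\<close> a by (simp add: com_def L_diff L_u)
  then show "(u - p) - a \<in> C" using L_le[of "u - p" a] a p by (simp add: sharp_I I_orth)
qed

lemma sharp_L: "sharp p \<Longrightarrow> sharp q \<Longrightarrow> com p q \<Longrightarrow> sharp (L p q)"
  unfolding sharp_def[of "L p q"]
  using L_L[of p q "L p q"] L_commute[of p q q] L_closed[of p q]
  by (simp add: sharp_I L_idem sharp_L_self com_sym)

lemma sharp_diff:
  assumes "sharp p" "sharp q" "q - p \<in> C"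
  shows "sharp (q - p)"
proof -
  have "q - p = L q (u - p)"
    using sharp_above(1)[OF assms(2) sharp_I[OF assms(1)] assms(3)] assms by (simp add: sharp_I L_diff L_u)
  moreover have "com q (u - p)"
    using sharp_above(2)[OF assms(2) sharp_I[OF assms(1)] assms(3)] assms by (simp add: sharp_I com_orth)
  ultimately show ?thesis using sharp_L sharp_orth assms by simp
qed

lemma sharp_add:
  assumes "sharp p" "sharp q" "u - (p + q) \<in> C"
  shows "sharp (p + q)"
  using sharp_orth[OF sharp_diff[OF assms(2) sharp_orth[OF assms(1)]]] assms(3) 
  by (simp add: algebra_simps)

section \<open>Spectral decomposition\<close>

text \<open>Here \<open>r\<close> is the order unit norm of \<open>a\<close>, a minimum because the
  cone is closed. The last conjunct says that the rescaled effect has norm exactly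
  \<open>1\<close>.\<close>

lemma order_norm_attained:
  assumes a: "a \<in> I" "a \<noteq> 0"
  shows "\<exists>r. 0 < r \<and> r \<le> 1 \<and> (1 / r) *\<^sub>R a \<in> I \<and> (\<forall>c<1. c *\<^sub>R u - (1 / r) *\<^sub>R a \<notin> C)"
proof -
  define S where "S = {0..1} \<inter> (\<lambda>r. r *\<^sub>R u - a) -` C"
  have "compact S" unfolding S_def
    by (intro compact_Int_closed compact_Icc closed_vimage closed_C continuous_intros)
  moreover have "1 \<in> S" using a by (simp add: S_def mem_I)
  ultimately obtain r where r: "r \<in> S" "\<And>s. s \<in> S \<Longrightarrow> r \<le> s"
    using compact_attains_inf[of S] by auto
  have aC: "a \<in> C" using a by (simp add: mem_I)
  have "r \<noteq> 0" using r(1) C_antisym[OF aC] a by (auto simp: S_def)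
  then have r01: "0 < r" "r \<le> 1" "r *\<^sub>R u - a \<in> C" using r(1) by (auto simp: S_def)
  have "u - (1 / r) *\<^sub>R a = (1 / r) *\<^sub>R (r *\<^sub>R u - a)"
    using r01 by (simp add: scaleR_diff_right)
  then have "(1 / r) *\<^sub>R a \<in> I" using r01 aC by (auto simp: mem_I C_scaleR_cancel)
  moreover have "c *\<^sub>R u - (1 / r) *\<^sub>R a \<notin> C" if c: "c < 1" for c
  proof
    assume "c *\<^sub>R u - (1 / r) *\<^sub>R a \<in> C"
    \<comment> \<open>As \<open>c\<close> may be negative while \<open>S\<close> lies in the
      interval from \<open>0\<close> to \<open>1\<close>, the bound \<open>r * c\<close> is first
      raised to \<open>max 0 (r * c)\<close>.\<close>
    then have "r *\<^sub>R (c *\<^sub>R u - (1 / r) *\<^sub>R a) + (max 0 (r * c) - r * c) *\<^sub>R u \<in> C"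
      using r01 by (intro C_add C_scaleR u_in_C) auto
    then have "max 0 (r * c) *\<^sub>R u - a \<in> C"
      using r01 by (simp add: algebra_simps)
    moreover have rc: "r * c < r" using r01 c by simp
    moreover have "max 0 (r * c) \<le> 1" using rc r01 by linarith
    ultimately have "max 0 (r * c) \<in> S" unfolding S_def by simp
    then have "r \<le> max 0 (r * c)" by (rule r(2))
    then show False using rc r01 by linarith
  qed
  ultimately show ?thesis using r01 by blast
qed

text \<open>The sharp element is the limit of the powers of \<open>b\<close>; it is nonzero because
  \<open>u - b\<^sup>n \<le> n (u - b)\<close>.\<close>

lemma nonzero_sharp_below:
  assumes b: "b \<in> I" and top: "\<And>c. c < 1 \<Longrightarrow> c *\<^sub>R u - b \<notin> C"
  shows "\<exists>m. sharp m \<and> m \<noteq> 0 \<and> b - m \<in> C"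
proof -
  define f where "f n = (L b ^^ n) u" for n
  have f: "f 0 = u" "f (Suc n) = L b (f n)" for n by (simp_all add: f_def)
  have fI: "f n \<in> I" for n by (induction n) (auto simp: f u_in_I b L_closed)
  have com_bf: "com b (f n)" for n
    by (induction n) (auto simp: f b fI com_u com_refl intro: com_L)
  have dec: "f n - f (Suc n) \<in> C" for n
    using com_bf[of n] L_le[OF fI[of n] b] by (simp add: f com_def)
  obtain m where m: "(\<lambda>n. f (2 * n)) \<longlonglongrightarrow> m"
    using even_powers_of_symmetric_contraction_convergent[of "L b" u, OF L_symmetric[OF b] norm_L[OF b]]
    by (auto simp: f_def convergent_def)
  have dec_add: "f n - f (n + k) \<in> C" for n k
  proof (induction k)
    case (Suc k)
    then show ?case using C_trans[OF dec[of "n + k"] Suc] by simp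
  qed (simp add: C_0)
  have f_le: "f n - m \<in> C" for n
  proof (rule Lim_in_closed_set[OF closed_C])
    show "(\<lambda>k. f n - f (2 * k)) \<longlonglongrightarrow> f n - m" by (intro tendsto_intros m)
    show "\<forall>\<^sub>F k in sequentially. f n - f (2 * k) \<in> C"
      using eventually_ge_at_top[of n]
    proof eventually_elim
      case (elim k)
      then show ?case using dec_add[of n "2 * k - n"] by simp
    qed
  qed simp
  have m_greatest: "m - l \<in> C" if "\<And>n. f n - l \<in> C" for l
    by (rule Lim_in_closed_set[OF closed_C, of "\<lambda>k. f (2 * k) - l"])
      (use that in \<open>auto intro!: tendsto_intros m\<close>)
  have mI: "m \<in> I" 
    using m_greatest[of 0] fI f_le[of 0] by (simp add: mem_I f)
  note cont = bounded_linear.tendsto[OF bounded_linear_L]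
  have "(\<lambda>n. f (2 * Suc n)) \<longlonglongrightarrow> L b (L b m)"
    using cont[OF b cont[OF b m]] by (simp add: f)
  then have LLm: "L b (L b m) = m"
    using LIMSEQ_unique LIMSEQ_Suc[OF m] by blast
  have "m - L b m \<in> C"
    by (rule Lim_in_closed_set[OF closed_C, of "\<lambda>k. f (2 * k) - f (Suc (2 * k))"])
      (use dec in \<open>auto simp: f(2) intro!: tendsto_intros m cont b\<close>)
  moreover from L_mono[OF b this] have "L b m - m \<in> C" by (simp add: LLm)
  ultimately have Lbm: "L b m = m" by (intro C_eq_0)
  \<comment> \<open>The Hilbert limit \<open>m\<close> is also the infimum of the powers, so
    commutation with \<open>b\<close> passes to it. This converts \<open>L (f n) m = m\<close> into
    \<open>L m (f n) = m\<close>, whose limit is idempotence.\<close>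
  have com_mb: "com m b"
    unfolding com_iff[OF mI b] using commute_inf[of f m b] fI dec mI f_le m_greatest b com_bf
    by (simp add: com_iff)
  have com_mf: "com m (f n)" for n
    by (induction n) (auto simp: f mI b fI com_u com_mb intro: com_L)
  have "L (f n) m = m" for n
    by (induction n) (auto simp: f L_u_left L_L b fI com_bf Lbm)
  then have "L m (f n) = m" for n using com_mf[of n] by (simp add: com_def)
  then have "(\<lambda>n. m) \<longlonglongrightarrow> L m m" using cont[OF mI m] by simp
  then have "L m m = m" by (simp add: LIMSEQ_const_iff)
  then have "sharp m" using mI by (simp add: sharp_def)
  moreover have "b - m \<in> C" using f_le[of 1] b by (simp add: f L_u)
  moreover have "m \<noteq> 0"
  proof
    assume "m = 0"
    obtain K where K: "0 < K" "\<And>x. x \<in> order_ball (K * norm x)"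
      using norm_dominates_order_norm by blast
    have "(\<lambda>n. norm (f (2 * n))) \<longlonglongrightarrow> 0"
      using m unfolding \<open>m = 0\<close> by (rule tendsto_norm_zero)
    then have "\<forall>\<^sub>F n in sequentially. norm (f (2 * n)) < 1 / (2 * K)"
      using K(1) by (intro order_tendstoD(2)) auto
    then obtain n where n: "norm (f (2 * n)) < 1 / (2 * K)"
      by (auto simp: eventually_sequentially)
    then have "K * norm (f (2 * n)) \<le> 1 / 2" using K(1) by (simp add: field_simps)
    then have half: "(1 / 2) *\<^sub>R u - f (2 * n) \<in> C"
      using order_ball_mono[OF K(2)] by (auto simp: order_ball_def)
    have bernoulli: "real k *\<^sub>R (u - b) - (u - f k) \<in> C" for k
    proof (induction k)
      case (Suc k)
      have "com (f k) (u - b)" using com_orth com_sym com_bf fI b by blast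
      then have "(u - b) - L (f k) (u - b) \<in> C"
        using L_le[of "u - b" "f k"] fI b by (simp add: com_def I_orth)
      moreover have "L (f k) (u - b) = f k - f (Suc k)"
        using com_bf[of k] fI by (simp add: L_diff L_u f com_def)
      moreover have "real (Suc k) *\<^sub>R (u - b) - (u - f (Suc k))
          = (real k *\<^sub>R (u - b) - (u - f k)) + ((u - b) - (f k - f (Suc k)))"
        by (simp add: algebra_simps)
      ultimately show ?case using C_add[OF Suc] by (simp only:)
    qed (simp add: f C_0)
    \<comment> \<open>If the powers tended to \<open>0\<close>, some \<open>f (2 * n)\<close> would
      be at most \<open>u / 2\<close>, so that \<open>u / 2\<close> would be at most
      \<open>2 * n\<close> times \<open>u - b\<close>. One more summand \<open>u - b\<close> makes
      the multiplier positive even for \<open>n = 0\<close>, and dividing by it contradicts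
      \<open>top\<close>.\<close>
    define N where "N = 2 * real n + 1"
    have N: "N > 0" by (simp add: N_def)
    have "N *\<^sub>R (u - b) - (1 / 2) *\<^sub>R u =
        (real (2 * n) *\<^sub>R (u - b) - (u - f (2 * n))) + ((1 / 2) *\<^sub>R u - f (2 * n)) + (u - b)"
    proof -
      have "u = (1 / 2) *\<^sub>R u + (1 / 2) *\<^sub>R u" by (simp flip: scaleR_add_left)
      then have "u - (1 / 2) *\<^sub>R u = (1 / 2) *\<^sub>R u" by (simp only: diff_eq_eq)
      then show ?thesis by (simp add: N_def scaleR_add_left)
    qed
    also have "\<dots> \<in> C" using bernoulli[of "2 * n"] half b by (intro C_add) (auto simp: mem_I)
    finally have "(1 / N) *\<^sub>R (N *\<^sub>R (u - b) - (1 / 2) *\<^sub>R u) \<in> C"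
      using N by (simp add: C_scaleR_cancel)
    moreover have "(1 / N) *\<^sub>R (N *\<^sub>R (u - b) - (1 / 2) *\<^sub>R u) = (1 - 1 / (2 * N)) *\<^sub>R u - b"
      using N by (simp add: algebra_simps)
    ultimately show False using top[of "1 - 1 / (2 * N)"] N by simp
  qed
  ultimately show ?thesis by blast
qed

definition atom :: "'v \<Rightarrow> bool" where
  "atom p \<longleftrightarrow> sharp p \<and> p \<noteq> 0 \<and> (\<forall>q. sharp q \<longrightarrow> p - q \<in> C \<longrightarrow> q = 0 \<or> q = p)"

lemma atom_sharp: "atom p \<Longrightarrow> sharp p" and atom_I: "atom p \<Longrightarrow> p \<in> I"
  and atom_nonzero: "atom p \<Longrightarrow> p \<noteq> 0"
  by (auto simp: atom_def sharp_I)

text \<open>Pairwise orthogonality is a consequence: since the members add up to \<open>u\<close>,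
  each lies below the complement of any other, see \<open>frame_orth\<close>.\<close>

definition frame :: "'v \<Rightarrow> 'v set \<Rightarrow> bool" where
  "frame e F \<longleftrightarrow> finite F \<and> (\<forall>p\<in>F. atom p) \<and> \<Sum>F = e"

lemma frame_below:
  assumes "frame e F" "p \<in> F"
  shows "e - p \<in> C"
proof -
  have "e - p = \<Sum>(F - {p})" using assms by (auto simp: frame_def sum.remove)
  moreover have "\<Sum>(F - {p}) \<in> C"
    using assms by (intro C_sum) (auto simp: frame_def intro: sharp_C atom_sharp)
  ultimately show ?thesis by simp
qed

lemma sharp_inner_diff:
  assumes "sharp p" "sharp q" "q - p \<in> C"
  shows "inner p (q - p) = 0"
proof -
  have "inner p (q - p) = inner (L p p) (q - p)" using assms by (simp add: sharp_L_self)
  also have "\<dots> = inner p (L p (q - p))" using assms by (simp add: L_symmetric sharp_I)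
  also have "L p (q - p) = 0"
    using sharp_below(1)[OF assms(1) sharp_I[OF assms(2)] assms(3)] assms
    by (simp add: L_diff sharp_I sharp_L_self)
  finally show ?thesis by simp
qed

lemma sharp_le_scaled_u:
  assumes p: "sharp p" and c: "c *\<^sub>R u - p \<in> C" "c < 1"
  shows "p = 0"
proof -
  have "L p (c *\<^sub>R u - p) \<in> C" using p c by (intro L_positive) (auto simp: sharp_I)
  also have "L p (c *\<^sub>R u - p) = (1 - c) *\<^sub>R (- p)"
    using p by (simp add: L_diff L_scaleR L_u sharp_I sharp_L_self algebra_simps)
  finally have "- p \<in> C" using c by (subst (asm) C_scaleR_cancel) auto
  then show ?thesis using C_antisym sharp_C[OF p] by blast
qed

text \<open>By \<open>sharp_le_scaled_u\<close> a nonzero sharp element has order unit norm at least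
  \<open>1\<close>, and the Hilbert norm dominates that norm up to the factor
  \<open>K\<close>.\<close>

lemma sharp_norm_lower_bound: "\<exists>d>0. \<forall>p. sharp p \<longrightarrow> p \<noteq> 0 \<longrightarrow> d \<le> (norm p)\<^sup>2"
proof -
  obtain K where K: "0 < K" "\<And>x. x \<in> order_ball (K * norm x)"
    using norm_dominates_order_norm by blast
  have "(1 / K)\<^sup>2 \<le> (norm p)\<^sup>2" if "sharp p" "p \<noteq> 0" for p
  proof (rule power_mono)
    have "(K * norm p) *\<^sub>R u - p \<in> C" using K(2)[of p] by (simp add: order_ball_def)
    then have "1 \<le> K * norm p" using sharp_le_scaled_u that by force
    then show "1 / K \<le> norm p" using K(1) by (simp add: field_simps)
  qed (use K in simp)
  then show ?thesis using K(1) by (intro exI[of _ "(1 / K)\<^sup>2"]) auto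
qed

lemma sharp_below_unique: "sharp p \<Longrightarrow> sharp q \<Longrightarrow> q - p \<in> C \<Longrightarrow> (u - q) - p \<in> C \<Longrightarrow> p = 0"
proof -
  assume *: "sharp p" "sharp q" "q - p \<in> C" "(u - q) - p \<in> C"
  have "L q p = p" "L (u - q) p = p"
    using * sharp_above(1) sharp_orth sharp_I by blast+
  then have "p = L q (L (u - q) p)" by simp
  also have "\<dots> = L (L q (u - q)) p"
    using * com_orth[OF _ _ com_refl] by (simp add: L_L sharp_I I_orth)
  also have "\<dots> = 0"
    using * com_0[of p] L_0[of p] by (simp add: L_sharp_orth com_def sharp_I)
  finally show "p = 0" .
qed

text \<open>Induction on how often \<open>d\<close> fits into \<open>(norm e)\<^sup>2\<close>. A
  proper nonzero sharp \<open>m\<close> below \<open>e\<close> splits \<open>e\<close> orthogonally,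
  and each part has squared norm smaller by at least \<open>d\<close>; so the process stops without
  any bound on the dimension.\<close>

theorem spectral_decomposition_below:
  assumes "sharp e" "a \<in> I" "e - a \<in> C"
  shows "\<exists>F c. frame e F \<and> a = (\<Sum>p\<in>F. c p *\<^sub>R p)"
proof -
  obtain d where d: "0 < d" "\<And>p. sharp p \<Longrightarrow> p \<noteq> 0 \<Longrightarrow> d \<le> (norm p)\<^sup>2"
    using sharp_norm_lower_bound by blast
  have "\<exists>F c. frame e F \<and> a = (\<Sum>p\<in>F. c p *\<^sub>R p)"
    if "(norm e)\<^sup>2 \<le> real n * d" "sharp e" "a \<in> I" "e - a \<in> C" for n e a
    using that
  proof (induction n arbitrary: e a)
    case 0
    then have "e = 0" by simp
    then have "a = 0" using 0 C_antisym I_imp_C by simp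
    then show ?case using \<open>e = 0\<close> by (intro exI[of _ "{}"]) (auto simp: frame_def)
  next
    case (Suc n)
    note e = \<open>sharp e\<close>
    have split: "\<exists>F c. frame e F \<and> a = (\<Sum>p\<in>F. c p *\<^sub>R p)"
      if m: "sharp m" "m \<noteq> 0" "m \<noteq> e" "e - m \<in> C"
        and a1: "a1 \<in> I" "m - a1 \<in> C" and a2: "a2 \<in> I" "(e - m) - a2 \<in> C" and a: "a = a1 + a2"
      for m a1 a2
    proof -
      have em: "sharp (e - m)" using sharp_diff m e by simp
      have "(norm e)\<^sup>2 = (norm m)\<^sup>2 + (norm (e - m))\<^sup>2"
        using sharp_inner_diff[OF m(1) e m(4)]
        by (simp add: power2_norm_eq_inner inner_diff inner_commute)
      moreover have "d \<le> (norm m)\<^sup>2" "d \<le> (norm (e - m))\<^sup>2" using d(2) m em by auto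
      ultimately have "(norm m)\<^sup>2 \<le> real n * d" "(norm (e - m))\<^sup>2 \<le> real n * d"
        using Suc.prems(1) by (simp_all add: algebra_simps)
      then obtain F1 c1 F2 c2 where F1: "frame m F1" "a1 = (\<Sum>p\<in>F1. c1 p *\<^sub>R p)"
        and F2: "frame (e - m) F2" "a2 = (\<Sum>p\<in>F2. c2 p *\<^sub>R p)"
        using Suc.IH[of m a1] Suc.IH[of "e - m" a2] m em a1 a2 by blast
      \<comment> \<open>Frames are sets with one coefficient per atom, so the two frames may be
        merged only if they share no atom.\<close>
      have "F1 \<inter> F2 = {}"
      proof (rule ccontr)
        assume "F1 \<inter> F2 \<noteq> {}"
        then obtain p where p: "p \<in> F1" "p \<in> F2" by blast
        have "m - p \<in> C" "(e - m) - p \<in> C" using frame_below F1 F2 p by auto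
        moreover from this(2) have "(u - m) - p \<in> C"
          using C_add[of "(e - m) - p" "u - e"] sharp_I[OF e] by (simp add: mem_I algebra_simps)
        moreover have "atom p" using F1 p by (simp add: frame_def)
        ultimately show False using sharp_below_unique m atom_sharp atom_nonzero by blast
      qed
      then have "frame e (F1 \<union> F2)"
        using F1(1) F2(1) by (auto simp: frame_def sum.union_disjoint)
      moreover have "a = (\<Sum>p\<in>F1 \<union> F2. (if p \<in> F1 then c1 p else c2 p) *\<^sub>R p)"
      proof -
        have "(\<Sum>p\<in>F1. (if p \<in> F1 then c1 p else c2 p) *\<^sub>R p) = a1"
          unfolding F1(2) by (rule sum.cong) auto
        moreover have "(\<Sum>p\<in>F2. (if p \<in> F1 then c1 p else c2 p) *\<^sub>R p) = a2"
          unfolding F2(2) using \<open>F1 \<inter> F2 = {}\<close> by (intro sum.cong) auto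
        ultimately show ?thesis
          using F1 F2 \<open>F1 \<inter> F2 = {}\<close> a by (simp add: frame_def sum.union_disjoint)
      qed
      ultimately show ?thesis
        by (intro exI[of _ "F1 \<union> F2"] exI[of _ "\<lambda>p. if p \<in> F1 then c1 p else c2 p"] conjI)
    qed
    \<comment> \<open>A multiple of \<open>e\<close> singles out no proper sharp element below
      \<open>e\<close>; unless \<open>e\<close> is an atom, an arbitrary one is used for the
      splitting.\<close>
    have scalar: "\<exists>F c. frame e F \<and> a = (\<Sum>p\<in>F. c p *\<^sub>R p)"
      if r: "a = r *\<^sub>R e" "0 \<le> r" "r \<le> 1" for r
    proof (cases "e = 0")
      case True
      then show ?thesis using r by (intro exI[of _ "{}"]) (auto simp: frame_def)
    next
      case False
      show ?thesis
      proof (cases "atom e")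
        case True
        then show ?thesis using r by (intro exI[of _ "{e}"] exI[of _ "\<lambda>_. r"]) (auto simp: frame_def)
      next
        case False
        then obtain m where m: "sharp m" "m \<noteq> 0" "m \<noteq> e" "e - m \<in> C"
          using \<open>e \<noteq> 0\<close> e by (auto simp: atom_def)
        have "m - r *\<^sub>R m = (1 - r) *\<^sub>R m" "(e - m) - r *\<^sub>R (e - m) = (1 - r) *\<^sub>R (e - m)"
          by (simp_all add: algebra_simps)
        then have "m - r *\<^sub>R m \<in> C" "(e - m) - r *\<^sub>R (e - m) \<in> C"
          using m r by (auto intro: C_scaleR sharp_C)
        moreover have "r *\<^sub>R m \<in> I" "r *\<^sub>R (e - m) \<in> I"
          using I_scaleR[OF r(2,3) sharp_I[OF m(1)]]
            I_scaleR[OF r(2,3) sharp_I[OF sharp_diff[OF m(1) e m(4)]]] .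
        moreover have "a = r *\<^sub>R m + r *\<^sub>R (e - m)"
          by (simp add: r(1) scaleR_diff_right)
        ultimately show ?thesis by (intro split[OF m])
      qed
    qed
    show ?case
    proof (cases "a = 0")
      case True
      then show ?thesis by (intro scalar[of 0]) auto
    next
      case False
      then obtain r where r: "0 < r" "r \<le> 1" and b: "(1 / r) *\<^sub>R a \<in> I"
        "\<And>c. c < 1 \<Longrightarrow> c *\<^sub>R u - (1 / r) *\<^sub>R a \<notin> C"
        using order_norm_attained[OF Suc.prems(3)] by blast
      define b where "b = (1 / r) *\<^sub>R a"
      have a: "a = r *\<^sub>R b" using r by (simp add: b_def)
      have bI: "b \<in> I" using b(1) by (simp add: b_def)
      obtain m where m: "sharp m" "m \<noteq> 0" "b - m \<in> C"
        using nonzero_sharp_below[of b] b by (auto simp: b_def)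
      have "L e a = a" using sharp_above(1) Suc.prems by blast
      then have "L e b = b" using e by (simp add: b_def L_scaleR sharp_I)
      then have eb: "e - b \<in> C" using L_le[of e b] bI e by (simp add: sharp_I)
      then have em: "e - m \<in> C" using C_trans[OF m(3)] by simp
      show ?thesis
      proof (cases "m = e")
        case True
        then have "b = e" using eb m(3) C_eq_0 by blast
        then show ?thesis using r a by (intro scalar[of r]) auto
      next
        case False
        have "m - r *\<^sub>R m = (1 - r) *\<^sub>R m" by (simp add: algebra_simps)
        then have "m - r *\<^sub>R m \<in> C" using m r by (simp add: C_scaleR sharp_C)
        moreover have eq: "(e - m) - r *\<^sub>R (b - m) = (e - b) + (1 - r) *\<^sub>R (b - m)"
          by (simp add: algebra_simps)
        have "(e - m) - r *\<^sub>R (b - m) \<in> C"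
          unfolding eq using m r eb by (intro C_add C_scaleR) auto
        moreover have "r *\<^sub>R m \<in> I" "r *\<^sub>R (b - m) \<in> I"
          using I_scaleR[of r m] I_scaleR[of r "b - m"] I_diff[of m b] r m bI
          by (simp_all add: sharp_I sharp_C)
        moreover have "a = r *\<^sub>R m + r *\<^sub>R (b - m)"
          by (simp add: a scaleR_diff_right)
        ultimately show ?thesis using False em m by (intro split[of m])
      qed
    qed
  qed
  moreover obtain n :: nat where "(norm e)\<^sup>2 \<le> real n * d"
    using real_arch_simple[of "(norm e)\<^sup>2 / d"] d(1) by (auto simp: field_simps)
  ultimately show ?thesis using assms by blast
qed


text \<open>Homogeneity in the left factor is not an axiom. A sharp \<open>p\<close> commutes with
  \<open>r p\<close> and with \<open>r (u - p)\<close>, hence with their sum \<open>r u\<close>;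
  sharp elements span by the spectral decomposition.\<close>

lemma L_u_scaled:
  assumes r: "0 \<le> r" "r \<le> 1"
  shows "L (r *\<^sub>R u) x = r *\<^sub>R x"
proof (rule linear_eq_on_I[where f = "L (r *\<^sub>R u)" and g = "\<lambda>x. r *\<^sub>R x"])
  have rI: "r *\<^sub>R u \<in> I" using r u_in_I by (intro I_scaleR)
  show "linear (L (r *\<^sub>R u))" by (rule linear_L[OF rI])
  show "linear (\<lambda>x::'v. r *\<^sub>R x)" by (rule linear_scaleR)
  have sharp: "L (r *\<^sub>R u) p = r *\<^sub>R p" if p: "sharp p" for p
  proof -
    have scaled: "r *\<^sub>R q \<in> I" "com q (r *\<^sub>R q)" if q: "sharp q" for q
    proof -
      show qI: "r *\<^sub>R q \<in> I" using r q by (intro I_scaleR sharp_I)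
      have "q - r *\<^sub>R q = (1 - r) *\<^sub>R q" by (simp add: algebra_simps)
      then have "q - r *\<^sub>R q \<in> C" using r q by (auto intro: C_scaleR sharp_C)
      then show "com q (r *\<^sub>R q)" using sharp_above(2)[OF q qI] by simp
    qed
    have "com p (r *\<^sub>R (u - p))"
      using scaled[OF sharp_orth[OF p]] com_orth_iff[of "r *\<^sub>R (u - p)" p] p com_sym sharp_I by metis
    moreover have eq: "r *\<^sub>R p + r *\<^sub>R (u - p) = r *\<^sub>R u" by (simp add: algebra_simps)
    ultimately have "com p (r *\<^sub>R u)"
      using com_add[OF scaled(1)[OF p] scaled(1)[OF sharp_orth[OF p]] sharp_I[OF p] scaled(2)[OF p]] rI
      by simp
    then show ?thesis using p by (simp add: com_def L_scaleR L_u sharp_I)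
  qed
  fix x assume "x \<in> I"
  then obtain F c where F: "frame u F" "x = (\<Sum>p\<in>F. c p *\<^sub>R p)"
    using spectral_decomposition_below[OF sharp_u] mem_I by blast
  then have "L (r *\<^sub>R u) x = (\<Sum>p\<in>F. c p *\<^sub>R r *\<^sub>R p)"
    by (simp add: L_sum[OF rI] L_scaleR[OF rI] sharp frame_def atom_sharp)
  then show "L (r *\<^sub>R u) x = r *\<^sub>R x"
    by (simp add: F(2) scaleR_sum_right mult.commute)
qed

lemma spectral_decomposition: "\<exists>F c. frame u F \<and> x = (\<Sum>p\<in>F. c p *\<^sub>R p)"
proof -
  obtain b r where b: "b \<in> I" "x = (2 * r) *\<^sub>R b - r *\<^sub>R u" using I_decomposition by blast
  obtain F c where F: "frame u F" "b = (\<Sum>p\<in>F. c p *\<^sub>R p)"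
    using spectral_decomposition_below[OF sharp_u b(1)] b(1) by (auto simp: mem_I)
  have "x = (2 * r) *\<^sub>R (\<Sum>p\<in>F. c p *\<^sub>R p) - r *\<^sub>R \<Sum>F"
    using b(2) F by (simp add: frame_def)
  also have "\<dots> = (\<Sum>p\<in>F. (2 * r * c p - r) *\<^sub>R p)"
    by (simp add: scaleR_sum_right sum_subtractf scaleR_diff_left)
  finally show ?thesis using F(1) by (intro exI[of _ F] exI[of _ "\<lambda>p. 2 * r * c p - r"]) auto
qed

lemma linear_eq_on_atoms:
  assumes "linear f" "linear g" "\<And>q. atom q \<Longrightarrow> f q = g q"
  shows "f x = g x"
proof -
  obtain F c where "frame u F" "x = (\<Sum>p\<in>F. c p *\<^sub>R p)" using spectral_decomposition by blast
  then show ?thesis using assms by (auto simp: linear_sum linear_scale frame_def intro!: sum.cong)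
qed

lemma frame_orth:
  assumes F: "frame u F" "p \<in> F" "q \<in> F" "p \<noteq> q"
  shows "L p q = 0"
proof -
  have pq: "sharp p" "sharp q" using F by (auto simp: frame_def atom_sharp)
  have "u = p + (q + \<Sum>(F - {p} - {q}))"
    using F sum.remove[of F p "\<lambda>x. x"] sum.remove[of "F - {p}" q "\<lambda>x. x"] by (simp add: frame_def)
  then have "(u - p) - q = \<Sum>(F - {p} - {q})" by simp
  moreover have "\<Sum>(F - {p} - {q}) \<in> C"
    using F(1) by (intro C_sum) (simp add: frame_def sharp_C atom_sharp)
  ultimately have "L (u - p) q = q" "com (u - p) q"
    using sharp_above[OF sharp_orth[OF pq(1)] sharp_I[OF pq(2)]] by auto
  then have "L q p = 0" using pq by (simp add: com_def L_diff L_u sharp_I)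
  then show ?thesis using L_zero_sym pq sharp_I by blast
qed

lemma L_frame_sum:
  assumes F: "frame u F" "p \<in> F"
  shows "L p (\<Sum>q\<in>F. c q *\<^sub>R q) = c p *\<^sub>R p"
proof -
  have p: "p \<in> I" "L p p = p" using F by (auto simp: frame_def atom_I atom_sharp sharp_L_self)
  have "L p (\<Sum>q\<in>F. c q *\<^sub>R q) = (\<Sum>q\<in>F. if q = p then c p *\<^sub>R p else 0)"
    unfolding L_sum[OF p(1)] using frame_orth[OF F] p
    by (intro sum.cong) (auto simp: L_scaleR)
  then show ?thesis using F by (simp add: frame_def)
qed

section \<open>The trace functional and positivity of the inner product on the cone\<close>

lemma inner_u_sharp: "sharp p \<Longrightarrow> inner u p = (norm p)\<^sup>2"
  using L_symmetric[of p u p] by (simp add: sharp_I L_u sharp_L_self power2_norm_eq_inner)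

lemma scaleR_in_C_imp_nonneg: "c *\<^sub>R x \<in> C \<Longrightarrow> x \<in> C \<Longrightarrow> x \<noteq> 0 \<Longrightarrow> 0 \<le> c"
  using C_antisym[of x] C_scaleR_cancel[of "- c" "- x"] by force

lemma frame_coeff_nonneg:
  assumes F: "frame u F" "p \<in> F" and "(\<Sum>q\<in>F. c q *\<^sub>R q) \<in> C"
  shows "0 \<le> c p"
proof -
  have p: "atom p" using F by (simp add: frame_def)
  have "L p (\<Sum>q\<in>F. c q *\<^sub>R q) \<in> C" using p assms(3) by (intro L_positive atom_I)
  then have "c p *\<^sub>R p \<in> C" by (simp only: L_frame_sum[OF F])
  then show ?thesis
    using p by (intro scaleR_in_C_imp_nonneg[of "c p" p]) (auto simp: atom_nonzero sharp_C atom_sharp)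
qed

lemma inner_u_nonneg: "a \<in> C \<Longrightarrow> 0 \<le> inner u a"
proof -
  assume a: "a \<in> C"
  obtain F c where F: "frame u F" "a = (\<Sum>p\<in>F. c p *\<^sub>R p)" using spectral_decomposition by blast
  then have "inner u a = (\<Sum>p\<in>F. c p * (norm p)\<^sup>2)"
    by (simp add: inner_sum_right frame_def atom_sharp inner_u_sharp)
  then show ?thesis using frame_coeff_nonneg[OF F(1)] a F(2) by (auto intro!: sum_nonneg)
qed

text \<open>After scaling \<open>a\<close> to an effect, \<open>a = L a u\<close>, and symmetry
  turns the inner product into the trace of the positive vector \<open>L a b\<close>.\<close>

lemma inner_C_nonneg: "a \<in> C \<Longrightarrow> b \<in> C \<Longrightarrow> 0 \<le> inner a b"
proof -
  assume "a \<in> C" "b \<in> C"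
  then obtain r where r: "0 < r" "(1 / r) *\<^sub>R a \<in> I" using C_imp_I by blast
  have "inner ((1 / r) *\<^sub>R a) b = inner u (L ((1 / r) *\<^sub>R a) b)"
    using L_symmetric[OF r(2), of u b] L_u[OF r(2)] by simp
  then have "0 \<le> (1 / r) * inner a b"
    using inner_u_nonneg L_positive[OF r(2)] \<open>b \<in> C\<close> by simp
  then show ?thesis using r(1) by (simp add: zero_le_divide_iff)
qed

text \<open>Faithfulness of the trace: \<open>a\<close> is at most \<open>r u\<close>, so
  \<open>inner a a\<close> is at most \<open>r\<close> times the trace of \<open>a\<close>.\<close>

lemma inner_u_eq_0: "a \<in> C \<Longrightarrow> inner u a = 0 \<Longrightarrow> a = 0"
proof -
  assume a: "a \<in> C" "inner u a = 0"
  obtain r where r: "a \<in> order_ball r" using order_ball_exists by blast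
  then have "0 \<le> inner a (r *\<^sub>R u - a)" using inner_C_nonneg a by (auto simp: order_ball_def)
  then have "inner a a \<le> 0" using a by (simp add: inner_diff inner_commute)
  then show "a = 0" using inner_ge_zero[of a] by (metis inner_eq_zero_iff order_antisym)
qed

text \<open>The difference of the two sides is the trace of \<open>L a (u - a)\<close>, and the
  trace is faithful.\<close>

lemma sharp_iff_inner: "a \<in> I \<Longrightarrow> sharp a \<longleftrightarrow> inner u a = (norm a)\<^sup>2"
proof
  assume a: "a \<in> I" "inner u a = (norm a)\<^sup>2"
  have "inner u (L a (u - a)) = inner (L a u) (u - a)" using a by (simp add: L_symmetric)
  also have "\<dots> = 0" using a by (simp add: L_u inner_diff inner_commute power2_norm_eq_inner)
  finally have "L a (u - a) = 0"
    using a by (intro inner_u_eq_0 L_positive) (auto simp: mem_I)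
  then show "sharp a" using a by (simp add: sharp_def L_diff L_u)
qed (rule inner_u_sharp)

lemma sharp_scaleR_unique:
  assumes "sharp p" "sharp (c *\<^sub>R p)" "c \<noteq> 0"
  shows "c *\<^sub>R p = p"
proof -
  have "c * (norm p)\<^sup>2 = c\<^sup>2 * (norm p)\<^sup>2"
    using inner_u_sharp[OF assms(2)] inner_u_sharp[OF assms(1)] by (simp add: power_mult_distrib)
  then show ?thesis using assms(3) by (auto simp: power2_eq_square)
qed

lemma below_atom:
  assumes "atom q" "x \<in> C" "q - x \<in> C"
  shows "\<exists>c. x = c *\<^sub>R q"
proof -
  have "x \<in> I" using assms atom_I I_le by blast
  then obtain F c where F: "frame q F" "x = (\<Sum>p\<in>F. c p *\<^sub>R p)"
    using spectral_decomposition_below assms atom_sharp by blast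
  have "p = q" if "p \<in> F" for p
    using that frame_below[OF F(1) that] F(1) assms(1) unfolding atom_def frame_def by metis
  then have "F \<subseteq> {q}" by blast
  then show ?thesis using F(2) by (auto simp: subset_singleton_iff intro: exI[of _ 0])
qed

text \<open>Only multiples of \<open>q\<close> lie below an atom \<open>q\<close>, so
  \<open>L q\<close> has rank one; symmetry identifies it as the orthogonal projection onto the line
  of \<open>q\<close>.\<close>

lemma L_atom:
  assumes q: "atom q"
  shows "L q x = (inner q x / (norm q)\<^sup>2) *\<^sub>R q"
proof (rule linear_eq_on_I[where f = "L q" and g = "\<lambda>x. (inner q x / (norm q)\<^sup>2) *\<^sub>R q"])
  show "linear (L q)" using q by (intro linear_L atom_I)
  show "linear (\<lambda>x. (inner q x / (norm q)\<^sup>2) *\<^sub>R q)"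
    by (intro linearI) (auto simp: inner_add_right add_divide_distrib scaleR_add_left)
  fix b assume b: "b \<in> I"
  obtain c where c: "L q b = c *\<^sub>R q"
    using below_atom[OF q L_positive[OF atom_I[OF q] I_imp_C[OF b]]] L_le[OF atom_I[OF q] b] by blast
  have "inner q b = inner (L q q) b" using q by (simp add: atom_sharp sharp_L_self)
  also have "\<dots> = c * (norm q)\<^sup>2"
    using q c by (simp add: L_symmetric atom_I power2_norm_eq_inner)
  finally show "L q b = (inner q b / (norm q)\<^sup>2) *\<^sub>R q"
    using q c by (simp add: atom_nonzero)
qed

section \<open>Transport of atoms\<close>

text \<open>Left multiplication by \<open>ray e r\<close> transports atoms; as \<open>r\<close> goes from \<open>1\<close> to \<open>0\<close> it moves from the
  identity to \<open>L e\<close>.\<close>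

definition ray :: "'v \<Rightarrow> real \<Rightarrow> 'v" where
  "ray e r = e + r *\<^sub>R (u - e)"

context
  fixes e assumes e: "sharp e"
begin

lemma ray_I: "0 \<le> r \<Longrightarrow> r \<le> 1 \<Longrightarrow> ray e r \<in> I"
proof -
  assume r: "0 \<le> r" "r \<le> 1"
  have "u - ray e r = (1 - r) *\<^sub>R (u - e)" by (simp add: ray_def algebra_simps)
  then show ?thesis
    using r sharp_C[OF e] sharp_C[OF sharp_orth[OF e]] unfolding mem_I
    by (auto simp: ray_def intro: C_add C_scaleR)
qed

lemma
  assumes r: "0 \<le> r" "r \<le> 1"
  shows com_ray: "com e (ray e r)"
    and L_ray_self: "L (ray e r) e = e" and L_ray_orth: "L (ray e r) (u - e) = r *\<^sub>R (u - e)"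
proof -
  have "ray e r - e \<in> C"
    using r sharp_C[OF sharp_orth[OF e]] by (auto simp: ray_def intro: C_scaleR)
  note * = sharp_below[OF e ray_I[OF r] this]
  show "com e (ray e r)" by (rule *)
  then show "L (ray e r) e = e" using * by (simp add: com_def)
  then show "L (ray e r) (u - e) = r *\<^sub>R (u - e)"
    using ray_I[OF r] by (simp add: L_diff L_u) (simp add: ray_def)
qed

text \<open>A multiplicative one-parameter semigroup: \<open>L (ray e r)\<close> fixes
  \<open>e\<close> and scales \<open>u - e\<close> by \<open>r\<close>, so rays of the same
  \<open>e\<close> commute and their parameters multiply.\<close>

lemma L_ray_ray:
  assumes "0 \<le> r" "r \<le> 1" "0 \<le> s" "s \<le> 1"
  shows "L (ray e r) (L (ray e s) x) = L (ray e (r * s)) x"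
proof -
  have "L (ray e r) (ray e s) = ray e (r * s)" if "0 \<le> r" "r \<le> 1" for r s
    using that ray_I[OF that]
    by (simp add: ray_def[of e s] L_add L_scaleR L_ray_self L_ray_orth del: scaleR_diff_right)
      (simp add: ray_def mult.commute)
  then show ?thesis
    using L_L[OF ray_I[OF assms(1,2)] ray_I[OF assms(3,4)]] assms
    by (simp add: com_def mult.commute)
qed

lemma L_ray_form_upper:
  assumes r: "0 \<le> r" "r \<le> 1"
  shows "inner (L (ray e r) x) x \<le> (norm x)\<^sup>2"
proof -
  have "inner (L (ray e r) x) x \<le> norm (L (ray e r) x) * norm x" by (rule norm_cauchy_schwarz)
  also have "\<dots> \<le> norm x * norm x" using norm_L[OF ray_I[OF r]] by (intro mult_right_mono) auto
  finally show ?thesis by (simp add: power2_eq_square)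
qed

end

text \<open>The rays of \<open>e\<close> and of \<open>u - e\<close> commute with product
  \<open>r u\<close>. For \<open>r > 0\<close> the operator of a ray is therefore invertible with
  positive inverse, an order automorphism of the cone.\<close>

lemma L_ray_L_ray_orth:
  assumes e: "sharp e" and r: "0 \<le> r" "r \<le> 1"
  shows "L (ray e r) (L (ray (u - e) r) x) = r *\<^sub>R x"
    and "L (ray (u - e) r) (L (ray e r) x) = r *\<^sub>R x"
proof -
  note eI = ray_I[OF e r] and e'I = ray_I[OF sharp_orth[OF e] r]
  have 1: "L (ray e r) (ray (u - e) r) = r *\<^sub>R u"
    using eI L_ray_self[OF e r] L_ray_orth[OF e r]
    by (simp add: ray_def[of "u - e"] L_add L_scaleR) (simp add: algebra_simps)
  have 2: "L (ray (u - e) r) (ray e r) = r *\<^sub>R u"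
    using e'I L_ray_self[OF sharp_orth[OF e] r] L_ray_orth[OF sharp_orth[OF e] r]
    by (simp add: ray_def[of "e"] L_add L_scaleR) (simp add: algebra_simps)
  show "L (ray e r) (L (ray (u - e) r) x) = r *\<^sub>R x"
    using L_L[OF eI e'I] 1 2 r by (simp add: com_def L_u_scaled)
  show "L (ray (u - e) r) (L (ray e r) x) = r *\<^sub>R x"
    using L_L[OF e'I eI] 1 2 r by (simp add: com_def L_u_scaled)
qed

text \<open>With \<open>s = sqrt r\<close> the form is
  \<open>(norm (L (ray e s) x))\<^sup>2\<close>, and applying the contraction
  \<open>L (ray (u - e) s)\<close> recovers \<open>s x\<close>.\<close>

lemma L_ray_form_lower:
  assumes e: "sharp e" and r: "0 \<le> r" "r \<le> 1"
  shows "r * (norm x)\<^sup>2 \<le> inner (L (ray e r) x) x"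
proof -
  define s where "s = sqrt r"
  have s: "0 \<le> s" "s \<le> 1" "s * s = r" using r by (auto simp: s_def)
  have "s * norm x = norm (L (ray (u - e) s) (L (ray e s) x))"
    using L_ray_L_ray_orth(2)[OF e s(1,2)] s by simp
  also have "\<dots> \<le> norm (L (ray e s) x)" by (intro norm_L ray_I sharp_orth e s)
  finally have "(s * norm x)\<^sup>2 \<le> (norm (L (ray e s) x))\<^sup>2" using s by (intro power_mono) auto
  also have "\<dots> = inner (L (ray e s) (L (ray e s) x)) x"
    using L_symmetric[OF ray_I[OF e s(1,2)]] by (simp add: power2_norm_eq_inner)
  also have "\<dots> = inner (L (ray e r) x) x"
    using L_ray_ray[OF e s(1,2) s(1,2)] s by simp
  finally show ?thesis using s(3) by (simp add: power_mult_distrib power2_eq_square[of s])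
qed

text \<open>Substitute for continuity in the left factor: the form of \<open>L (ray e r)\<close>
  lies between \<open>r\<close> and \<open>1\<close> times the squared norm.\<close>

lemma norm_diff_L_ray:
  assumes e: "sharp e" and r: "0 \<le> r" "r \<le> 1"
  shows "norm (x - L (ray e r) x) \<le> (1 - r) * norm x"
proof (rule symmetric_norm_le_of_form_le[where f = "\<lambda>x. x - L (ray e r) x"])
  note I = ray_I[OF e r]
  show "linear (\<lambda>x. x - L (ray e r) x)"
    using I by (intro linearI) (auto simp: L_add L_scaleR algebra_simps)
  show "inner (x - L (ray e r) x) y = inner x (y - L (ray e r) y)" for x y
    using I by (simp add: inner_diff L_symmetric)
  show "\<bar>inner (x - L (ray e r) x) x\<bar> \<le> (1 - r) * (norm x)\<^sup>2" for x
    using L_ray_form_upper[OF e r, of x] L_ray_form_lower[OF e r, of x]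
    by (simp add: inner_diff power2_norm_eq_inner algebra_simps)
qed

text \<open>One nonzero spectral term of \<open>A q\<close>, pulled back by \<open>B\<close>, lies
  below \<open>r q\<close> and is thus a multiple of the atom \<open>q\<close>; pushed forward
  again, the term is a multiple of \<open>A q\<close>. The bounds on \<open>m\<close> hold because
  \<open>A q\<close> and \<open>B p\<close> are effects while atoms have order unit norm
  \<open>1\<close>.\<close>

lemma L_ray_atom:
  assumes e: "sharp e" and r: "0 < r" "r \<le> 1" and q: "atom q"
  shows "\<exists>m p. r \<le> m \<and> m \<le> 1 \<and> atom p \<and> L (ray e r) q = m *\<^sub>R p"
proof -
  define A where "A = L (ray e r)"
  define B where "B = L (ray (u - e) r)"
  have rI: "ray e r \<in> I" "ray (u - e) r \<in> I" using e r by (auto intro: ray_I sharp_orth)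
  have AB: "A (B x) = r *\<^sub>R x" "B (A x) = r *\<^sub>R x" for x
    unfolding A_def B_def using e r by (auto simp: L_ray_L_ray_orth)
  have AI: "A q \<in> I" unfolding A_def using rI q by (simp add: L_closed atom_I)
  obtain F c where F: "frame u F" "A q = (\<Sum>p\<in>F. c p *\<^sub>R p)"
    using spectral_decomposition by blast
  have "A q \<noteq> 0" using AB(2)[of q] r q L_0[OF rI(2)] by (auto simp: B_def atom_nonzero)
  then obtain p where p: "p \<in> F" "c p \<noteq> 0" using F(2) by (metis (no_types, lifting) scaleR_zero_left sum.neutral)
  have c: "0 \<le> c p'" if "p' \<in> F" for p'
    using frame_coeff_nonneg[OF F(1) that] AI F(2) by (simp add: mem_I)
  have atom_p: "atom p" using F p by (simp add: frame_def)
  have "A q - c p *\<^sub>R p = (\<Sum>p'\<in>F - {p}. c p' *\<^sub>R p')"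
    using F p by (simp add: frame_def sum.remove)
  also have "\<dots> \<in> C"
    using F c by (intro C_sum C_scaleR) (auto simp: frame_def sharp_C atom_sharp)
  finally have "B (A q) - B (c p *\<^sub>R p) \<in> C" unfolding B_def by (intro L_mono rI)
  then have "(1 / r) *\<^sub>R (r *\<^sub>R q - B (c p *\<^sub>R p)) \<in> C"
    unfolding AB(2) using r by (simp add: C_scaleR_cancel)
  then have "q - (1 / r) *\<^sub>R B (c p *\<^sub>R p) \<in> C" using r by (simp add: scaleR_diff_right)
  moreover have "(1 / r) *\<^sub>R B (c p *\<^sub>R p) \<in> C"
    unfolding B_def using r c p atom_p by (intro C_scaleR L_positive rI) (auto simp: sharp_C atom_sharp)
  ultimately obtain k where "(1 / r) *\<^sub>R B (c p *\<^sub>R p) = k *\<^sub>R q"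
    using below_atom[OF q] by blast
  then have "r *\<^sub>R ((1 / r) *\<^sub>R B (c p *\<^sub>R p)) = r *\<^sub>R (k *\<^sub>R q)" by simp
  then have "B (c p *\<^sub>R p) = (r * k) *\<^sub>R q" using r by simp
  then have "A (B (c p *\<^sub>R p)) = (r * k) *\<^sub>R A q"
    by (simp add: A_def L_scaleR rI)
  then have "r *\<^sub>R (c p *\<^sub>R p) = r *\<^sub>R (k *\<^sub>R A q)" by (simp add: AB)
  then have kA: "c p *\<^sub>R p = k *\<^sub>R A q" using r by (simp only: scaleR_cancel_left) simp
  then have "k \<noteq> 0" using p atom_p by (auto simp: atom_nonzero)
  define m where "m = c p / k"
  have Aq: "A q = m *\<^sub>R p"
  proof -
    have "m *\<^sub>R p = (1 / k) *\<^sub>R (c p *\<^sub>R p)" by (simp add: m_def)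
    then show ?thesis using kA \<open>k \<noteq> 0\<close> by simp
  qed
  have pC: "p \<in> C" "sharp p" "p \<noteq> 0" using atom_p by (auto simp: sharp_C atom_sharp atom_nonzero)
  have "0 \<le> m" using scaleR_in_C_imp_nonneg[of m p] AI Aq pC by (simp add: mem_I)
  then have m0: "0 < m" using Aq \<open>A q \<noteq> 0\<close> by (cases "m = 0") auto
  have "m \<le> 1"
  proof (rule ccontr)
    assume m: "\<not> m \<le> 1"
    have "u - m *\<^sub>R p \<in> C" using AI Aq by (simp add: mem_I)
    then have "(1 / m) *\<^sub>R (u - m *\<^sub>R p) \<in> C" using m0 by (simp add: C_scaleR_cancel)
    then have "(1 / m) *\<^sub>R u - p \<in> C" using m0 by (simp add: scaleR_diff_right)
    then show False using sharp_le_scaled_u[of p "1 / m"] m pC by auto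
  qed
  moreover have "r \<le> m"
  proof (rule ccontr)
    assume m: "\<not> r \<le> m"
    have "r *\<^sub>R q = m *\<^sub>R B p" using AB(2)[of q] Aq by (simp add: B_def L_scaleR rI)
    moreover have "m *\<^sub>R (u - B p) \<in> C"
      using L_closed[OF rI(2) atom_I[OF atom_p]] m0 by (intro C_scaleR) (simp_all add: B_def mem_I)
    ultimately have "m *\<^sub>R u - r *\<^sub>R q \<in> C" by (simp add: scaleR_diff_right)
    then have "(1 / r) *\<^sub>R (m *\<^sub>R u - r *\<^sub>R q) \<in> C" using r by (intro C_scaleR) auto
    then have "(m / r) *\<^sub>R u - q \<in> C" using r by (simp add: scaleR_diff_right)
    then show False using sharp_le_scaled_u[of q "m / r"] m r q by (auto simp: atom_sharp atom_nonzero)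
  qed
  ultimately show ?thesis using Aq atom_p unfolding A_def by blast
qed

text \<open>The numbers \<open>inner p (u - q)\<close> and \<open>inner q (u - p)\<close> are
  nonnegative; their difference is the trace difference and their sum is
  \<open>(norm (p - q))\<^sup>2\<close>.\<close>

lemma trace_diff_le:
  assumes "sharp p" "sharp q"
  shows "\<bar>inner u p - inner u q\<bar> \<le> (norm (p - q))\<^sup>2"
proof -
  have "0 \<le> inner p (u - q)" "0 \<le> inner q (u - p)"
    using assms by (auto intro!: inner_C_nonneg simp: sharp_C sharp_orth)
  moreover have "(norm (p - q))\<^sup>2 = inner u p + inner u q - 2 * inner p q"
    using assms[THEN inner_u_sharp]
    by (simp add: power2_norm_eq_inner inner_diff inner_commute)
  ultimately show ?thesis by (simp add: inner_diff inner_commute)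
qed

lemma atom_scaled_eq:
  assumes "atom p" "atom q" "c *\<^sub>R p = d *\<^sub>R q" "d \<noteq> 0"
  shows "p = q"
proof -
  have "q = (1 / d) *\<^sub>R (d *\<^sub>R q)" using assms(4) by simp
  also have "\<dots> = (c / d) *\<^sub>R p" by (simp flip: assms(3))
  finally have q: "q = (c / d) *\<^sub>R p" .
  then have "c / d \<noteq> 0" using assms(2) atom_nonzero by fastforce
  then show ?thesis using sharp_scaleR_unique[of p "c / d"] assms q by (metis atom_sharp)
qed

text \<open>By \<open>trace_diff_le\<close> the trace of the transported atom varies at most quadratically in
  the path parameter \<open>t\<close>, hence not at all.\<close>

lemma L_ray_atom_trace:
  assumes e: "sharp e" and r: "0 < r" "r \<le> 1" and q: "atom q"
  shows "\<exists>m p. r \<le> m \<and> m \<le> 1 \<and> atom p \<and> L (ray e r) q = m *\<^sub>R p \<and> inner u p = inner u q"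
proof -
  \<comment> \<open>The parameter \<open>r = exp (- t)\<close> makes the semigroup additive in
    \<open>t\<close>: the atom at time \<open>t\<close> is the atom at time \<open>s\<close>
    transported by a ray that depends only on \<open>t - s\<close>.\<close>
  have "\<exists>p. atom p \<and> (\<exists>m. exp (- t) \<le> m \<and> m \<le> 1 \<and> L (ray e (exp (- t))) q = m *\<^sub>R p)" if "0 \<le> t" for t
    using L_ray_atom[OF e _ _ q, of "exp (- t)"] that by auto
  then obtain Q where "\<forall>t. 0 \<le> t \<longrightarrow> atom (Q t) \<and> (\<exists>m. exp (- t) \<le> m \<and> m \<le> 1 \<and> L (ray e (exp (- t))) q = m *\<^sub>R Q t)"
    by metis
  then obtain M where Q: "\<And>t. 0 \<le> t \<Longrightarrow> atom (Q t)"
    and M: "\<And>t. 0 \<le> t \<Longrightarrow> exp (- t) \<le> M t" "\<And>t. 0 \<le> t \<Longrightarrow> M t \<le> 1"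
    and QM: "\<And>t. 0 \<le> t \<Longrightarrow> L (ray e (exp (- t))) q = M t *\<^sub>R Q t"
    by metis
  have M0: "M t \<noteq> 0" if "0 \<le> t" for t using M(1)[OF that] exp_gt_zero[of "- t"] by linarith
  have step: "norm (Q t - Q s) \<le> 2 * (t - s) * norm u" if st: "0 \<le> s" "s \<le> t" for s t
  proof -
    define h where "h = exp (- (t - s))"
    have h: "0 < h" "h \<le> 1" "1 - h \<le> t - s"
      using st exp_ge_add_one_self[of "- (t - s)"] unfolding h_def by (simp, simp, linarith)
    obtain m p where mp: "h \<le> m" "m \<le> 1" "atom p" "L (ray e h) (Q s) = m *\<^sub>R p"
      using L_ray_atom[OF e h(1,2) Q[OF st(1)]] by blast
    have "M t *\<^sub>R Q t = L (ray e (h * exp (- s))) q"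
      using QM[of t] st by (simp add: h_def flip: exp_add)
    also have "\<dots> = L (ray e h) (M s *\<^sub>R Q s)"
      using L_ray_ray[OF e, of h "exp (- s)" q] h st by (simp add: QM)
    also have "\<dots> = (M s * m) *\<^sub>R p" using mp(4) h by (simp add: L_scaleR ray_I e)
    finally have "p = Q t"
      using atom_scaled_eq[OF mp(3) Q[of t], of "M s * m" "M t"] st M0[of t] by simp
    then have "Q t - Q s = (1 - m) *\<^sub>R Q t - (Q s - L (ray e h) (Q s))"
      by (simp add: mp(4) algebra_simps)
    then have "norm (Q t - Q s) \<le> norm ((1 - m) *\<^sub>R Q t) + norm (Q s - L (ray e h) (Q s))"
      by (metis norm_triangle_ineq4)
    also have "\<dots> \<le> (1 - m) * norm (Q t) + (1 - h) * norm (Q s)"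
      using norm_diff_L_ray[OF e, of h "Q s"] h mp by simp
    also have "\<dots> \<le> (t - s) * norm u + (t - s) * norm u"
      using h mp st Q by (intro add_mono mult_mono norm_I atom_I) auto
    finally show ?thesis by (simp only: mult_2 distrib_right)
  qed
  have "\<bar>inner u (Q t) - inner u (Q s)\<bar> \<le> (4 * (norm u)\<^sup>2) * (t - s)\<^sup>2" if st: "0 \<le> s" "s \<le> t" for s t
  proof -
    have "\<bar>inner u (Q t) - inner u (Q s)\<bar> \<le> (norm (Q t - Q s))\<^sup>2"
      using st Q by (intro trace_diff_le atom_sharp) auto
    also have "\<dots> \<le> (2 * (t - s) * norm u)\<^sup>2" using step[OF st] by (intro power_mono) auto
    also have "\<dots> = (4 * (norm u)\<^sup>2) * (t - s)\<^sup>2"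
      by (simp only: power_mult_distrib) simp
    finally show ?thesis .
  qed
  then have const: "inner u (Q t) = inner u (Q 0)" if "0 \<le> t" for t
    using quadratic_variation_imp_constant[of "\<lambda>t. inner u (Q t)"] that by blast
  have "1 *\<^sub>R q = M 0 *\<^sub>R Q 0" using QM[of 0] by (simp add: ray_def L_u_left)
  then have "q = Q 0" using atom_scaled_eq[OF q Q[of 0] _ M0[of 0], of 1] by simp
  moreover define t where "t = - ln r"
  moreover have "0 \<le> t" "exp (- t) = r" using r by (auto simp: t_def)
  ultimately show ?thesis using Q[of t] M[of t] QM[of t] const[of t] by auto
qed


text \<open>These operators are the even powers of \<open>L (ray e (1 / 2))\<close>, so a limit
  \<open>y\<close> exists. It lies between \<open>0\<close> and \<open>e\<close>, hence is fixed by
  \<open>L e\<close>, and \<open>L e\<close> maps every term to \<open>L e b\<close>.\<close>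

lemma L_ray_power_tendsto:
  assumes e: "sharp e" and b: "b \<in> I"
  shows "(\<lambda>n. L (ray e ((1 / 2) ^ (2 * n))) b) \<longlonglongrightarrow> L e b"
proof -
  define r where "r n = (1 / 2 :: real) ^ n" for n
  have r: "0 \<le> r n" "r n \<le> 1" for n by (simp_all add: r_def power_le_one)
  have half: "ray e (1 / 2) \<in> I" by (intro ray_I e) auto
  have pow: "(L (ray e (1 / 2)) ^^ n) b = L (ray e (r n)) b" for n
  proof (induction n)
    case (Suc n)
    then show ?case using L_ray_ray[OF e, of "1 / 2" "r n" b] r[of n] by (simp add: r_def)
  qed (simp add: r_def ray_def L_u_left)
  obtain y where y: "(\<lambda>n. L (ray e (r (2 * n))) b) \<longlonglongrightarrow> y"
    using even_powers_of_symmetric_contraction_convergent[of "L (ray e (1 / 2))" b,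
        OF L_symmetric[OF half] norm_L[OF half]] by (auto simp: pow convergent_def)
  have "(\<lambda>n. r (2 * n)) \<longlonglongrightarrow> 0"
    unfolding r_def power_mult by (rule LIMSEQ_realpow_zero) (auto simp: power2_eq_square)
  then have ray: "(\<lambda>n. ray e (r (2 * n))) \<longlonglongrightarrow> e"
    unfolding ray_def by (auto intro!: tendsto_eq_intros)
  have LI: "L (ray e (r n)) b \<in> I" for n using e b r by (intro L_closed ray_I)
  have "y \<in> C"
    using y LI by (intro Lim_in_closed_set[OF closed_C _ _ y]) (auto simp: mem_I)
  moreover have "e - y \<in> C"
  proof (rule Lim_in_closed_set[OF closed_C])
    show "(\<lambda>n. ray e (r (2 * n)) - L (ray e (r (2 * n))) b) \<longlonglongrightarrow> e - y"
      by (intro tendsto_diff ray y)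
    show "\<forall>\<^sub>F n in sequentially. ray e (r (2 * n)) - L (ray e (r (2 * n))) b \<in> C"
      using e b r by (intro always_eventually allI L_le ray_I)
  qed simp
  ultimately have "L e y = y" using sharp_above(1)[OF e] I_le sharp_I[OF e] by blast
  moreover have "L e (L (ray e (r n)) b) = L e b" for n
  proof -
    have "L e (ray e (r n)) = e"
      using com_ray[OF e r] L_ray_self[OF e r] by (simp add: com_def)
    then show ?thesis using L_L[OF sharp_I[OF e] ray_I[OF e r] com_ray[OF e r]] by metis
  qed
  then have "(\<lambda>n. L e b) \<longlonglongrightarrow> L e y"
    using bounded_linear.tendsto[OF bounded_linear_L[OF sharp_I[OF e]] y] by simp
  then have "L e y = L e b" by (simp add: LIMSEQ_const_iff)
  ultimately show ?thesis using y by (simp add: r_def)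
qed

section \<open>Compressions of atoms by sharp elements\<close>

text \<open>Each \<open>z n\<close> is a positive multiple of an atom of trace \<open>d\<close>, so
  \<open>(norm (z n))\<^sup>2 = (inner u (z n))\<^sup>2 / d\<close> and \<open>z n\<close> is at
  most \<open>inner u (z n) / d\<close> times \<open>u\<close>. Both facts pass to the limit
  \<open>L e q\<close>; rescaled to trace \<open>d\<close> it is an effect satisfying
  \<open>sharp_iff_inner\<close>.\<close>

lemma compressed_atom_sharp:
  assumes e: "sharp e" and q: "atom q" and "L e q \<noteq> 0"
  shows "\<exists>p. sharp p \<and> L e q = (inner e q / (norm q)\<^sup>2) *\<^sub>R p \<and> (norm p)\<^sup>2 = (norm q)\<^sup>2 \<and> 0 < inner e q"
proof -
  define r where "r n = (1 / 2 :: real) ^ (2 * n)" for n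
  have r: "0 < r n" "r n \<le> 1" for n by (simp_all add: r_def power_le_one)
  define d where "d = (norm q)\<^sup>2"
  have d: "0 < d" using q by (simp add: d_def atom_nonzero)
  have dq: "inner u q = d" using q by (simp add: d_def inner_u_sharp atom_sharp)
  define z where "z n = L (ray e (r n)) q" for n
  have lim: "z \<longlonglongrightarrow> L e q"
    using L_ray_power_tendsto[OF e atom_I[OF q]] by (simp add: z_def[abs_def] r_def)
  have z: "(norm (z n))\<^sup>2 = (inner u (z n))\<^sup>2 / d \<and> (inner u (z n) / d) *\<^sub>R u - z n \<in> C" for n
  proof -
    obtain m p where "r n \<le> m" "atom p" "L (ray e (r n)) q = m *\<^sub>R p" "inner u p = inner u q"
      using L_ray_atom_trace[OF e r[of n] q] by blast
    then have mp: "0 < m" "atom p" "z n = m *\<^sub>R p" "inner u p = inner u q"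
      using r(1)[of n] by (auto simp: z_def)
    have "(norm p)\<^sup>2 = d" using mp dq inner_u_sharp[OF atom_sharp[OF mp(2)]] by simp
    moreover have "(inner u (z n) / d) *\<^sub>R u - z n = m *\<^sub>R (u - p)"
      using mp dq d by (simp add: scaleR_diff_right)
    moreover have "m *\<^sub>R (u - p) \<in> C"
      using mp atom_I[OF mp(2)] by (intro C_scaleR) (auto simp: mem_I)
    ultimately show ?thesis
      using mp dq d by (simp add: power_mult_distrib) (simp add: power2_eq_square)
  qed
  have s: "inner u (L e q) = inner e q"
    using L_symmetric[of e u q] e by (simp add: L_u sharp_I)
  have "(\<lambda>n. (norm (z n))\<^sup>2) \<longlonglongrightarrow> (norm (L e q))\<^sup>2" by (intro tendsto_intros lim)
  moreover have "(\<lambda>n. (norm (z n))\<^sup>2) \<longlonglongrightarrow> (inner e q)\<^sup>2 / d"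
    using z d unfolding s[symmetric] by (auto intro!: tendsto_intros lim)
  ultimately have norm: "(norm (L e q))\<^sup>2 = (inner e q)\<^sup>2 / d" by (rule LIMSEQ_unique)
  have "(inner e q / d) *\<^sub>R u - L e q \<in> C"
    unfolding s[symmetric] using z d
    by (intro Lim_in_closed_set[OF closed_C, of "\<lambda>n. (inner u (z n) / d) *\<^sub>R u - z n"])
      (auto intro!: tendsto_intros lim)
  moreover have pos: "0 < inner e q"
    using norm assms inner_C_nonneg[of e q] d
    by (cases "inner e q = 0") (auto simp: sharp_C atom_sharp)
  define s where "s = inner e q / d"
  have s0: "0 < s" using pos d by (simp add: s_def)
  define p where "p = (1 / s) *\<^sub>R L e q"
  have Lp: "L e q = s *\<^sub>R p" using s0 by (simp add: p_def)
  have "s *\<^sub>R (u - p) \<in> C" using calculation by (simp add: s_def[symmetric] Lp scaleR_diff_right)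
  then have "u - p \<in> C" using s0 by (simp only: C_scaleR_cancel)
  moreover have "p \<in> C"
    unfolding p_def using s0 e q by (intro C_scaleR L_positive) (auto simp: sharp_I sharp_C atom_sharp)
  ultimately have pI: "p \<in> I" by (simp add: mem_I)
  have "s\<^sup>2 * (norm p)\<^sup>2 = s\<^sup>2 * d" 
    using norm d s0 by (simp add: Lp power_mult_distrib) (simp add: s_def power2_eq_square)
  then have np: "(norm p)\<^sup>2 = d" using s0 by simp
  have "s * inner u p = s * d" using \<open>inner u (L e q) = inner e q\<close> d by (simp add: Lp) (simp add: s_def)
  then have "inner u p = d" using s0 by simp
  then have "sharp p" using sharp_iff_inner[OF pI] np by simp
  then show ?thesis using Lp np pos unfolding s_def d_def by blast
qed

text \<open>The nonzero vector \<open>L p q\<close> is a multiple of \<open>p\<close>, and also of a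
  sharp element with the norm of \<open>q\<close>; proportional nonzero sharp elements
  coincide.\<close>

lemma non_orthogonal_atoms_norm_eq:
  assumes p: "atom p" and q: "atom q" and "inner p q \<noteq> 0"
  shows "norm p = norm q"
proof -
  have "L p q \<noteq> 0" using assms by (simp add: L_atom atom_nonzero)
  then obtain p' where p': "sharp p'" "L p q = (inner p q / (norm q)\<^sup>2) *\<^sub>R p'" "(norm p')\<^sup>2 = (norm q)\<^sup>2"
    using compressed_atom_sharp[OF atom_sharp[OF p] q] by blast
  have "p' = ((norm q)\<^sup>2 / (norm p)\<^sup>2) *\<^sub>R p"
  proof -
    have "p' = ((norm q)\<^sup>2 / inner p q) *\<^sub>R L p q"
      using p'(2) assms(3) q by (simp add: atom_nonzero)
    then show ?thesis using assms(3) L_atom[OF p, of q] by simp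
  qed
  moreover have "(norm q)\<^sup>2 / (norm p)\<^sup>2 \<noteq> 0" using p q by (simp add: atom_nonzero)
  ultimately have "p' = p" using sharp_scaleR_unique[OF atom_sharp[OF p]] p'(1) by metis
  then show ?thesis using p'(3) by (simp add: power2_eq_iff_nonneg)
qed

lemma norm_sharp_frame: "frame e F \<Longrightarrow> sharp e \<Longrightarrow> (norm e)\<^sup>2 = (\<Sum>p\<in>F. (norm p)\<^sup>2)"
proof -
  assume F: "frame e F" and "sharp e"
  then have "(norm e)\<^sup>2 = inner u (\<Sum>F)" using inner_u_sharp by (simp add: frame_def)
  also have "\<dots> = (\<Sum>p\<in>F. (norm p)\<^sup>2)"
    unfolding inner_sum_right using F by (intro sum.cong) (auto simp: frame_def inner_u_sharp atom_sharp)
  finally show ?thesis .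
qed

text \<open>The sharp element \<open>r\<close> has the norm of \<open>q\<close> and is not
  orthogonal to \<open>q\<close>. Some atom in a frame of \<open>r\<close> is then not orthogonal to
  \<open>q\<close> either; it already has the norm of \<open>q\<close> and leaves no room for
  another atom.\<close>

lemma L_orth_atom_atom:
  assumes p: "atom p" and q: "atom q" and pq: "p \<noteq> q"
  shows "\<exists>r. atom r \<and> L (u - p) q = (inner (u - p) q / (norm q)\<^sup>2) *\<^sub>R r \<and> 0 < inner (u - p) q"
proof -
  have e: "sharp (u - p)" using p by (intro sharp_orth atom_sharp)
  have "L (u - p) q \<noteq> 0"
  proof
    assume "L (u - p) q = 0"
    then have "p - q \<in> C" using L_eq_0_imp(2)[OF e atom_I[OF q]] by simp
    then show False using p q pq atom_sharp atom_nonzero unfolding atom_def by metis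
  qed
  then obtain r where r: "sharp r" "L (u - p) q = (inner (u - p) q / (norm q)\<^sup>2) *\<^sub>R r"
    "(norm r)\<^sup>2 = (norm q)\<^sup>2" "0 < inner (u - p) q"
    using compressed_atom_sharp[OF e q] by blast
  have "r - 0 \<in> C" using r by (simp add: sharp_C)
  then obtain F where F: "frame r F"
    using spectral_decomposition_below[OF r(1) zero_in_I] by blast
  have "inner (L (u - p) q) q = (norm (L (u - p) q))\<^sup>2"
    using L_symmetric[OF sharp_I[OF e], of q "L (u - p) q"] L_idem[OF e, of q]
    by (simp add: power2_norm_eq_inner inner_commute)
  then have "inner r q \<noteq> 0" using r(2) \<open>L (u - p) q \<noteq> 0\<close> by auto
  moreover have "inner r q = (\<Sum>s\<in>F. inner s q)" using F by (auto simp: frame_def inner_sum_left)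
  ultimately obtain s where s: "s \<in> F" "inner s q \<noteq> 0" by (metis sum.neutral)
  have atoms: "atom t" if "t \<in> F" for t using F that by (simp add: frame_def)
  have "norm s = norm q" using non_orthogonal_atoms_norm_eq[OF atoms[OF s(1)] q s(2)] .
  then have "(\<Sum>t\<in>F - {s}. (norm t)\<^sup>2) = 0"
    using norm_sharp_frame[OF F r(1)] r(3) s(1) F by (simp add: frame_def sum.remove[of F s])
  then have "F - {s} = {}"
    using F atoms atom_nonzero by (force simp: frame_def sum_nonneg_eq_0_iff)
  then have "F = {s}" using s(1) by blast
  then have "r = s" using F by (simp add: frame_def)
  then show ?thesis using r atoms[OF s(1)] by blast
qed

section \<open>Peirce operators of sharp elements\<close>

text \<open>It is the identity on the range of \<open>L p\<close>, zero on the range of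
  \<open>L (u - p)\<close> and one half where both vanish.\<close>

definition T :: "'v \<Rightarrow> 'v \<Rightarrow> 'v" where
  "T p x = (1 / 2) *\<^sub>R (x + L p x - L (u - p) x)"

text \<open>The minimality half of \<open>p + r\<close> being the supremum of \<open>p\<close> and
  \<open>q\<close>. A sharp \<open>f\<close> above both fixes \<open>q\<close> and commutes with
  \<open>u - p\<close>, so it fixes \<open>r\<close>; hence \<open>f - p\<close> fixes
  \<open>r\<close> too.\<close>

lemma sharp_sum_le_upper_bound:
  assumes p: "sharp p" and q: "sharp q" and r: "sharp r" and f: "sharp f"
    and pf: "f - p \<in> C" and qf: "f - q \<in> C" and rs: "L (u - p) q = s *\<^sub>R r" "s \<noteq> 0"
  shows "f - (p + r) \<in> C"
proof -
  have p': "sharp (u - p)" and f': "sharp (u - f)" using p f by (auto intro: sharp_orth)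
  have r_le: "L (u - p) r = r"
  proof -
    have "s *\<^sub>R L (u - p) r = s *\<^sub>R r"
      using L_idem[OF p', of q] by (simp add: rs L_scaleR sharp_I p')
    then show ?thesis using rs(2) by simp
  qed
  have cpf: "com p f" "com q f"
    using sharp_above(2)[OF f sharp_I pf] sharp_above(2)[OF f sharp_I qf] p q com_sym by auto
  have cp'f: "com (u - p) f"
    using cpf(1) com_sym com_orth p f sharp_I by metis
  have "s *\<^sub>R L f r = L f (L (u - p) q)" by (simp add: rs L_scaleR sharp_I f)
  also have "\<dots> = L (u - p) (L f q)"
    using L_commute[OF sharp_I[OF p'] sharp_I[OF f] cp'f] by simp
  also have "\<dots> = s *\<^sub>R r"
    using sharp_above(1)[OF f sharp_I[OF q] qf] rs by simp
  finally have fr: "L f r = r" using rs(2) by simp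
  have "L (u - p) f = f - p"
    using sharp_below(1)[OF p sharp_I[OF f] pf] cp'f cpf(1) p f
    by (simp add: com_def L_diff L_u sharp_I)
  then have "L (f - p) r = L (u - p) (L f r)"
    using L_L[OF sharp_I[OF p'] sharp_I[OF f] cp'f] by simp
  then have "L (f - p) r = r" by (simp add: fr r_le)
  then have "(f - p) - r \<in> C"
    using L_le[of "f - p" r] sharp_I[OF sharp_diff[OF p f pf]] r by (simp add: sharp_I)
  then show ?thesis by (simp add: algebra_simps)
qed

text \<open>For nonorthogonal atoms \<open>p\<close> and \<open>q\<close> of equal trace, both sides are
  \<open>(p + q - (1 - t) f) / 2\<close> with \<open>f\<close> the supremum of \<open>p\<close> and \<open>q\<close>.\<close>

lemma T_atoms_commute:
  assumes p: "atom p" and q: "atom q"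
  shows "T p q = T q p"
proof (cases "p = q")
  case False
  note pI = atom_I[OF p] and qI = atom_I[OF q]
  have ps: "sharp p" "sharp q" using p q by (auto simp: atom_sharp)
  show ?thesis
  proof (cases "inner p q = 0")
    case True
    have "T a b = 0" if "atom a" "atom b" "inner a b = 0" for a b
    proof -
      have "L a b = 0" using that by (simp add: L_atom)
      then have "(u - a) - b \<in> C" using L_eq_0_imp(2) that atom_sharp atom_I by blast
      then have "L (u - a) b = b"
        using sharp_above(1)[OF sharp_orth] that atom_sharp atom_I by blast
      then show ?thesis using \<open>L a b = 0\<close> by (simp add: T_def)
    qed
    then show ?thesis using p q True by (simp add: inner_commute)
  next
    case ne: False
    define d where "d = (norm p)\<^sup>2"
    have d: "d = (norm p)\<^sup>2" "d = (norm q)\<^sup>2" "d \<noteq> 0"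
      using non_orthogonal_atoms_norm_eq[OF p q ne] p by (auto simp: d_def atom_nonzero)
    define t where "t = inner p q / d"
    have Lpq: "L p q = t *\<^sub>R p" "L q p = t *\<^sub>R q"
      unfolding t_def by (simp_all only: L_atom[OF p] L_atom[OF q] inner_commute[of q p] flip: d(1,2))
    have "inner u q = d" "inner u p = d" using ps d(1,2) by (simp_all add: inner_u_sharp)
    then have u: "inner (u - p) q / d = 1 - t" "inner (u - q) p / d = 1 - t"
      using d(3) by (simp_all add: inner_diff_left diff_divide_distrib t_def inner_commute[of q p])
    obtain r where r: "atom r" "L (u - p) q = (1 - t) *\<^sub>R r" "0 < inner (u - p) q"
      using L_orth_atom_atom[OF p q False] u by (metis d(2))
    obtain r' where r': "atom r'" "L (u - q) p = (1 - t) *\<^sub>R r'"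
      using L_orth_atom_atom[OF q p] False u by (metis d(1))
    have t1: "1 - t \<noteq> 0" using r(3) u(1) d(3) by auto
    \<comment> \<open>The upper bound half: the complement \<open>g\<close> of \<open>a + c\<close>
      lies below \<open>u - a\<close>, so \<open>L g b\<close> is a multiple of
      \<open>L g c = 0\<close>, which puts \<open>b\<close> below \<open>a + c\<close>.\<close>
    have sup: "sharp (a + c) \<and> (a + c) - a \<in> C \<and> (a + c) - b \<in> C"
      if a: "sharp a" and b: "sharp b" and c: "sharp c" "L (u - a) b = (1 - t) *\<^sub>R c" for a b c
    proof -
      have a': "sharp (u - a)" using a by (rule sharp_orth)
      have "(1 - t) *\<^sub>R L (u - a) c = (1 - t) *\<^sub>R c"
        using L_idem[OF a', of b] by (simp add: c L_scaleR sharp_I a')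
      then have "L (u - a) c = c" using t1 by simp
      then have le: "(u - a) - c \<in> C" using L_le[of "u - a" c] a' c by (simp add: sharp_I)
      then have f: "sharp (a + c)" using sharp_add[OF a c(1)] by (simp add: algebra_simps)
      define g where "g = u - (a + c)"
      have g: "sharp g" using sharp_orth[OF f] by (simp add: g_def)
      have "(u - a) - g \<in> C" using c by (simp add: g_def sharp_C)
      then have ga: "L (u - a) g = g" "com (u - a) g"
        using sharp_above[OF a' sharp_I[OF g]] by auto
      have "(u - g) - c \<in> C" using a by (simp add: g_def sharp_C)
      then have "L g c = 0"
      proof -
        have "L (u - g) c = c" "com (u - g) c"
          using sharp_above[OF sharp_orth[OF g] sharp_I[OF c(1)] \<open>(u - g) - c \<in> C\<close>] by auto
        then have "L c g = 0" using c g by (simp add: com_def L_diff L_u sharp_I)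
        then show ?thesis using L_zero_sym c g sharp_I by blast
      qed
      have "L g b = L g (L (u - a) b)"
        using L_L[OF sharp_I[OF g] sharp_I[OF a'] com_sym[OF ga(2)], of b] ga by (simp add: com_def)
      also have "\<dots> = 0" using \<open>L g c = 0\<close> c(2) by (simp add: L_scaleR sharp_I g)
      finally have "(u - g) - b \<in> C" using L_eq_0_imp(2)[OF g] b sharp_I by blast
      then show ?thesis using f c by (simp add: g_def sharp_C add.commute[of c a])
    qed
    note f = sup[OF ps(1,2) atom_sharp[OF r(1)] r(2)]
    note f' = sup[OF ps(2,1) atom_sharp[OF r'(1)] r'(2)]
    have "(q + r') - (p + r) \<in> C"
      using sharp_sum_le_upper_bound[OF ps(1,2) atom_sharp[OF r(1)] _ _ _ r(2) t1] f' by blast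
    moreover have "(p + r) - (q + r') \<in> C"
      using sharp_sum_le_upper_bound[OF ps(2,1) atom_sharp[OF r'(1)] _ _ _ r'(2) t1] f by blast
    ultimately have "p + r = q + r'" by (intro C_eq_0)
    then have rr': "r = q + r' - p" by (simp add: algebra_simps)
    show ?thesis
      unfolding T_def Lpq r(2) r'(2) by (simp add: rr' algebra_simps)
  qed
qed simp

end

text \<open>Applied to the eigenvalues \<open>w p\<close> of \<open>T p\<close> on a joint Peirce eigenvector. Either one of them is \<open>1\<close>,
  or two of them are \<open>1/2\<close>.\<close>

lemma peirce_weight_identity:
  fixes w c :: "'a \<Rightarrow> real"
  assumes fin: "finite F" and w: "\<And>p. p \<in> F \<Longrightarrow> w p = 0 \<or> w p = 1 / 2 \<or> w p = 1"
    and sum: "sum w F = 1" and c: "\<And>p. p \<in> F \<Longrightarrow> 0 \<le> c p"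
  shows "(\<Prod>p\<in>F. if w p = 0 then 1 else if w p = 1 then c p else sqrt (c p))
    = 2 * (\<Sum>p\<in>F. sqrt (c p) * w p)\<^sup>2 - (\<Sum>p\<in>F. c p * w p)"
proof -
  define m where "m p = (if w p = 0 then 1 else if w p = 1 then c p else sqrt (c p))" for p
  have w0: "0 \<le> w p" if "p \<in> F" for p using w[OF that] by auto
  have zero: "w p = 0" if "p \<in> G" "G \<subseteq> F" "sum w G = 0" for p G
    using that fin w0 sum_nonneg_eq_0_iff[of G w] by (meson finite_subset subsetD)
  have trivial: "prod m G = 1 \<and> (\<Sum>p\<in>G. sqrt (c p) * w p) = 0 \<and> (\<Sum>p\<in>G. c p * w p) = 0"
    if "G \<subseteq> F" "sum w G = 0" for G
    using zero[OF _ that] by (simp add: m_def)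
  show ?thesis
  proof (cases "\<exists>p\<in>F. w p = 1")
    case True
    then obtain p where p: "p \<in> F" "w p = 1" by blast
    then have "sum w (F - {p}) = 0" using sum fin by (simp add: sum_diff1)
    then have "prod m (F - {p}) = 1" "(\<Sum>p\<in>F - {p}. sqrt (c p) * w p) = 0"
      "(\<Sum>p\<in>F - {p}. c p * w p) = 0" using trivial[of "F - {p}"] by auto
    then show ?thesis
      using p fin c[OF p(1)] unfolding m_def[symmetric]
      by (simp add: prod.remove[of F p] sum.remove[of F p]) (simp add: m_def)
  next
    case False
    then have half: "w p = 1 / 2" if "p \<in> F" "w p \<noteq> 0" for p using w[OF that(1)] that by auto
    obtain p where p: "p \<in> F" "w p \<noteq> 0" using sum by (metis sum.neutral zero_neq_one)
    have sp: "sum w (F - {p}) = 1 / 2" using sum fin p half[OF p] by (simp add: sum_diff1)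
    then obtain q where q: "q \<in> F - {p}" "w q \<noteq> 0" by (metis sum.neutral zero_neq_one divide_eq_0_iff zero_neq_numeral)
    then have wq: "w q = 1 / 2" using half by simp
    have "sum w (F - {p} - {q}) = 0" using sp fin q wq by (simp add: sum_diff1)
    then have "prod m (F - {p} - {q}) = 1" "(\<Sum>p\<in>F - {p} - {q}. sqrt (c p) * w p) = 0"
      "(\<Sum>p\<in>F - {p} - {q}. c p * w p) = 0" using trivial[of "F - {p} - {q}"] by auto
    then have "prod m F = m p * m q"
      "(\<Sum>p\<in>F. sqrt (c p) * w p) = sqrt (c p) * w p + sqrt (c q) * w q"
      "(\<Sum>p\<in>F. c p * w p) = c p * w p + c q * w q"
      using p q fin
      by (simp_all add: prod.remove[of F p] sum.remove[of F p] prod.remove[of "F - {p}" q] sum.remove[of "F - {p}" q])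
    moreover have "m p = sqrt (c p)" "m q = sqrt (c q)"
      using half[OF p] wq by (simp_all add: m_def)
    moreover have "2 * (x * (1 / 2) + y * (1 / 2))\<^sup>2 - (x\<^sup>2 * (1 / 2) + y\<^sup>2 * (1 / 2)) = x * y" for x y :: real
      by (simp add: power2_eq_square field_simps)
    from this[of "sqrt (c p)" "sqrt (c q)"]
    have "2 * (sqrt (c p) * w p + sqrt (c q) * w q)\<^sup>2 - (c p * w p + c q * w q) = sqrt (c p) * sqrt (c q)"
      unfolding half[OF p] wq using c[of p] c[of q] p q by simp
    ultimately show ?thesis unfolding m_def[symmetric] by (simp only:)
  qed
qed

context symmetric_sequential_product
begin

section \<open>The Jordan product\<close>

lemma linear_T: "sharp p \<Longrightarrow> linear (T p)"
  using sharp_I[of p] sharp_I[OF sharp_orth, of p]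
  by (intro linearI) (auto simp: T_def L_add L_scaleR algebra_simps)

lemmas T_add = linear_add[OF linear_T]
  and T_scaleR = linear_scale[OF linear_T]
  and T_sum = linear_sum[OF linear_T]

lemma T_symmetric: "sharp p \<Longrightarrow> inner (T p x) y = inner x (T p y)"
  using L_symmetric[OF sharp_I] L_symmetric[OF sharp_I[OF sharp_orth]]
  by (simp add: T_def inner_add inner_diff)

lemma T_u: "sharp p \<Longrightarrow> T p u = p"
  by (simp add: T_def L_u sharp_I I_orth)

lemma L_L_orth: "sharp p \<Longrightarrow> L p (L (u - p) x) = 0" and L_orth_L: "sharp p \<Longrightarrow> L (u - p) (L p x) = 0"
proof -
  assume p: "sharp p"
  have c: "com p (u - p)" using p com_orth[OF _ _ com_refl] sharp_I by blast
  have "L 0 x = 0"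
    using linear_eq_on_I[OF linear_L[OF zero_in_I] linear_zero, of x] com_0 L_0 zero_in_I
    unfolding com_def by metis
  then show "L p (L (u - p) x) = 0"
    using L_L[OF sharp_I[OF p] sharp_I[OF sharp_orth[OF p]] c, of x] p by (simp add: L_sharp_orth)
  then show "L (u - p) (L p x) = 0"
    using L_commute[OF sharp_I[OF p] sharp_I[OF sharp_orth[OF p]] c, of x] by simp
qed

lemma com_sharp_orth: "sharp p \<Longrightarrow> sharp q \<Longrightarrow> com p q \<Longrightarrow> com (u - p) q"
  using com_orth com_sym sharp_I by metis

lemma L_T_commute:
  assumes "sharp p" "sharp q" "com p q"
  shows "L p (T q x) = T q (L p x)"
proof -
  have "com p (u - q)" using com_sharp_orth assms com_sym by blast
  then show ?thesis
    using assms L_commute[of p q x] L_commute[of p "u - q" x]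
    by (simp add: T_def L_add L_diff L_scaleR sharp_I I_orth)
qed

lemma T_commute:
  assumes "sharp p" "sharp q" "com p q"
  shows "T p (T q x) = T q (T p x)"
  using L_T_commute[OF assms, of x] L_T_commute[OF sharp_orth[OF assms(1)] assms(2) com_sharp_orth[OF assms], of x]
  using linear_T[OF assms(2)]
  by (simp add: T_def[of p] linear_add linear_diff linear_scale)

text \<open>On the eigenvalues \<open>0\<close>, \<open>1/2\<close>, \<open>1\<close> of
  \<open>T p\<close> the polynomial \<open>2 w\<^sup>2 - w\<close> is the indicator of
  \<open>1\<close>; the first formula is already the quadratic representation of
  \<open>p\<close>.\<close>

lemma L_eq_T:
  assumes "sharp p"
  shows "L p x = 2 *\<^sub>R T p (T p x) - T p x" and "L (u - p) x = x + L p x - 2 *\<^sub>R T p x"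
proof -
  show *: "L (u - p) x = x + L p x - 2 *\<^sub>R T p x" by (simp add: T_def)
  have "L p (T p x) = L p x"
    using assms by (simp add: T_def L_add L_diff L_scaleR sharp_I L_idem L_L_orth)
  moreover have "L (u - p) (T p x) = 0"
    using assms sharp_orth[OF assms] by (simp add: T_def L_add L_diff L_scaleR sharp_I L_idem L_orth_L)
  ultimately have "T p (T p x) = (1 / 2) *\<^sub>R (T p x + L p x)" by (simp add: T_def[of p "T p x"])
  then show "L p x = 2 *\<^sub>R T p (T p x) - T p x" by simp
qed

lemma frame_com: "frame u F \<Longrightarrow> p \<in> F \<Longrightarrow> q \<in> F \<Longrightarrow> com p q"
  using frame_orth[of F p q] frame_orth[of F q p] by (cases "p = q") (auto simp: com_def)

lemma frame_sharp: "frame u F \<Longrightarrow> p \<in> F \<Longrightarrow> sharp p"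
  by (simp add: frame_def atom_sharp)

definition J :: "'v \<Rightarrow> 'v \<Rightarrow> 'v" where
  "J a b = (let (F, c) = (SOME (F, c). frame u F \<and> a = (\<Sum>p\<in>F. c p *\<^sub>R p))
    in \<Sum>p\<in>F. c p *\<^sub>R T p b)"

text \<open>Since \<open>T p q = T q p\<close> for atoms, the sum does not depend on the spectral decomposition.\<close>

lemma sum_T_swap:
  assumes F: "frame u F" and G: "frame u G"
  shows "(\<Sum>p\<in>F. c p *\<^sub>R T p (\<Sum>q\<in>G. d q *\<^sub>R q)) = (\<Sum>q\<in>G. d q *\<^sub>R T q (\<Sum>p\<in>F. c p *\<^sub>R p))"
proof -
  have "(\<Sum>p\<in>F. c p *\<^sub>R T p (\<Sum>q\<in>G. d q *\<^sub>R q)) = (\<Sum>p\<in>F. \<Sum>q\<in>G. (c p * d q) *\<^sub>R T p q)"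
    using F by (intro sum.cong refl) (simp add: T_sum T_scaleR frame_sharp scaleR_sum_right)
  also have "\<dots> = (\<Sum>q\<in>G. \<Sum>p\<in>F. (c p * d q) *\<^sub>R T q p)"
    using F G by (subst sum.swap) (auto simp: frame_def T_atoms_commute intro!: sum.cong)
  also have "\<dots> = (\<Sum>q\<in>G. d q *\<^sub>R T q (\<Sum>p\<in>F. c p *\<^sub>R p))"
    using G by (intro sum.cong refl) (simp add: T_sum T_scaleR frame_sharp scaleR_sum_right mult.commute)
  finally show ?thesis .
qed

text \<open>After \<open>sum_T_swap\<close> with a decomposition of \<open>b\<close>, the left
  argument enters only as a vector, so the chosen decomposition and the given one yield the same
  value.\<close>

lemma J_eq:
  assumes F: "frame u F"
  shows "J (\<Sum>p\<in>F. c p *\<^sub>R p) b = (\<Sum>p\<in>F. c p *\<^sub>R T p b)"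
proof -
  obtain F' c' where F': "(SOME (F', c'). frame u F' \<and> (\<Sum>p\<in>F. c p *\<^sub>R p) = (\<Sum>p\<in>F'. c' p *\<^sub>R p)) = (F', c')"
    by fastforce
  have "frame u F' \<and> (\<Sum>p\<in>F. c p *\<^sub>R p) = (\<Sum>p\<in>F'. c' p *\<^sub>R p)"
    using someI_ex[of "\<lambda>(F', c'). frame u F' \<and> (\<Sum>p\<in>F. c p *\<^sub>R p) = (\<Sum>p\<in>F'. c' p *\<^sub>R p)"] F
    unfolding F' by auto
  moreover obtain G d where G: "frame u G" "b = (\<Sum>q\<in>G. d q *\<^sub>R q)"
    using spectral_decomposition by blast
  ultimately show ?thesis
    unfolding J_def F' using sum_T_swap[OF _ G(1)] F by (simp add: G(2))
qed

lemma J_commute: "J a b = J b a"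
proof -
  obtain F c where F: "frame u F" "a = (\<Sum>p\<in>F. c p *\<^sub>R p)" using spectral_decomposition by blast
  obtain G d where G: "frame u G" "b = (\<Sum>q\<in>G. d q *\<^sub>R q)" using spectral_decomposition by blast
  show ?thesis
    unfolding F(2) G(2) J_eq[OF F(1)] J_eq[OF G(1)] by (rule sum_T_swap[OF F(1) G(1)])
qed

lemma linear_J: "linear (J a)"
proof -
  obtain F c where F: "frame u F" "a = (\<Sum>p\<in>F. c p *\<^sub>R p)" using spectral_decomposition by blast
  show ?thesis
    unfolding F(2) by (intro linearI)
      (auto simp: J_eq[OF F(1)] T_add T_scaleR frame_sharp[OF F(1)] scaleR_add_right sum.distrib
        scaleR_sum_right mult.commute intro!: sum.cong)
qed

lemmas J_add = linear_add[OF linear_J]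
  and J_diff = linear_diff[OF linear_J]
  and J_scaleR = linear_scale[OF linear_J]

lemma J_diff_left: "J (a - b) x = J a x - J b x"
  using J_diff[of x a b] by (simp add: J_commute)

lemma bilinear_J: "bilinear J"
  unfolding bilinear_def
proof (intro conjI allI linear_J)
  show "linear (\<lambda>x. J x y)" for y
  proof -
    have "(\<lambda>x. J x y) = J y" by (rule ext) (rule J_commute)
    then show ?thesis using linear_J[of y] by simp
  qed
qed

lemma J_symmetric: "inner (J a b) c = inner b (J a c)"
proof -
  obtain F k where F: "frame u F" "a = (\<Sum>p\<in>F. k p *\<^sub>R p)" using spectral_decomposition by blast
  show ?thesis
    unfolding F(2) J_eq[OF F(1)] inner_sum_left inner_sum_right
    using F(1) by (intro sum.cong refl) (simp add: T_symmetric frame_sharp)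
qed

lemma J_u: "J a u = a"
proof -
  obtain F c where F: "frame u F" "a = (\<Sum>p\<in>F. c p *\<^sub>R p)" using spectral_decomposition by blast
  show ?thesis
    unfolding F(2) J_eq[OF F(1)] using F(1) by (intro sum.cong refl) (simp add: T_u frame_sharp)
qed

lemma T_frame:
  assumes F: "frame u F" "p \<in> F" "q \<in> F"
  shows "T p q = (if q = p then p else 0)"
proof (cases "q = p")
  case True
  have "p + p = 2 *\<^sub>R p" by (simp add: scaleR_2)
  then show ?thesis
    using True frame_sharp[OF F(1,2)] by (simp add: T_def sharp_L_self L_orth_sharp)
next
  case False
  have "L p q = 0" using frame_orth F False by metis
  moreover have "L (u - p) q = q"
    using L_eq_0_imp[OF frame_sharp[OF F(1,2)] sharp_I[OF frame_sharp[OF F(1,3)]] \<open>L p q = 0\<close>]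
      sharp_above(1)[OF sharp_orth[OF frame_sharp[OF F(1,2)]]] frame_sharp[OF F(1,3)] sharp_I by blast
  ultimately show ?thesis using False by (simp add: T_def)
qed

lemma J_frame_square:
  assumes F: "frame u F"
  shows "J (\<Sum>p\<in>F. c p *\<^sub>R p) (\<Sum>p\<in>F. c p *\<^sub>R p) = (\<Sum>p\<in>F. (c p)\<^sup>2 *\<^sub>R p)"
proof -
  have "T p (\<Sum>q\<in>F. c q *\<^sub>R q) = c p *\<^sub>R p" if "p \<in> F" for p
  proof -
    have "T p (\<Sum>q\<in>F. c q *\<^sub>R q) = (\<Sum>q\<in>F. if q = p then c p *\<^sub>R p else 0)"
      unfolding T_sum[OF frame_sharp[OF F that]]
      using F that by (intro sum.cong refl) (simp add: T_scaleR frame_sharp T_frame)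
    then show ?thesis using F that by (simp add: frame_def)
  qed
  then show ?thesis unfolding J_eq[OF F] by (simp add: power2_eq_square)
qed

text \<open>An element and its square are decomposed along the same frame, and the operators
  \<open>T p\<close> of a frame commute.\<close>

lemma jordan_identity_J: "J (J a a) (J b a) = J (J (J a a) b) a"
proof -
  obtain F c where F: "frame u F" "a = (\<Sum>p\<in>F. c p *\<^sub>R p)" using spectral_decomposition by blast
  have "J (J a a) (J a b) = J a (J (J a a) b)"
    unfolding F(2) J_frame_square[OF F(1)] unfolding J_eq[OF F(1)]
    using F(1) by (simp add: T_sum T_scaleR frame_sharp scaleR_sum_right)
      (subst sum.swap, auto intro!: sum.cong simp: T_commute frame_sharp frame_com mult.commute)
  then show ?thesis using J_commute[of a b] J_commute[of a "J (J a a) b"] by simp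
qed

section \<open>Positivity, self-duality and uniqueness of square roots\<close>

lemma jordan_nonneg_iff: "jordan_nonneg J v \<longleftrightarrow> v \<in> C"
proof
  assume "jordan_nonneg J v"
  then obtain b where b: "v = J b b" by (auto simp: jordan_nonneg_def)
  obtain F c where F: "frame u F" "b = (\<Sum>p\<in>F. c p *\<^sub>R p)" using spectral_decomposition by blast
  show "v \<in> C"
    unfolding b F(2) J_frame_square[OF F(1)]
    using F(1) by (intro C_sum C_scaleR) (auto simp: frame_sharp sharp_C)
next
  assume v: "v \<in> C"
  obtain F c where F: "frame u F" "v = (\<Sum>p\<in>F. c p *\<^sub>R p)" using spectral_decomposition by blast
  have "v = J (\<Sum>p\<in>F. sqrt (c p) *\<^sub>R p) (\<Sum>p\<in>F. sqrt (c p) *\<^sub>R p)"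
    unfolding J_frame_square[OF F(1)] unfolding F(2)
    using frame_coeff_nonneg[OF F(1), of _ c] v F(2) by (intro sum.cong) auto
  then show "jordan_nonneg J v" by (auto simp: jordan_nonneg_def)
qed

text \<open>Pairing \<open>v\<close> with an atom of its own frame gives its coefficient times a
  positive number.\<close>

lemma C_self_dual: "v \<in> C \<longleftrightarrow> (\<forall>b\<in>C. 0 \<le> inner v b)"
proof (intro iffI ballI)
  assume v: "\<forall>b\<in>C. 0 \<le> inner v b"
  obtain F c where F: "frame u F" "v = (\<Sum>p\<in>F. c p *\<^sub>R p)" using spectral_decomposition by blast
  have "0 \<le> c p" if p: "p \<in> F" for p
  proof -
    have ps: "sharp p" "atom p" using F p by (auto simp: frame_def atom_sharp)
    have "inner v p = inner v (L p p)" by (simp add: sharp_L_self ps)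
    also have "\<dots> = inner (L p v) p" by (simp add: L_symmetric sharp_I ps)
    also have "\<dots> = c p * (norm p)\<^sup>2"
      unfolding F(2) L_frame_sum[OF F(1) p] by (simp add: power2_norm_eq_inner)
    finally have "0 \<le> c p * (norm p)\<^sup>2" using v sharp_C[OF ps(1)] by metis
    then show ?thesis using atom_nonzero[OF ps(2)] by (simp add: zero_le_mult_iff)
  qed
  then show "v \<in> C"
    unfolding F(2) using F(1) by (intro C_sum C_scaleR) (auto simp: frame_sharp sharp_C)
qed (rule inner_C_nonneg)

lemma euclidean_jordan_algebra_J: "euclidean_jordan_algebra J u"
proof
  show "bilinear J" by (rule bilinear_J)
  show "J a b = J b a" for a b by (rule J_commute)
  show "J u a = a" for a by (subst J_commute) (rule J_u)
  show "J (J a a) (J b a) = J (J (J a a) b) a" for a b by (rule jordan_identity_J)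
  show "inner (J a b) c = inner b (J a c)" for a b c by (rule J_symmetric)
  show "jordan_nonneg J a \<longleftrightarrow> (\<forall>b. jordan_nonneg J b \<longrightarrow> 0 \<le> inner a b)" for a
    unfolding jordan_nonneg_iff using C_self_dual[of a] by blast
qed

text \<open>\<open>T p\<close> is the average of the two orthogonal projections \<open>L p\<close>
  and \<open>x - L (u - p) x\<close>, so its form is a sum of squares.\<close>

lemma inner_T_nonneg: "sharp p \<Longrightarrow> 0 \<le> inner (T p x) x"
  and inner_T_eq_0: "sharp p \<Longrightarrow> inner (T p x) x = 0 \<Longrightarrow> T p x = 0"
proof -
  assume p: "sharp p"
  have "inner (L q x) x = (norm (L q x))\<^sup>2" if "sharp q" for q
    using L_symmetric[OF sharp_I[OF that], of x "L q x"] L_idem[OF that, of x]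
    by (simp add: power2_norm_eq_inner inner_commute)
  note q = this[OF p] this[OF sharp_orth[OF p]]
  have eq: "inner (T p x) x = (1 / 2) * ((norm (x - L (u - p) x))\<^sup>2 + (norm (L p x))\<^sup>2)"
    using q by (simp add: T_def inner_add inner_diff power2_norm_eq_inner inner_commute)
  show "0 \<le> inner (T p x) x" unfolding eq by simp
  assume "inner (T p x) x = 0"
  then have "(norm (x - L (u - p) x))\<^sup>2 + (norm (L p x))\<^sup>2 = 0" using eq by simp
  then have "x - L (u - p) x = 0" "L p x = 0" by (simp_all add: add_nonneg_eq_0_iff)
  then show "T p x = 0" by (simp add: T_def)
qed

lemma inner_J_nonneg: "a \<in> C \<Longrightarrow> 0 \<le> inner (J a x) x"
  and inner_J_eq_0: "a \<in> C \<Longrightarrow> inner (J a x) x = 0 \<Longrightarrow> J a x = 0"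
proof -
  assume a: "a \<in> C"
  obtain F c where F: "frame u F" "a = (\<Sum>p\<in>F. c p *\<^sub>R p)" using spectral_decomposition by blast
  have c: "0 \<le> c p" if "p \<in> F" for p
    using frame_coeff_nonneg[OF F(1) that, of c] a F(2) by simp
  have eq: "inner (J a x) x = (\<Sum>p\<in>F. c p * inner (T p x) x)"
    unfolding F(2) J_eq[OF F(1)] by (simp add: inner_sum_left)
  have nonneg: "0 \<le> c p * inner (T p x) x" if "p \<in> F" for p
    using that c F(1) by (intro mult_nonneg_nonneg inner_T_nonneg) (auto simp: frame_sharp)
  then show "0 \<le> inner (J a x) x" unfolding eq by (rule sum_nonneg)
  assume "inner (J a x) x = 0"
  then have "c p * inner (T p x) x = 0" if "p \<in> F" for p
    using sum_nonneg_eq_0_iff[of F "\<lambda>p. c p * inner (T p x) x"] nonneg that F(1)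
    unfolding eq by (simp add: frame_def)
  then have "c p *\<^sub>R T p x = 0" if "p \<in> F" for p
    using that inner_T_eq_0 F(1) by (metis frame_sharp mult_eq_0_iff scaleR_eq_0_iff)
  then show "J a x = 0" unfolding F(2) J_eq[OF F(1)] by (intro sum.neutral ballI)
qed

text \<open>For \<open>d = s - t\<close> one has \<open>J s d + J t d = s\<^sup>2 - t\<^sup>2\<close>, and both summands are positive forms.\<close>

lemma jordan_square_inj:
  assumes st: "s \<in> C" "t \<in> C" "J s s = J t t"
  shows "s = t"
proof -
  define d where "d = s - t"
  have "J s d + J t d = 0"
    using st(3) J_commute[of s t] by (simp add: d_def J_diff)
  then have "inner (J s d) d + inner (J t d) d = 0" by (metis inner_add_left inner_zero_left)
  then have "inner (J s d) d = 0" "inner (J t d) d = 0"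
    using inner_J_nonneg[OF st(1), of d] inner_J_nonneg[OF st(2), of d] by linarith+
  then have "J s d = 0" "J t d = 0" using inner_J_eq_0 st by auto
  then have "J d d = 0" by (simp add: d_def J_diff_left)
  then have "inner d (J d u) = 0" by (metis J_symmetric inner_zero_left)
  then show ?thesis by (simp add: J_u d_def)
qed

lemma jordan_sqrt_eq: "s \<in> C \<Longrightarrow> J s s = a \<Longrightarrow> jordan_sqrt J a = s"
  unfolding jordan_sqrt_def using jordan_square_inj by (intro the_equality) (auto simp: jordan_nonneg_iff)


section \<open>The sequential product as quadratic representation\<close>

text \<open>Along the path the transported atom keeps its trace, which determines
  \<open>norm (L (ray (u - p) r) q)\<close> for all \<open>r\<close>; the square root arises because
  \<open>inner (L (ray (u - p) r) q) q = (norm (L (ray (u - p) (sqrt r)) q))\<^sup>2\<close>.\<close>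

lemma L_ray_peirce:
  assumes p: "atom p" and r: "0 \<le> r" "r \<le> 1"
  shows "L (ray (u - p) r) x = L (u - p) x + r *\<^sub>R L p x + sqrt r *\<^sub>R (x - L p x - L (u - p) x)"
proof (cases "r = 0")
  case True
  then show ?thesis by (simp add: ray_def)
next
  case False
  then have r0: "0 < r" using r by simp
  have ps: "sharp p" using p by (rule atom_sharp)
  have e: "sharp (u - p)" using ps by (rule sharp_orth)
  define A where "A s = L (ray (u - p) s)" for s
  have A_lin: "linear (A s)" if "0 \<le> s" "s \<le> 1" for s
    unfolding A_def using ray_I[OF e that] by (rule linear_L)
  have A_sym: "inner (A s x) y = inner x (A s y)" if "0 \<le> s" "s \<le> 1" for s x y
    unfolding A_def using ray_I[OF e that] by (rule L_symmetric)
  have A_e: "A s (L (u - p) x) = L (u - p) x" and A_p: "A s p = s *\<^sub>R p" if s: "0 \<le> s" "s \<le> 1" for s x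
  proof -
    show "A s (L (u - p) x) = L (u - p) x"
      unfolding A_def using L_L[OF ray_I[OF e s] sharp_I[OF e] com_sym[OF com_ray[OF e s]], of x]
      by (simp add: L_ray_self[OF e s])
    show "A s p = s *\<^sub>R p" using L_ray_orth[OF e s] by (simp add: A_def)
  qed
  have rr: "0 \<le> sqrt r" "sqrt r \<le> 1" "sqrt r * sqrt r = r" using r by auto
  show ?thesis
  proof (rule linear_eq_on_atoms[where f = "L (ray (u - p) r)"
      and g = "\<lambda>x. L (u - p) x + r *\<^sub>R L p x + sqrt r *\<^sub>R (x - L p x - L (u - p) x)"])
    show "linear (L (ray (u - p) r))" using A_lin[OF r] by (simp add: A_def)
    show "linear (\<lambda>x. L (u - p) x + r *\<^sub>R L p x + sqrt r *\<^sub>R (x - L p x - L (u - p) x))"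
      using sharp_I[OF ps] sharp_I[OF e]
      by (intro linearI) (simp_all add: L_add L_scaleR algebra_simps)
    fix q assume q: "atom q"
    have "A r q = L (u - p) q + r *\<^sub>R L p q + sqrt r *\<^sub>R (q - L p q - L (u - p) q)"
    proof (cases "inner p q = 0")
      case True
      then have 0: "L p q = 0" using p by (simp add: L_atom)
      then have "L (u - p) q = q"
        using L_eq_0_imp(2)[OF ps atom_I[OF q]] sharp_above(1)[OF e atom_I[OF q]] by blast
      then show ?thesis using 0 A_e[OF r, of q] by simp
    next
      case ne: False
      define d where "d = (norm q)\<^sup>2"
      define t where "t = inner p q / d"
      have d: "0 < d" using q by (simp add: d_def atom_nonzero)
      have pd: "(norm p)\<^sup>2 = d" using non_orthogonal_atoms_norm_eq[OF p q ne] by (simp add: d_def)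
      have uq: "inner u q = d" using q by (simp add: d_def inner_u_sharp atom_sharp)
      define a where "a = L p q"
      define b where "b = L (u - p) q"
      have a: "a = t *\<^sub>R p" using L_atom[OF p, of q] by (simp add: a_def t_def pd)
      have pq: "inner p q = t * d" using d by (simp add: t_def)
      have idem: "inner (L f q) (L f q) = inner (L f q) q" if "sharp f" for f
        using L_symmetric[OF sharp_I[OF that], of q "L f q"] L_idem[OF that, of q]
        by (simp add: inner_commute)
      have aq: "inner a q = t\<^sup>2 * d" by (simp add: a pq power2_eq_square)
      have aa: "inner a a = t\<^sup>2 * d" using idem[OF ps] aq by (simp add: a_def)
      have ab: "inner a b = 0"
        using L_symmetric[OF sharp_I[OF ps], of q b] L_L_orth[OF ps, of q] by (simp add: a_def b_def)
      \<comment> \<open>The compressed atom is available only for \<open>b\<close> nonzero;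
        otherwise the trace of \<open>b\<close>, which is \<open>(1 - t) * d\<close>,
        vanishes.\<close>
      have bq: "inner b q = (1 - t)\<^sup>2 * d"
      proof (cases "b = 0")
        case True
        have "inner u b = (1 - t) * d"
          using L_symmetric[OF sharp_I[OF e], of u q] e uq pq
          by (simp add: b_def L_u sharp_I inner_diff_left algebra_simps)
        then show ?thesis using True by auto
      next
        case False
        then obtain w where w: "sharp w" "b = (inner (u - p) q / d) *\<^sub>R w" "(norm w)\<^sup>2 = d"
          using compressed_atom_sharp[OF e q] by (auto simp: b_def d_def)
        have "inner (u - p) q / d = 1 - t"
          using d uq pq by (simp add: inner_diff_left field_simps)
        then have "inner b b = (1 - t)\<^sup>2 * d"
          using w by (simp add: power2_eq_square power2_norm_eq_inner[symmetric] flip: w(3))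
        then show ?thesis using idem[OF e] by (simp add: b_def)
      qed
      have bb: "inner b b = (1 - t)\<^sup>2 * d" using idem[OF e] bq by (simp add: b_def)
      have norm_A: "inner (A s q) (A s q) = (1 - t + s * t)\<^sup>2 * d" if s: "0 < s" "s \<le> 1" for s
      proof -
        obtain m v where mv: "atom v" "A s q = m *\<^sub>R v" "inner u v = d"
          using L_ray_atom_trace[OF e s q] unfolding A_def uq by blast
        have "m * d = inner u (A s q)" by (simp add: mv)
        also have "\<dots> = inner (ray (u - p) s) q"
          using A_sym[of s u q] s L_u[OF ray_I[OF e]] by (simp add: A_def)
        also have "\<dots> = (1 - t + s * t) * d"
          by (simp add: ray_def inner_diff_left inner_add_left uq pq algebra_simps)
        finally have "m = 1 - t + s * t" using d by simp
        moreover have "inner v v = d"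
          using inner_u_sharp[OF atom_sharp[OF mv(1)]] mv(3) by (simp add: power2_norm_eq_inner)
        ultimately show ?thesis by (simp add: mv(2) power2_eq_square)
      qed
      have "A (sqrt r) (A (sqrt r) q) = A r q"
        unfolding A_def using L_ray_ray[OF e rr(1,2) rr(1,2)] rr by simp
      then have Aq: "inner (A r q) q = (1 - t + sqrt r * t)\<^sup>2 * d"
        using norm_A[of "sqrt r"] A_sym[OF rr(1,2), of "A (sqrt r) q" q] r0 rr by (simp add: inner_commute)
      have "A r a = r *\<^sub>R a" "A r b = b"
        using A_p[OF r] A_e[OF r, of q] linear_scale[OF A_lin[OF r]] by (simp_all add: a b_def)
      then have Aa: "inner (A r q) a = r * (t\<^sup>2 * d)" and Ab: "inner (A r q) b = (1 - t)\<^sup>2 * d"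
        using A_sym[OF r, of q a] A_sym[OF r, of q b] aq bq inner_commute[of q a] inner_commute[of q b]
        by simp_all
      \<comment> \<open>The value predicted by the Peirce decomposition. Its squared norm, its inner
        product with \<open>A r q\<close> and the squared norm of \<open>A r q\<close> all agree, so
        the two vectors are equal.\<close>
      define M where "M = b + r *\<^sub>R a + sqrt r *\<^sub>R (q - a - b)"
      have "inner (A r q) M = (1 - t + r * t)\<^sup>2 * d"
      proof -
        have "inner (A r q) M = (1 - t)\<^sup>2 * d + r * (r * (t\<^sup>2 * d))
            + sqrt r * ((1 - t + sqrt r * t)\<^sup>2 * d - r * (t\<^sup>2 * d) - (1 - t)\<^sup>2 * d)"
          by (simp add: M_def inner_add_right inner_diff_right Aq Aa Ab)
        also have "\<dots> = (1 - t)\<^sup>2 * d + r * (r * (t\<^sup>2 * d))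
            + (2 * (sqrt r * sqrt r) * t * (1 - t) + sqrt r * (t\<^sup>2 * (sqrt r * sqrt r) - r * t\<^sup>2)) * d"
        proof -
          have "(1 - t)\<^sup>2 * d + r * (r * (t\<^sup>2 * d)) + z * ((1 - t + z * t)\<^sup>2 * d - r * (t\<^sup>2 * d) - (1 - t)\<^sup>2 * d)
              = (1 - t)\<^sup>2 * d + r * (r * (t\<^sup>2 * d)) + (2 * (z * z) * t * (1 - t) + z * (t\<^sup>2 * (z * z) - r * t\<^sup>2)) * d" for z
            by (simp add: power2_eq_square algebra_simps)
          then show ?thesis .
        qed
        also have "\<dots> = (1 - t + r * t)\<^sup>2 * d"
          unfolding rr(3) by (simp add: power2_eq_square algebra_simps)
        finally show ?thesis .
      qed
      moreover have "inner M M = (1 - t + r * t)\<^sup>2 * d"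
      proof -
        define v where "v = q - a - b"
        have "inner q q = d" by (simp add: d_def power2_norm_eq_inner)
        then have v: "inner a v = 0" "inner b v = 0" "inner v v = (1 - t\<^sup>2 - (1 - t)\<^sup>2) * d"
          using aq aa ab bq bb by (simp_all add: v_def inner_diff inner_commute algebra_simps)
        have "inner M M = inner b b + r\<^sup>2 * inner a a + (sqrt r * sqrt r) * inner v v"
          unfolding M_def v_def[symmetric]
          using v ab by (simp add: inner_add inner_commute power2_eq_square)
        also have "\<dots> = (1 - t + r * t)\<^sup>2 * d"
          unfolding rr(3) bb aa v by (simp add: power2_eq_square algebra_simps)
        finally show ?thesis .
      qed
      ultimately have "inner (A r q - M) (A r q - M) = 0"
        using norm_A[OF r0 r(2)] by (simp add: inner_diff inner_commute)
      then show ?thesis by (simp add: M_def a_def b_def)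
    qed
    then show "L (ray (u - p) r) q = L (u - p) q + r *\<^sub>R L p q + sqrt r *\<^sub>R (q - L p q - L (u - p) q)"
      by (simp add: A_def)
  qed
qed

lemma L_ray_eigenvector:
  assumes p: "atom p" and r: "0 \<le> r" "r \<le> 1"
    and x: "T p x = w *\<^sub>R x" and w: "w = 0 \<or> w = 1 / 2 \<or> w = 1"
  shows "L (ray (u - p) r) x = (if w = 0 then 1 else if w = 1 then r else sqrt r) *\<^sub>R x"
proof -
  note ps = atom_sharp[OF p]
  have Lp: "L p x = (2 * w\<^sup>2 - w) *\<^sub>R x"
    using L_eq_T(1)[OF ps, of x] ps by (simp add: x T_scaleR power2_eq_square scaleR_diff_left)
  have Le: "L (u - p) x = (1 + 2 * w\<^sup>2 - 3 * w) *\<^sub>R x"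
  proof -
    have "L (u - p) x = (1 + (2 * w\<^sup>2 - w) - 2 * w) *\<^sub>R x"
      unfolding L_eq_T(2)[OF ps, of x] Lp x
      by (simp only: scaleR_add_left scaleR_diff_left scaleR_one scaleR_scaleR)
    then show ?thesis by simp
  qed
  have "y *\<^sub>R x + r *\<^sub>R z *\<^sub>R x + k *\<^sub>R (x - z *\<^sub>R x - y *\<^sub>R x) = (y + r * z + k * (1 - z - y)) *\<^sub>R x" for y z k
    by (simp add: algebra_simps)
  then have "L (ray (u - p) r) x = ((1 + 2 * w\<^sup>2 - 3 * w) + r * (2 * w\<^sup>2 - w)
      + sqrt r * (1 - (2 * w\<^sup>2 - w) - (1 + 2 * w\<^sup>2 - 3 * w))) *\<^sub>R x"
    unfolding L_ray_peirce[OF p r] Lp Le .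
  then show ?thesis using w by (elim disjE) (simp_all add: power2_eq_square)
qed

text \<open>The effect is a product of the commuting rays \<open>u - (1 - c p) p\<close>, one for
  each atom of the frame, and \<open>L\<close> turns such a product into a composition; each ray
  contributes one factor to the eigenvalue.\<close>

lemma L_frame_eigenvector:
  assumes F: "frame u F" and c: "\<And>p. p \<in> F \<Longrightarrow> 0 \<le> c p \<and> c p \<le> 1"
    and x: "\<And>p. p \<in> F \<Longrightarrow> T p x = w p *\<^sub>R x" and w: "\<And>p. p \<in> F \<Longrightarrow> w p = 0 \<or> w p = 1 / 2 \<or> w p = 1"
  shows "L (\<Sum>p\<in>F. c p *\<^sub>R p) x = (\<Prod>p\<in>F. if w p = 0 then 1 else if w p = 1 then c p else sqrt (c p)) *\<^sub>R x"
proof -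
  define m where "m p = (if w p = 0 then 1 else if w p = 1 then c p else sqrt (c p))" for p
  \<comment> \<open>The partial product: coefficient \<open>c p\<close> on \<open>G\<close> and
    \<open>1\<close> on the other atoms of the frame.\<close>
  define b where "b G = u - (\<Sum>p\<in>G. (1 - c p) *\<^sub>R p)" for G
  have product: "b G \<in> I \<and> L (b G) x = prod m G *\<^sub>R x" if "finite G" "G \<subseteq> F" for G
    using that
  proof (induction G)
    case empty
    then show ?case by (simp add: b_def u_in_I L_u_left)
  next
    case (insert p G)
    then have p: "p \<in> F" and G: "G \<subseteq> F" and IH: "b G \<in> I" "L (b G) x = prod m G *\<^sub>R x" by auto
    have pa: "atom p" using F p by (simp add: frame_def)
    note ps = atom_sharp[OF pa]
    have e: "sharp (u - p)" using ps by (rule sharp_orth)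
    have cp: "0 \<le> c p" "c p \<le> 1" using c[OF p] by auto
    have "L p (\<Sum>q\<in>G. (1 - c q) *\<^sub>R q) = (\<Sum>q\<in>G. (1 - c q) *\<^sub>R L p q)"
      using ps by (simp add: L_sum L_scaleR sharp_I)
    also have "\<dots> = 0"
      using frame_orth[OF F p] G insert.hyps by (intro sum.neutral) auto
    finally have "L p (u - b G) = 0" by (simp add: b_def)
    then have "com p (u - b G)" using L_eq_0_imp(1)[OF ps I_orth[OF IH(1)]] by simp
    then have com: "com p (b G)" using com_orth_iff[OF sharp_I[OF ps] IH(1)] by simp
    have Lp: "L p (b G) = p" using \<open>L p (u - b G) = 0\<close> ps by (simp add: L_diff L_u sharp_I)
    then have bp: "L (b G) p = p" using com by (simp add: com_def)
    have "com (u - p) (b G)"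
      using com_sym[OF com_orth[OF IH(1) sharp_I[OF ps] com_sym[OF com]]] .
    then have Le: "L (u - p) (b G) = b G - p"
      using bp IH(1) by (simp add: com_def L_diff L_u)
    have ray: "ray (u - p) (c p) = u - (1 - c p) *\<^sub>R p"
      by (simp add: ray_def algebra_simps)
    have b_ins: "b (insert p G) = b G - (1 - c p) *\<^sub>R p"
      using insert.hyps by (simp add: b_def)
    have 1: "L (b G) (ray (u - p) (c p)) = b (insert p G)"
      unfolding ray b_ins using IH(1) bp by (simp add: L_diff L_scaleR L_u)
    have 2: "L (ray (u - p) (c p)) (b G) = b (insert p G)"
      unfolding L_ray_peirce[OF pa cp] Lp Le b_ins by (simp add: algebra_simps)
    have rI: "ray (u - p) (c p) \<in> I" using ray_I[OF e cp] .
    have "L (b (insert p G)) x = L (b G) (L (ray (u - p) (c p)) x)"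
      using L_L[OF IH(1) rI, of x] 1 2 by (simp add: com_def)
    also have "\<dots> = prod m (insert p G) *\<^sub>R x"
      using L_ray_eigenvector[OF pa cp x[OF p] w[OF p]] IH insert.hyps
      by (simp add: L_scaleR m_def[of p] mult.commute)
    finally show ?case using L_closed[OF IH(1) rI] 1 by simp
  qed
  have "b F = (\<Sum>p\<in>F. c p *\<^sub>R p)"
    using F by (simp add: b_def scaleR_diff_left sum_subtractf frame_def)
  then show ?thesis using product[of F] F unfolding frame_def m_def[symmetric] by simp
qed

text \<open>Splitting along one Peirce projection after the other decomposes every vector into joint
  eigenvectors.\<close>

lemma span_joint_eigenvectors:
  assumes F: "frame u F"
  shows "x \<in> span {v. \<forall>p\<in>F. \<exists>w\<in>{0, 1 / 2, 1}. T p v = w *\<^sub>R v}"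
proof -
  define S where "S G = {v. \<forall>p\<in>G. \<exists>w\<in>{0, 1 / 2, 1}. T p v = w *\<^sub>R v}" for G
  have "span (S G) = UNIV" if "finite G" "G \<subseteq> F" for G
    using that
  proof (induction G)
    case empty
    then show ?case by (simp add: S_def)
  next
    case (insert p G)
    then have p: "p \<in> F" and G: "G \<subseteq> F" by auto
    note ps = frame_sharp[OF F p]
    have "S G \<subseteq> span (S (insert p G))"
    proof
      fix v assume v: "v \<in> S G"
      have e: "sharp (u - p)" using ps by (rule sharp_orth)
      define v1 where "v1 = L p v"
      define v0 where "v0 = L (u - p) v"
      have L1: "L p v1 = v1" "L (u - p) v1 = 0" and L0: "L p v0 = 0" "L (u - p) v0 = v0"
        by (simp_all add: v1_def v0_def L_idem L_L_orth L_orth_L ps e)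
      have inS: "L' v \<in> S (insert p G)"
        if T': "\<And>q. q \<in> G \<Longrightarrow> T q (L' v) = L' (T q v)" and lin: "\<And>w. L' (w *\<^sub>R v) = w *\<^sub>R L' v"
          and eig: "\<exists>w\<in>{0, 1 / 2, 1}. T p (L' v) = w *\<^sub>R L' v" for L'
        unfolding S_def
      proof (intro CollectI ballI)
        fix q assume "q \<in> insert p G"
        then consider "q = p" | "q \<in> G" by blast
        then show "\<exists>w\<in>{0, 1 / 2, 1}. T q (L' v) = w *\<^sub>R L' v"
        proof cases
          case 1
          then show ?thesis using eig by simp
        next
          case 2
          then obtain w where "w \<in> {0, 1 / 2, 1}" "T q v = w *\<^sub>R v"
            using v unfolding S_def by blast
          then show ?thesis using T'[OF 2] lin by metis
        qed
      qed
      have T1: "T q v1 = L p (T q v)" and T0: "T q v0 = L (u - p) (T q v)" if "q \<in> G" for q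
        using that G p L_T_commute[OF ps frame_sharp[OF F], of q v] L_T_commute[OF e frame_sharp[OF F], of q v]
          frame_com[OF F p] com_sharp_orth[OF ps frame_sharp[OF F]] 
        by (auto simp: v1_def v0_def subset_iff)
      have "v1 \<in> S (insert p G)"
        unfolding v1_def
        by (rule inS) (use T1 L1 ps in \<open>auto simp: v1_def L_scaleR sharp_I T_def\<close>)
      moreover have "v0 \<in> S (insert p G)"
        unfolding v0_def
        by (rule inS) (use T0 L0 e in \<open>auto simp: v0_def L_scaleR sharp_I T_def\<close>)
      moreover have "v - v1 - v0 \<in> S (insert p G)"
        unfolding v1_def v0_def
      proof (rule inS[of "\<lambda>v. v - L p v - L (u - p) v"])
        show "T q (v - L p v - L (u - p) v) = T q v - L p (T q v) - L (u - p) (T q v)" if "q \<in> G" for q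
          using T1[OF that] T0[OF that] that G F
          by (simp add: v1_def v0_def linear_diff[OF linear_T] frame_sharp subset_iff)
        show "w *\<^sub>R v - L p (w *\<^sub>R v) - L (u - p) (w *\<^sub>R v) = w *\<^sub>R (v - L p v - L (u - p) v)" for w
          using ps e by (simp add: L_scaleR sharp_I scaleR_diff_right)
        have "L p (v - v1 - v0) = 0" "L (u - p) (v - v1 - v0) = 0"
          using L1 L0 ps e by (simp_all add: L_diff sharp_I) (simp_all add: v1_def v0_def)
        then have "T p (v - v1 - v0) = (1 / 2) *\<^sub>R (v - v1 - v0)" by (simp add: T_def)
        then show "\<exists>w\<in>{0, 1 / 2, 1}. T p (v - L p v - L (u - p) v) = w *\<^sub>R (v - L p v - L (u - p) v)"
          by (auto simp: v1_def v0_def)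
      qed
      ultimately have "v1 + v0 + (v - v1 - v0) \<in> span (S (insert p G))"
        by (intro span_add span_base)
      then show "v \<in> span (S (insert p G))" by simp
    qed
    then show ?case using insert G by (metis span_minimal subspace_span top.extremum_unique)
  qed
  then show ?thesis using F by (auto simp: frame_def S_def)
qed

text \<open>Both sides are linear, so they are compared on the joint Peirce eigenvectors of a frame
  of \<open>a\<close>, where the claim becomes \<open>peirce_weight_identity\<close>.\<close>

lemma L_eq_jordan_quad:
  assumes a: "a \<in> I"
  shows "L a x = jordan_quad J (jordan_sqrt J a) x"
proof -
  obtain F c where F: "frame u F" "a = (\<Sum>p\<in>F. c p *\<^sub>R p)" using spectral_decomposition by blast
  have c0: "0 \<le> c p" if "p \<in> F" for p
    using frame_coeff_nonneg[OF F(1) that, of c] a F(2) by (simp add: mem_I)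
  have "u - a = (\<Sum>p\<in>F. (1 - c p) *\<^sub>R p)"
    using F by (simp add: scaleR_diff_left sum_subtractf frame_def)
  then have c1: "c p \<le> 1" if "p \<in> F" for p
    using frame_coeff_nonneg[OF F(1) that, of "\<lambda>p. 1 - c p"] a by (simp add: mem_I)
  define s where "s = (\<Sum>p\<in>F. sqrt (c p) *\<^sub>R p)"
  have sC: "s \<in> C"
    unfolding s_def using F(1) c0 by (intro C_sum C_scaleR) (auto simp: frame_sharp sharp_C)
  have ss: "J s s = a"
    unfolding s_def J_frame_square[OF F(1)] F(2) using c0 by (intro sum.cong) auto
  have sqrt: "jordan_sqrt J a = s" using jordan_sqrt_eq[OF sC ss] .
  have "L a x = 2 *\<^sub>R J s (J s x) - J a x"
  proof (rule linear_eq_on[where f = "L a" and g = "\<lambda>x. 2 *\<^sub>R J s (J s x) - J a x"])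
    show "linear (L a)" by (rule linear_L[OF a])
    show "linear (\<lambda>x. 2 *\<^sub>R J s (J s x) - J a x)"
      by (intro linearI) (simp_all add: J_add J_scaleR algebra_simps)
    show "x \<in> span {v. \<forall>p\<in>F. \<exists>w\<in>{0, 1 / 2, 1}. T p v = w *\<^sub>R v}"
      by (rule span_joint_eigenvectors[OF F(1)])
    fix v assume "v \<in> {v. \<forall>p\<in>F. \<exists>w\<in>{0, 1 / 2, 1}. T p v = w *\<^sub>R v}"
    then obtain w where w: "\<And>p. p \<in> F \<Longrightarrow> w p = 0 \<or> w p = 1 / 2 \<or> w p = 1"
      and v: "\<And>p. p \<in> F \<Longrightarrow> T p v = w p *\<^sub>R v" by (auto simp: Bex_def) metis
    have J: "J (\<Sum>p\<in>F. k p *\<^sub>R p) v = (\<Sum>p\<in>F. k p * w p) *\<^sub>R v" for k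
      unfolding J_eq[OF F(1)] scaleR_sum_left by (intro sum.cong) (auto simp: v)
    show "L a v = 2 *\<^sub>R J s (J s v) - J a v"
    proof (cases "v = 0")
      case True
      then show ?thesis using L_0[OF a] linear_0[OF linear_J] by simp
    next
      case False
      \<comment> \<open>The frame sums to \<open>u\<close>, which is the unit for \<open>J\<close>;
        therefore the eigenvalues on a nonzero joint eigenvector sum to \<open>1\<close>.\<close>
      have "u = (\<Sum>p\<in>F. 1 *\<^sub>R p)" using F(1) by (simp add: frame_def)
      then have "v = (\<Sum>p\<in>F. 1 * w p) *\<^sub>R v"
        using J[of "\<lambda>p. 1"] J_u[of v] J_commute[of u v] by metis
      then have "1 *\<^sub>R v = sum w F *\<^sub>R v" by simp
      then have "sum w F = 1" using False by (simp only: scaleR_cancel_right) simp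
      then have "L a v = (2 * (\<Sum>p\<in>F. sqrt (c p) * w p)\<^sup>2 - (\<Sum>p\<in>F. c p * w p)) *\<^sub>R v"
        unfolding F(2) using L_frame_eigenvector[OF F(1) _ v w, of c] c0 c1
          peirce_weight_identity[of F w c] w F(1) by (simp add: frame_def)
      also have "\<dots> = 2 *\<^sub>R J s (J s v) - J a v"
        unfolding s_def F(2) J J_scaleR by (simp add: scaleR_diff_left power2_eq_square)
      finally show ?thesis .
    qed
  qed
  then show ?thesis by (simp add: jordan_quad_def sqrt ss)
qed

end

section \<open>Transfer to the effect space\<close>

lemma associated_space_symmetric_sequential_product:
  fixes C :: "'v::{real_inner,complete_space} set"
  assumes "sequential_effect_space E zero one padd sp scal"
    and "associated_order_unit_space E zero one padd scal C u \<phi>"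
    and symmetric: "\<And>a b c. \<lbrakk>a \<in> E; b \<in> E; c \<in> E\<rbrakk> \<Longrightarrow>
      inner (\<phi> (sp a b)) (\<phi> c) = inner (\<phi> b) (\<phi> (sp a c))"
  shows "symmetric_sequential_product C u (\<lambda>a b. \<phi> (sp (inv_into E \<phi> a) (inv_into E \<phi> b)))"
    (is "symmetric_sequential_product C u ?sq")
proof -
  interpret E: sequential_effect_space E zero one padd sp scal by fact
  interpret order_unit_space C u using assms(2) by (simp add: associated_order_unit_space_def)
  let ?I = "unit_interval C u"
  define \<psi> where "\<psi> = inv_into E \<phi>"
  have iso: "convex_effect_algebra_iso E zero one padd scal ?I 0 u (unit_interval_padd C u) (*\<^sub>R) \<phi>"
    using assms(2) by (simp add: associated_order_unit_space_def)
  then have bij: "bij_betw \<phi> E ?I" and \<phi>0: "\<phi> zero = 0" and \<phi>u: "\<phi> one = u"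
    and padd: "\<And>x y. x \<in> E \<Longrightarrow> y \<in> E \<Longrightarrow> unit_interval_padd C u (\<phi> x) (\<phi> y) = map_option \<phi> (padd x y)"
    by (auto simp: convex_effect_algebra_iso_def)
  have \<phi>I: "\<phi> x \<in> ?I" if "x \<in> E" for x using bij that by (auto simp: bij_betw_def)
  have \<psi>E: "\<psi> a \<in> E" if "a \<in> ?I" for a
    unfolding \<psi>_def using bij that by (metis bij_betw_def inv_into_into)
  have \<psi>\<phi>: "\<psi> (\<phi> x) = x" if "x \<in> E" for x
    unfolding \<psi>_def using bij that by (simp add: bij_betw_def)
  have \<phi>\<psi>: "\<phi> (\<psi> a) = a" if "a \<in> ?I" for a
    unfolding \<psi>_def using bij that by (metis bij_betw_def f_inv_into_f)
  have \<phi>_inj: "\<phi> x = \<phi> y \<Longrightarrow> x = y" if "x \<in> E" "y \<in> E" for x y using that \<psi>\<phi> by metis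
  have \<phi>_padd: "\<phi> z = \<phi> x + \<phi> y" if "x \<in> E" "y \<in> E" "padd x y = Some z" for x y z
    using padd[OF that(1,2)] that(3) by (auto simp: unit_interval_padd_def split: if_splits)
  have \<psi>_padd: "padd (\<psi> a) (\<psi> b) = Some (\<psi> (a + b))" if ab: "a \<in> ?I" "b \<in> ?I" "a + b \<in> ?I" for a b
  proof -
    have "map_option \<phi> (padd (\<psi> a) (\<psi> b)) = Some (a + b)"
      using padd[OF \<psi>E[OF ab(1)] \<psi>E[OF ab(2)]] ab
      by (simp add: unit_interval_padd_def mem_unit_interval \<phi>\<psi>)
    then obtain z where z: "padd (\<psi> a) (\<psi> b) = Some z" "\<phi> z = a + b" by auto
    then have "z \<in> E" using E.padd_closed \<psi>E ab by blast
    then show ?thesis using z \<psi>\<phi> by metis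
  qed
  have orth: "E.orth x = \<psi> (u - \<phi> x)" if x: "x \<in> E" for x
  proof -
    have a: "u - \<phi> x \<in> ?I" using \<phi>I[OF x] by (rule unit_interval_orth)
    then have "padd x (\<psi> (u - \<phi> x)) = Some one"
      using \<psi>_padd[OF \<phi>I[OF x] a] u_in_unit_interval \<psi>\<phi>[OF x] \<psi>\<phi>[OF E.one_closed] \<phi>u by simp
    then show ?thesis
      unfolding E.orth_def using E.orthosupplement[OF x] \<psi>E[OF a] by (intro the1_equality) auto
  qed
  have le: "E.le x y \<longleftrightarrow> \<phi> y - \<phi> x \<in> C" if xy: "x \<in> E" "y \<in> E" for x y
  proof
    assume "E.le x y"
    then obtain z where "z \<in> E" "padd x z = Some y" by (auto simp: E.le_def)
    then show "\<phi> y - \<phi> x \<in> C" using \<phi>_padd xy \<phi>I[of z] by (simp add: mem_unit_interval)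
  next
    assume "\<phi> y - \<phi> x \<in> C"
    then have d: "\<phi> y - \<phi> x \<in> ?I"
      using unit_interval_diff[of "\<phi> x" "\<phi> y"] \<phi>I xy by (simp add: mem_unit_interval)
    then have "padd x (\<psi> (\<phi> y - \<phi> x)) = Some y"
      using \<psi>_padd[OF \<phi>I[OF xy(1)] d] \<phi>I xy \<psi>\<phi> by simp
    then show "E.le x y" using \<psi>E[OF d] by (auto simp: E.le_def)
  qed
  define sq where "sq = ?sq"
  have sq: "sq a b = \<phi> (sp (\<psi> a) (\<psi> b))" for a b by (simp add: sq_def \<psi>_def)
  have \<psi>_sq: "\<psi> (sq a b) = sp (\<psi> a) (\<psi> b)" if "a \<in> ?I" "b \<in> ?I" for a b
    unfolding sq using that by (simp add: \<psi>\<phi> E.sp_closed \<psi>E)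
  have sq_comm: "sq a b = sq b a \<longleftrightarrow> sp (\<psi> a) (\<psi> b) = sp (\<psi> b) (\<psi> a)" if "a \<in> ?I" "b \<in> ?I" for a b
    unfolding sq using that \<phi>_inj E.sp_closed \<psi>E by metis
  have \<psi>_orth: "\<psi> (u - a) = E.orth (\<psi> a)" if "a \<in> ?I" for a
    using that by (simp add: orth \<psi>E \<phi>\<psi>)
  have desc: "E.descending (\<lambda>i. \<psi> (f i))" if "\<And>i :: nat. f i \<in> ?I" "\<And>i. f i - f (Suc i) \<in> C" for f
    unfolding E.descending_def using that by (simp add: le \<psi>E \<phi>\<psi>)
  have inf: "E.is_seq_inf (\<lambda>i. \<psi> (f i)) m \<longleftrightarrow>
      m \<in> E \<and> (\<forall>i. f i - \<phi> m \<in> C) \<and> (\<forall>l\<in>?I. (\<forall>i. f i - l \<in> C) \<longrightarrow> \<phi> m - l \<in> C)"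
    if f: "\<And>i :: nat. f i \<in> ?I" for f m
  proof (cases "m \<in> E")
    case True
    have "(\<forall>l\<in>E. (\<forall>i. f i - \<phi> l \<in> C) \<longrightarrow> \<phi> m - \<phi> l \<in> C) \<longleftrightarrow>
        (\<forall>l\<in>?I. (\<forall>i. f i - l \<in> C) \<longrightarrow> \<phi> m - l \<in> C)"
      using \<phi>I \<psi>E \<phi>\<psi> by metis
    then show ?thesis
      unfolding E.is_seq_inf_def using True f by (simp add: le \<psi>E \<phi>\<psi> cong: ball_cong)
  qed (simp add: E.is_seq_inf_def)
  have "symmetric_sequential_product C u sq"
  \<comment> \<open>The order unit axioms are discharged by the interpretation above; the cases are
    the assumptions on the product, in the order of the locale.\<close>
  proof (unfold_locales, goal_cases)
    case (1 a b)
    then show ?case by (simp add: sq \<phi>I E.sp_closed \<psi>E)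
  next
    case (2 a b c)
    then have "padd (sp (\<psi> a) (\<psi> b)) (sp (\<psi> a) (\<psi> c)) = Some (sp (\<psi> a) (\<psi> (b + c)))"
      by (intro E.sp_padd \<psi>_padd \<psi>E)
    then show ?case unfolding sq using 2 by (intro \<phi>_padd E.sp_closed \<psi>E)
  next
    case (3 a)
    have "\<psi> u = one" using \<psi>\<phi>[OF E.one_closed] \<phi>u by simp
    then show ?case using 3 by (simp add: sq E.sp_one \<psi>E \<phi>\<psi>)
  next
    case (4 a b)
    have "sp (\<psi> a) (\<psi> b) = zero"
    proof (rule \<phi>_inj)
      show "sp (\<psi> a) (\<psi> b) \<in> E" using 4(1,2) by (intro E.sp_closed \<psi>E)
      show "\<phi> (sp (\<psi> a) (\<psi> b)) = \<phi> zero" using 4(3) by (simp only: sq \<phi>0)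
    qed (rule E.zero_closed)
    then have "sp (\<psi> b) (\<psi> a) = zero"
      by (rule E.sp_zero_sym[OF \<psi>E[OF 4(1)] \<psi>E[OF 4(2)]])
    then show ?case by (simp only: sq \<phi>0)
  next
    case (5 a b)
    then show ?case
      using E.commuting_orth[of "\<psi> a" "\<psi> b"] by (simp add: sq_comm unit_interval_orth \<psi>_orth \<psi>E)
  next
    case (6 a b c)
    then have "sp (\<psi> a) (sp (\<psi> b) (\<psi> c)) = sp (sp (\<psi> a) (\<psi> b)) (\<psi> c)"
      by (intro E.commuting_assoc \<psi>E) (simp_all add: sq_comm)
    then show ?case
      unfolding sq[of a "sq b c"] sq[of "sq a b" c] using 6(1,2,4) by (simp add: \<psi>_sq)
  next
    case (7 a b c)
    then have "sp (\<psi> c) (sp (\<psi> a) (\<psi> b)) = sp (sp (\<psi> a) (\<psi> b)) (\<psi> c)"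
      by (intro E.commuting_sp \<psi>E) (simp_all add: sq_comm)
    then show ?case
      unfolding sq[of c "sq a b"] sq[of "sq a b" c] using 7(1-3) by (simp add: \<psi>_sq)
  next
    case (8 a b c)
    then have "sp (\<psi> c) (\<psi> (a + b)) = sp (\<psi> (a + b)) (\<psi> c)"
      by (intro E.commuting_padd[OF _ _ _ _ _ \<psi>_padd] \<psi>E) (simp_all add: sq_comm)
    then show ?case using 8 by (simp add: sq_comm)
  next
    case (9 f)
    then obtain m where "E.is_seq_inf (\<lambda>i. \<psi> (f i)) m" using E.seq_inf_exists[OF desc] by blast
    then show ?case using 9 \<phi>I by (intro bexI[of _ "\<phi> m"]) (simp_all add: inf)
  next
    case (10 f m b)
    have "E.is_seq_inf (\<lambda>i. \<psi> (f i)) (\<psi> m)"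
      unfolding inf[OF 10(1)] \<phi>\<psi>[OF 10(3)] using \<psi>E[OF 10(3)] 10(4,5) by blast
    moreover have "sp (\<psi> b) (\<psi> (f i)) = sp (\<psi> (f i)) (\<psi> b)" for i
      using 10(7)[of i] sq_comm[OF 10(6) 10(1)] by blast
    ultimately have "sp (\<psi> b) (\<psi> m) = sp (\<psi> m) (\<psi> b)"
      using E.commuting_seq_inf[OF desc[of f, OF 10(1,2)] _ \<psi>E[OF 10(6)]] by blast
    then show ?case using sq_comm[OF 10(6) 10(3)] by blast
  next
    case (11 a b c)
    then show ?case
      using symmetric[of "\<psi> a" "\<psi> b" "\<psi> c"] by (simp add: sq \<psi>E \<phi>\<psi>)
  qed
  then show ?thesis by (simp only: sq_def)
qed

theorem theorem5p14:
  fixes E :: "'e set" and zero one :: 'e and padd :: "'e \<Rightarrow> 'e \<Rightarrow> 'e option"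
    and sp :: "'e \<Rightarrow> 'e \<Rightarrow> 'e" and scal :: "real \<Rightarrow> 'e \<Rightarrow> 'e"
    and C :: "'v::{real_inner,complete_space} set" and u :: 'v and \<phi> :: "'e \<Rightarrow> 'v"
  assumes "sequential_effect_space E zero one padd sp scal"
    and "associated_order_unit_space E zero one padd scal C u \<phi>"
    and "\<And>a b c. \<lbrakk>a \<in> E; b \<in> E; c \<in> E\<rbrakk> \<Longrightarrow>
           inner (\<phi> (sp a b)) (\<phi> c) = inner (\<phi> b) (\<phi> (sp a c))"
  shows "\<exists>J :: 'v \<Rightarrow> 'v \<Rightarrow> 'v.
           euclidean_jordan_algebra J u \<and>
           (\<forall>v. v \<in> C \<longleftrightarrow> jordan_nonneg J v) \<and>
           (\<forall>a\<in>E. \<forall>b\<in>E. \<phi> (sp a b) = jordan_quad J (jordan_sqrt J (\<phi> a)) (\<phi> b))"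
proof -
  define sq where "sq = (\<lambda>a b. \<phi> (sp (inv_into E \<phi> a) (inv_into E \<phi> b)))"
  interpret V: symmetric_sequential_product C u sq
    unfolding sq_def
    by (rule associated_space_symmetric_sequential_product[OF assms(1,2)]) (rule assms(3))
  have bij: "bij_betw \<phi> E (unit_interval C u)"
    using assms(2) by (simp add: associated_order_unit_space_def convex_effect_algebra_iso_def)
  have "\<phi> (sp a b) = jordan_quad V.J (jordan_sqrt V.J (\<phi> a)) (\<phi> b)" if "a \<in> E" "b \<in> E" for a b
  proof -
    have "\<phi> a \<in> unit_interval C u" "\<phi> b \<in> unit_interval C u"
      using bij that by (auto simp: bij_betw_def)
    moreover have "\<phi> (sp a b) = sq (\<phi> a) (\<phi> b)"
      using bij that by (simp add: sq_def bij_betw_def)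
    ultimately show ?thesis using V.L_eq_jordan_quad V.L_eq by metis
  qed
  then show ?thesis
    using V.euclidean_jordan_algebra_J V.jordan_nonneg_iff by blast
qed

end
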